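(* Let $u>0$, $d\ge 3$ and $M\ge 1$. For each $N\ge 1$ let $x_1,\dots,x_M$ (depending on $N$) be points of $\mathbb{T}=(\mathbb{Z}/N\mathbb{Z})^d$ such that $$\lim_{N\to\infty}\ \inf_{1\le i\ne j\le M}|x_i-x_j|_\infty=\infty .$$ Then the $(\{0,1\}^{\mathbb{Z}^d})^M$-valued random variables $(\omega_{x_1,uN^d},\dots,\omega_{x_M,uN^d})$ converge in distribution, under $P$, to $\mathbb{Q}_u^{\otimes M}$ as $N\to\infty$.
   Context: For $N\ge1$, $\mathbb{T}=(\mathbb{Z}/N\mathbb{Z})^d$ is the discrete torus, $\pi_{\mathbb{T}}:\mathbb{Z}^d\to\mathbb{T}$ is the canonical projection, and $|x-x'|_\infty$ denotes the $\ell_\infty$-distance on $\mathbb{T}$ (the minimum of $|z-z'|_\infty$ over representatives $z,z'\in\mathbb{Z}^d$ of $x,x'$). If $M=1$ the hypothesis on the mutual distances is vacuous. $P$ is the law on $\mathbb{T}^{\mathbb{N}}$ of simple (nearest-neighbor) random walk $(X_n)_{n\ge0}$ on $\mathbb{T}$ whose starting point $X_0$ is uniformly distributed on $\mathbb{T}$. For $x\in\mathbb{T}$ and $t\ge0$, the vacant configuration left by the walk in the neighborhood of $x$ at time $t$ is the $\{0,1\}^{\mathbb{Z}^d}$-valued random variable $$\omega_{x,t}(z)=1\{X_m\ne \pi_{\mathbb{T}}(z)+x\ \text{for all } 0\le m\le [t]\},\qquad z\in\mathbb{Z}^d,$$ where $[t]$ is the integer part of $t$. The space $\{0,1\}^{\mathbb{Z}^d}$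 carries the product topology and product $\sigma$-algebra, with canonical coordinates $\omega(x)$, $x\in\mathbb{Z}^d$. For a finite set $K\subseteq\mathbb{Z}^d$, the capacity is $\mathrm{cap}(K)=\sum_{x\in K}P^{\mathbb{Z}^d}_x[\tilde H_K=\infty]$, where $P^{\mathbb{Z}^d}_x$ is the law of simple random walk on $\mathbb{Z}^d$ started at $x$ and $\tilde H_K=\inf\{n\ge1:X_n\in K\}$. $\mathbb{Q}_u$ is the law on $\{0,1\}^{\mathbb{Z}^d}$ of the indicator function of the vacant set of random interlacements at level $u$; it is the unique probability measure on $\{0,1\}^{\mathbb{Z}^d}$ such that $$\mathbb{Q}_u[\omega(x)=1\ \text{for all }x\in K]=\exp\{-u\,\mathrm{cap}(K)\}\quad\text{for all finite } K\subseteq\mathbb{Z}^d.$$ $\mathbb{Q}_u^{\otimes M}$ is the $M$-fold product measure. *)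

theory Defs
  imports "HOL-Probability.Probability"
begin

text \<open>
  \<open>\<int>\<^sup>d\<close> is \<^typ>\<open>int ^ 'd\<close>, with \<open>d = CARD('d)\<close>.  Elements of
  \<open>(\<int>/N\<int>)\<^sup>d\<close> are represented by their canonical representatives with coordinates in
  \<open>{0..<N}\<close>, so the canonical projection is the coordinatewise remainder.
  The case \<open>N = 0\<close> is degenerate and plays no role, as only \<open>N \<rightarrow> \<infinity>\<close> matters.
\<close>

definition torus :: "nat \<Rightarrow> (int ^ 'd) set" where
  "torus N = {x. \<forall>i. x $ i \<in> {0..<int N}}"

definition torus_proj :: "nat \<Rightarrow> int ^ 'd \<Rightarrow> int ^ 'd" where
  "torus_proj N z = (\<chi> i. z $ i mod int N)"

definition torus_add :: "nat \<Rightarrow> int ^ 'd \<Rightarrow> int ^ 'd \<Rightarrow> int ^ 'd" where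
  "torus_add N x y = torus_proj N (x + y)"

definition sup_norm :: "int ^ 'd::finite \<Rightarrow> nat" where
  "sup_norm z = Max (range (\<lambda>i. nat \<bar>z $ i\<bar>))"

definition torus_dist :: "nat \<Rightarrow> int ^ 'd::finite \<Rightarrow> int ^ 'd \<Rightarrow> nat" where
  "torus_dist N x x' =
     Inf {sup_norm (z - z') | z z'. torus_proj N z = x \<and> torus_proj N z' = x'}"


definition unit_steps :: "(int ^ 'd::finite) set" where
  "unit_steps = {axis i s | i s. s \<in> {-1, 1}}"

definition step_measure :: "(nat \<Rightarrow> int ^ 'd::finite) measure" where
  "step_measure = PiM UNIV (\<lambda>_. measure_pmf (pmf_of_set unit_steps))"

definition srw :: "int ^ 'd::finite \<Rightarrow> (nat \<Rightarrow> int ^ 'd) measure" where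
  "srw x = distr step_measure (PiM UNIV (\<lambda>_. count_space UNIV))
     (\<lambda>\<xi> n. x + (\<Sum>k<n. \<xi> k))"

text \<open>
  For \<open>N \<le> 2\<close> distinct unit steps can project to the same element of the torus; the walk
  then follows the multigraph of projected edges.
\<close>

definition torus_walk :: "nat \<Rightarrow> (nat \<Rightarrow> int ^ 'd::finite) measure" where
  "torus_walk N =
     distr (measure_pmf (pmf_of_set (torus N)) \<Otimes>\<^sub>M step_measure)
       (PiM UNIV (\<lambda>_. count_space (torus N)))
       (\<lambda>(x, \<xi>) n. torus_add N x (torus_proj N (\<Sum>k<n. \<xi> k)))"


text \<open>
  \<open>{0,1}\<close> is rendered as \<^typ>\<open>bool\<close> with its discrete topology (\<open>1\<close> is \<open>True\<close>, i.e. vacant);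
  function types carry the product topology.
\<close>

type_synonym 'd config = "(int, 'd) vec \<Rightarrow> bool"

definition config_algebra :: "'d::finite config measure" where
  "config_algebra = PiM UNIV (\<lambda>_. count_space UNIV)"

instance bool :: second_countable_topology
proof
  have "open A \<longleftrightarrow> generate_topology UNIV A" for A :: "bool set"
    by (simp add: Topological_Spaces.open_discrete generate_topology.Basis)
  then have "open = generate_topology (UNIV :: bool set set)"
    by blast
  then show "\<exists>B :: bool set set. countable B \<and> open = generate_topology B"
    by (intro exI[of _ UNIV]) (simp add: countable_finite)
qed

lemma sets_config_algebra:
  "sets (config_algebra :: 'd::finite config measure) = sets borel"
proof -
  have "sets (config_algebra :: 'd config measure) =
      sets (PiM UNIV (\<lambda>_ :: int ^ 'd. borel :: bool measure))"
    unfolding config_algebra_def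
    by (intro sets_PiM_cong) (auto simp: sets_borel_eq_count_space)
  then show ?thesis
    by (simp only: sets_PiM_equal_borel)
qed

lemma sets_PiM_config_algebra:
  "sets (PiM UNIV (\<lambda>_ :: 'm::finite. config_algebra :: 'd::finite config measure)) = sets borel"
proof -
  have "sets (PiM UNIV (\<lambda>_ :: 'm. config_algebra :: 'd config measure)) =
      sets (PiM UNIV (\<lambda>_ :: 'm. borel :: 'd config measure))"
    by (intro sets_PiM_cong) (auto simp: sets_config_algebra)
  then show ?thesis
    by (simp only: sets_PiM_equal_borel)
qed

definition vacant_config ::
    "nat \<Rightarrow> int ^ 'd::finite \<Rightarrow> real \<Rightarrow> (nat \<Rightarrow> int ^ 'd) \<Rightarrow> 'd config" where
  "vacant_config N x t X =
     (\<lambda>z. \<forall>m. m \<le> nat \<lfloor>t\<rfloor> \<longrightarrow> X m \<noteq> torus_add N (torus_proj N z) x)"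


definition return_time :: "'a set \<Rightarrow> (nat \<Rightarrow> 'a) \<Rightarrow> enat" where
  "return_time K X = (INF n\<in>{n. n \<ge> 1 \<and> X n \<in> K}. enat n)"

definition capacity :: "(int ^ 'd::finite) set \<Rightarrow> real" where
  "capacity K = (\<Sum>x\<in>K. measure (srw x) {X \<in> space (srw x). return_time K X = \<infinity>})"

definition interlacement_law :: "real \<Rightarrow> 'd::finite config measure" where
  "interlacement_law u = (THE Q. prob_space Q \<and> sets Q = sets config_algebra \<and>
     (\<forall>K. finite K \<longrightarrow>
        measure Q {\<omega> \<in> space Q. \<forall>x\<in>K. \<omega> x} = exp (- u * capacity K)))"


text \<open>
  The test functions are meant to be measurable for the measures involved, which
  for configurations follows from \<open>sets_PiM_config_algebra\<close>.
\<close>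

definition weakly_converges ::
    "(nat \<Rightarrow> 'a::topological_space measure) \<Rightarrow> 'a measure \<Rightarrow> bool" where
  "weakly_converges \<mu> \<nu> \<longleftrightarrow>
     (\<forall>f :: 'a \<Rightarrow> real. continuous_on UNIV f \<and> bounded (range f) \<longrightarrow>
        (\<lambda>n. \<integral>\<omega>. f \<omega> \<partial>\<mu> n) \<longlonglongrightarrow> (\<integral>\<omega>. f \<omega> \<partial>\<nu>))"

end

(* Let F(t) be the sum over the torus of the probabilities of avoiding a set A up to time t.
   Stationarity gives F(t) - F(t + 1) = sum over a in A of P_a[no visit to A in {1..t + 1}], and the
   walk that escapes from A mixes before it could return, so this sum is close to cap * F(t) / N^d:
   a discrete Gronwall argument yields F(u N^d) / N^d -> exp (- u cap).  Both the transience estimate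
   and the mixing follow from the Fourier expansion of the heat kernel on the torus.  For distant
   points x_i the escape probabilities decouple and cap is the sum of the capacities.  Cylinder
   probabilities determine weak convergence by compactness, and the case M = 1 provides, through
   Kolmogorov's extension theorem, the law Q_u itself. *)

theory Submission
  imports Defs
begin

section \<open>The averaging operator\<close>

text \<open>Avoidance probabilities are iterates of the one-step operator \<open>avg\<close>, with
  or without killing on \<open>A\<close>, acting on functions on the lattice; measures on path space
  enter only after the survival limit. Three time scales are kept apart: \<open>n\<close> fixed for
  the escape, a multiple \<kappa> N^2 for the mixing, and N^d for the level u. Dimension at least 3
  acts twice: it makes N^2 negligible against N^d and j^(-d/2) summable. First N tends to infinity;
  the errors left over, of order 1 / \<kappa> and \<open>heat_tail n\<close>, are made small
  afterwards. For even \<open>N\<close> the walk has period 2: -1 is an eigenvalue and the law at a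
  single time does not approach the uniform one. Mixing is therefore proved for averages over a
  window of times, and survival at the end of the window is compared with that average. At fixed
  \<open>n\<close> the escape sum sees only \<open>n\<close> + 1 steps around each point, so for
  distant points and large \<open>N\<close> it equals the sum of the lattice escape sums exactly.
  The cylinder weights of Q_u are nonnegative because they are limits of probabilities for the torus
  walk; this is not read off from exp (- u cap).\<close>

lemma unit_steps_eq: "unit_steps = (\<lambda>(i, s). axis i s) ` (UNIV \<times> {-1, 1})"
  unfolding unit_steps_def by auto

lemma finite_unit_steps [simp]: "finite unit_steps"
  unfolding unit_steps_eq by simp

lemma sum_unit_steps:
  fixes g :: "int ^ 'd::finite \<Rightarrow> 'b::comm_monoid_add"
  shows "(\<Sum>e\<in>unit_steps. g e) = (\<Sum>i\<in>UNIV. g (axis i (-1)) + g (axis i 1))"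
proof -
  have "inj_on (\<lambda>(i, s). axis i s :: int ^ 'd) (UNIV \<times> {-1, 1})"
    by (auto simp: inj_on_def axis_eq_axis)
  then have "(\<Sum>e\<in>unit_steps. g e) = (\<Sum>(i, s)\<in>UNIV \<times> {-1, 1}. g (axis i s))"
    unfolding unit_steps_eq by (subst sum.reindex) (auto simp: case_prod_unfold)
  also have "\<dots> = (\<Sum>i\<in>UNIV. \<Sum>s\<in>{-1, 1}. g (axis i s))"
    by (rule sum.cartesian_product [symmetric])
  finally show ?thesis by simp
qed

lemma card_unit_steps: "card (unit_steps :: (int ^ 'd::finite) set) = 2 * CARD('d)"
  using sum_unit_steps [of "\<lambda>_ :: int ^ 'd. 1 :: nat"] by simp

lemma unit_steps_nonempty [simp]: "unit_steps \<noteq> {}"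
  by (metis card_unit_steps card.empty mult_eq_0_iff zero_neq_numeral zero_less_card_finite
      less_irrefl)

definition avg :: "(int ^ 'd::finite \<Rightarrow> real) \<Rightarrow> int ^ 'd \<Rightarrow> real" where
  "avg g z = (\<Sum>e\<in>unit_steps. g (z + e)) / real (card (unit_steps :: (int ^ 'd) set))"

lemma avg_mono: "(\<And>z. f z \<le> g z) \<Longrightarrow> avg f z \<le> avg g z"
  unfolding avg_def by (intro divide_right_mono sum_mono) auto

lemma avg_const [simp]: "avg (\<lambda>_. c) z = c"
  unfolding avg_def by (simp add: card_unit_steps)

lemma avg_cmult: "avg (\<lambda>z. c * f z) z = c * avg f z"
  unfolding avg_def by (simp add: sum_distrib_left)

lemma avg_diff: "avg (\<lambda>z. f z - g z) z = avg f z - avg g z"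
  unfolding avg_def by (simp add: sum_subtractf diff_divide_distrib)

lemma avg_sum: "avg (\<lambda>z. \<Sum>i\<in>I. f i z) z = (\<Sum>i\<in>I. avg (f i) z)"
  unfolding avg_def by (subst sum.swap) (simp add: sum_divide_distrib)

lemma avg_power_mono: "(\<And>z. f z \<le> g z) \<Longrightarrow> (avg ^^ n) f z \<le> (avg ^^ n) g z"
  by (induction n arbitrary: z) (auto intro: avg_mono)

lemma avg_cong: "(\<And>z. f z = g z) \<Longrightarrow> avg f z = avg g z"
  by presburger

lemma avg_power_const [simp]: "(avg ^^ n) (\<lambda>_. c) z = c"
proof (induction n arbitrary: z)
  case (Suc n)
  show ?case using avg_cong [where z = z, OF Suc] by simp
qed simp

lemma avg_power_diff: "(avg ^^ n) (\<lambda>z. f z - g z) z = (avg ^^ n) f z - (avg ^^ n) g z"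
proof (induction n arbitrary: z)
  case (Suc n)
  then have "(avg ^^ n) (\<lambda>z. f z - g z) = (\<lambda>z. (avg ^^ n) f z - (avg ^^ n) g z)" by blast
  then show ?case by (simp add: avg_diff)
qed simp

lemma avg_power_cmult: "(avg ^^ n) (\<lambda>z. c * f z) z = c * (avg ^^ n) f z"
proof (induction n arbitrary: z)
  case (Suc n)
  then have "(avg ^^ n) (\<lambda>z. c * f z) = (\<lambda>z. c * (avg ^^ n) f z)" by blast
  then show ?case by (simp add: avg_cmult)
qed simp

lemma avg_power_sum: "(avg ^^ n) (\<lambda>z. \<Sum>i\<in>I. f i z) z = (\<Sum>i\<in>I. (avg ^^ n) (f i) z)"
proof (induction n arbitrary: z)
  case (Suc n)
  then have "(avg ^^ n) (\<lambda>z. \<Sum>i\<in>I. f i z) = (\<lambda>z. \<Sum>i\<in>I. (avg ^^ n) (f i) z)" by blast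
  then show ?case by (simp add: avg_sum)
qed simp

section \<open>Periodic functions\<close>

lemma torus_proj_nth [simp]: "torus_proj N z $ i = z $ i mod int N"
  by (simp add: torus_proj_def)

lemma torus_proj_in_torus [simp]: "N \<ge> 1 \<Longrightarrow> torus_proj N z \<in> torus N"
  by (simp add: torus_def)

lemma torus_proj_of_torus: "z \<in> torus N \<Longrightarrow> torus_proj N z = z"
  by (simp add: torus_def vec_eq_iff)

lemma torus_proj_eq_iff: "torus_proj N z = torus_proj N w \<longleftrightarrow> (\<forall>i. int N dvd z $ i - w $ i)"
  by (simp add: vec_eq_iff mod_eq_dvd_iff)

lemma torus_proj_add_left: "torus_proj N (torus_proj N z + w) = torus_proj N (z + w)"
  by (simp add: vec_eq_iff mod_simps)

lemma torus_proj_add_right: "torus_proj N (z + torus_proj N w) = torus_proj N (z + w)"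
  by (simp add: vec_eq_iff mod_simps)

lemma torus_proj_idem [simp]: "torus_proj N (torus_proj N z) = torus_proj N z"
  by (simp add: vec_eq_iff)

lemma bij_betw_torus_PiE:
  "bij_betw vec_nth (torus N :: (int ^ 'd::finite) set) (PiE UNIV (\<lambda>_. {0..<int N}))"
  by (rule bij_betw_byWitness [where f' = vec_lambda]) (auto simp: torus_def)

lemma finite_torus [simp]: "finite (torus N)"
  using bij_betw_finite [OF bij_betw_torus_PiE] by (simp add: finite_PiE)

lemma card_torus: "card (torus N :: (int ^ 'd::finite) set) = N ^ CARD('d)"
  using bij_betw_same_card [OF bij_betw_torus_PiE [where 'd = 'd and N = N]] by (simp add: card_PiE)

lemma torus_nonempty: "N \<ge> 1 \<Longrightarrow> torus N \<noteq> {}"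
  using torus_proj_in_torus by blast

text \<open>Functions on the torus are represented by their lifts, so that one operator
  \<open>avg\<close> serves both the walk on the lattice and the walk on the torus.\<close>

definition periodic :: "nat \<Rightarrow> (int ^ 'd::finite \<Rightarrow> 'b) \<Rightarrow> bool" where
  "periodic N g \<longleftrightarrow> (\<forall>z. g (torus_proj N z) = g z)"

lemma periodicD: "periodic N g \<Longrightarrow> g (torus_proj N z) = g z"
  by (simp add: periodic_def)

lemma periodic_shift:
  assumes "periodic N g" shows "g (torus_proj N z + w) = g (z + w)"
  using periodicD [OF assms] by (metis torus_proj_add_left)

lemma periodic_avg: "periodic N g \<Longrightarrow> periodic N (avg g)"
  unfolding periodic_def [of _ "avg g"] avg_def by (simp add: periodic_shift)

text \<open>Translation followed by reduction modulo \<open>N\<close> permutes the canonical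
  representatives.\<close>

lemma sum_torus_shift:
  fixes g :: "int ^ 'd::finite \<Rightarrow> real"
  assumes "N \<ge> 1" "periodic N g"
  shows "(\<Sum>x\<in>torus N. g (x + e)) = (\<Sum>x\<in>torus N. g x)"
proof (rule sum.reindex_bij_witness
    [where i = "\<lambda>x. torus_proj N (x - e)" and j = "\<lambda>x. torus_proj N (x + e)"])
  fix a :: "int ^ 'd" assume "a \<in> torus N"
  then show "torus_proj N (torus_proj N (a + e) - e) = a"
    "torus_proj N (torus_proj N (a - e) + e) = a"
    using torus_proj_add_left [of N "a + e" "- e"] torus_proj_add_left [of N "a - e" e]
    by (simp_all add: torus_proj_of_torus)
qed (use assms in \<open>auto simp: periodicD\<close>)

text \<open>Invariance of the uniform distribution under the walk.\<close>

lemma sum_torus_avg: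
  fixes g :: "int ^ 'd::finite \<Rightarrow> real"
  assumes "N \<ge> 1" "periodic N g"
  shows "(\<Sum>x\<in>torus N. avg g x) = (\<Sum>x\<in>torus N. g x)"
proof -
  have "(\<Sum>x\<in>torus N. avg g x) =
      (\<Sum>e\<in>unit_steps. \<Sum>x\<in>torus N. g (x + e)) / real (card (unit_steps :: (int ^ 'd) set))"
    unfolding avg_def sum_divide_distrib [symmetric] by (subst sum.swap) simp
  also have "\<dots> = (\<Sum>x\<in>torus N. g x)"
    by (simp add: sum_torus_shift [OF assms] card_unit_steps)
  finally show ?thesis .
qed

section \<open>Survival probabilities\<close>

text \<open>\<open>surv A t z\<close> is the probability that simple random walk started at \<open>z\<close> avoids \<open>A\<close>
  during \<open>{0..t}\<close>; hence \<open>avg (surv A t) z\<close> is the probability that it avoids \<open>A\<close> during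
  \<open>{1..t + 1}\<close>.\<close>

definition kill :: "(int ^ 'd::finite) set \<Rightarrow> (int ^ 'd \<Rightarrow> real) \<Rightarrow> int ^ 'd \<Rightarrow> real" where
  "kill A g z = (if z \<in> A then 0 else avg g z)"

definition surv :: "(int ^ 'd::finite) set \<Rightarrow> nat \<Rightarrow> int ^ 'd \<Rightarrow> real" where
  "surv A t = (kill A ^^ t) (indicator (- A))"

lemma surv_0: "surv A 0 = indicator (- A)"
  by (simp add: surv_def)

lemma surv_Suc: "surv A (Suc t) z = (if z \<in> A then 0 else avg (surv A t) z)"
  by (simp add: surv_def kill_def)

lemma surv_add: "surv A (n + k) = (kill A ^^ n) (surv A k)"
  by (simp add: surv_def funpow_add)

text \<open>Killing the constant 1 once already gives the indicator of the complement, hence the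
  shift by one. In this form survival is what the killed iterates make of constants.\<close>

lemma surv_conv_kill_one: "surv A n = (kill A ^^ Suc n) (\<lambda>_. 1)"
proof -
  have "kill A (\<lambda>_. 1) = indicator (- A)" by (auto simp: kill_def fun_eq_iff)
  then show ?thesis by (simp add: surv_def funpow_Suc_right del: funpow.simps)
qed

lemma surv_bounds: "0 \<le> surv A t z" "surv A t z \<le> 1"
proof (induction t arbitrary: z)
  case 0
  { case 1 show ?case by (simp add: surv_0) }
  { case 2 show ?case by (simp add: surv_0 indicator_def) }
next
  case (Suc t)
  { case 1 show ?case using avg_mono [of "\<lambda>_. 0" "surv A t" z] Suc by (simp add: surv_Suc) }
  { case 2 show ?case using avg_mono [of "surv A t" "\<lambda>_. 1" z] Suc by (simp add: surv_Suc) }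
qed

lemma avg_surv_bounds: "0 \<le> avg (surv A t) z" "avg (surv A t) z \<le> 1"
  using avg_mono [of "\<lambda>_. 0" "surv A t" z] avg_mono [of "surv A t" "\<lambda>_. 1" z]
  by (simp_all add: surv_bounds)

lemma surv_Suc_le: "surv A (Suc t) z \<le> surv A t z"
proof (induction t arbitrary: z)
  case 0
  then show ?case using avg_surv_bounds(2) [of A 0 z] by (simp add: surv_0 surv_Suc indicator_def)
next
  case (Suc t)
  then show ?case using avg_mono [of "surv A (Suc t)" "surv A t" z] by (auto simp: surv_Suc)
qed

lemma surv_antimono: "s \<le> t \<Longrightarrow> surv A t z \<le> surv A s z"
  by (rule lift_Suc_antimono_le [of "\<lambda>t. surv A t z"]) (simp_all add: surv_Suc_le)

section \<open>Occupation probabilities and the comparison of the killed walk with the free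
  walk\<close>

definition hit_mass :: "(int ^ 'd::finite) set \<Rightarrow> nat \<Rightarrow> int ^ 'd \<Rightarrow> real" where
  "hit_mass A j = (avg ^^ j) (indicator A)"

lemma hit_mass_Suc: "hit_mass A (Suc j) = avg (hit_mass A j)"
  by (simp add: hit_mass_def)

lemma avg_power_hit_mass: "(avg ^^ n) (hit_mass A j) = hit_mass A (n + j)"
  by (simp add: hit_mass_def funpow_add)

lemma hit_mass_nonneg: "0 \<le> hit_mass A j z"
  using avg_power_mono [of "\<lambda>_. 0" "indicator A" j z] by (simp add: hit_mass_def)

lemma kill_le_avg: "(\<And>z. 0 \<le> g z) \<Longrightarrow> kill A g z \<le> avg g z"
  using avg_mono [of "\<lambda>_. 0" g z] by (simp add: kill_def)

lemma kill_mono: "(\<And>z. f z \<le> g z) \<Longrightarrow> kill A f z \<le> kill A g z"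
  by (simp add: kill_def avg_mono)

lemma kill_power_mono: "(\<And>z. f z \<le> g z) \<Longrightarrow> (kill A ^^ n) f z \<le> (kill A ^^ n) g z"
  by (induction n arbitrary: z) (auto intro: kill_mono)

lemma kill_cong: "(\<And>z. f z = g z) \<Longrightarrow> kill A f z = kill A g z"
  by presburger

lemma kill_power_diff: "(kill A ^^ n) (\<lambda>z. f z - g z) z = (kill A ^^ n) f z - (kill A ^^ n) g z"
proof (induction n arbitrary: z)
  case (Suc n)
  have diff: "kill A (\<lambda>z. f z - g z) z = kill A f z - kill A g z" for f g
    by (simp add: kill_def avg_diff)
  show ?case using kill_cong [where A = A and z = z, OF Suc] by (simp add: diff)
qed simp

lemma kill_power_const: "(kill A ^^ n) (\<lambda>_. c) z = c * (kill A ^^ n) (\<lambda>_. 1) z"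
proof (induction n arbitrary: z)
  case (Suc n)
  have cmult: "kill A (\<lambda>z. c * f z) z = c * kill A f z" for f
    by (simp add: kill_def avg_cmult)
  show ?case using kill_cong [where A = A and z = z, OF Suc] by (simp add: cmult)
qed simp

lemma kill_power_nonneg: "(\<And>z. 0 \<le> g z) \<Longrightarrow> 0 \<le> (kill A ^^ n) g z"
  using kill_power_mono [where A = A and n = n and f = "\<lambda>_. 0" and g = g and z = z]
    kill_power_const [where A = A and n = n and c = 0 and z = z] by simp

lemma kill_power_le_avg_power:
  "(\<And>z. 0 \<le> g z) \<Longrightarrow> (kill A ^^ n) g z \<le> (avg ^^ n) g z"
proof (induction n arbitrary: z)
  case (Suc n)
  have "(kill A ^^ Suc n) g z \<le> avg ((kill A ^^ n) g) z"
    using Suc.prems by (simp add: kill_le_avg kill_power_nonneg)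
  also have "\<dots> \<le> (avg ^^ Suc n) g z"
    using Suc by (simp add: avg_mono)
  finally show ?case .
qed simp

text \<open>Killing is ignored during the first \<open>n\<close> steps.\<close>

lemma surv_add_le: "surv A (n + k) z \<le> (avg ^^ n) (surv A k) z"
  unfolding surv_add by (rule kill_power_le_avg_power) (rule surv_bounds)

text \<open>Union bound: a walk that avoids \<open>A\<close> during {n..n + k} but not during {0..n
  + k} visits it at some time below \<open>n\<close>.\<close>

lemma surv_add_ge:
  "surv A (n + k) z \<ge> (avg ^^ n) (surv A k) z - (\<Sum>j<n. hit_mass A j z)"
proof (induction n arbitrary: z)
  case (Suc n)
  have sum_eq: "(\<Sum>j<Suc n. hit_mass A j z) = indicator A z + (\<Sum>j<n. hit_mass A (Suc j) z)"
    by (simp add: sum.lessThan_Suc_shift hit_mass_def del: sum.lessThan_Suc)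
  \<comment> \<open>A start in \<open>A\<close> is harmless, since the term j = 0 of the sum is then
    already 1.\<close>
  show ?case
  proof (cases "z \<in> A")
    case True
    have "(avg ^^ Suc n) (surv A k) z \<le> 1"
      using avg_power_mono [of "surv A k" "\<lambda>_. 1" "Suc n" z]
      by (simp add: surv_bounds del: funpow.simps)
    moreover have "0 \<le> (\<Sum>j<n. hit_mass A (Suc j) z)"
      by (intro sum_nonneg) (simp add: hit_mass_nonneg)
    ultimately show ?thesis using True by (simp only: sum_eq) (simp add: surv_Suc)
  next
    case False
    have "avg (surv A (n + k)) z \<ge> avg (\<lambda>z. (avg ^^ n) (surv A k) z - (\<Sum>j<n. hit_mass A j z)) z"
      using Suc by (rule avg_mono)
    then show ?thesis using False
      by (simp only: sum_eq) (simp add: surv_Suc avg_diff avg_sum hit_mass_Suc)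
  qed
qed simp

text \<open>Union bound over the last \<open>r\<close> times. In contrast to
  \<open>surv_add_ge\<close> the visits counted are late ones, which the heat kernel bound makes
  rare when \<open>k\<close> is large.\<close>

lemma surv_add_ge':
  "surv A (k + r) z \<ge> surv A k z - (\<Sum>j\<in>{k<..k + r}. hit_mass A j z)"
proof (induction k arbitrary: z)
  case 0
  \<comment> \<open>This controls the times below \<open>r\<close>. Time \<open>r\<close> itself
    enters through surv A 0 = 1 - indicator A, and the term j = 0 is finally absorbed into
    \<open>surv A 0 z\<close>.\<close>
  have "surv A (r + 0) z \<ge> (avg ^^ r) (surv A 0) z - (\<Sum>j<r. hit_mass A j z)"
    by (rule surv_add_ge)
  moreover have "surv A 0 = (\<lambda>z. 1 - indicator A z)"
    by (auto simp: surv_0 fun_eq_iff indicator_def)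
  then have "(avg ^^ r) (surv A 0) z = 1 - hit_mass A r z"
    using avg_power_diff [of r "\<lambda>_. 1" "indicator A" z] by (simp add: hit_mass_def)
  moreover have "(\<Sum>j<r. hit_mass A j z) + hit_mass A r z = (\<Sum>j\<in>{..r}. hit_mass A j z)"
    by (simp flip: lessThan_Suc_atMost)
  moreover have "(\<Sum>j\<in>{..r}. hit_mass A j z) = hit_mass A 0 z + (\<Sum>j\<in>{0<..r}. hit_mass A j z)"
    by (subst sum.remove [where x = 0]) (auto intro!: sum.cong)
  ultimately show ?case by (auto simp: surv_0 hit_mass_def indicator_def split: if_splits)
next
  case (Suc k)
  have sum_eq: "(\<Sum>j\<in>{Suc k<..Suc k + r}. hit_mass A j z) = (\<Sum>j\<in>{k<..k + r}. avg (hit_mass A j) z)"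
    by (rule sum.reindex_bij_witness [where i = Suc and j = "\<lambda>j. j - 1"])
      (auto simp flip: hit_mass_Suc)
  show ?case
  proof (cases "z \<in> A")
    case True
    have "0 \<le> (\<Sum>j\<in>{Suc k<..Suc k + r}. hit_mass A j z)"
      by (intro sum_nonneg) (simp add: hit_mass_nonneg)
    then show ?thesis using True by (simp add: surv_Suc)
  next
    case False
    have "avg (surv A (k + r)) z \<ge> avg (\<lambda>z. surv A k z - (\<Sum>j\<in>{k<..k + r}. hit_mass A j z)) z"
      using Suc by (rule avg_mono)
    then show ?thesis using False
      unfolding sum_eq by (simp add: surv_Suc avg_diff avg_sum)
  qed
qed

lemma periodic_surv:
  assumes "periodic N (\<lambda>z. z \<in> A)" shows "periodic N (surv A t)"
proof (induction t)
  case 0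
  show ?case using assms by (simp add: surv_0 periodic_def indicator_def)
next
  case (Suc t)
  then show ?case using assms periodic_avg [OF Suc] unfolding periodic_def surv_Suc by simp
qed

lemma sum_surv_Suc:
  fixes A :: "(int ^ 'd::finite) set"
  assumes "N \<ge> 1" "periodic N (\<lambda>z. z \<in> A)"
  shows "(\<Sum>x\<in>torus N. surv A (Suc t) x) =
    (\<Sum>x\<in>torus N. surv A t x) - (\<Sum>x\<in>torus N \<inter> A. avg (surv A t) x)"
proof -
  have "(\<Sum>x\<in>torus N. surv A t x) = (\<Sum>x\<in>torus N. avg (surv A t) x)"
    using sum_torus_avg [OF assms(1) periodic_surv [OF assms(2)]] by simp
  also have "\<dots> = (\<Sum>x\<in>torus N. surv A (Suc t) x) + (\<Sum>x\<in>torus N. if x \<in> A then avg (surv A t) x else 0)"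
    unfolding sum.distrib [symmetric] by (intro sum.cong) (auto simp: surv_Suc)
  finally show ?thesis by (simp add: sum.inter_restrict)
qed

section \<open>Fourier analysis on the torus\<close>

text \<open>The characteristic function of a single step, that is, the Fourier symbol of
  \<open>avg\<close>.\<close>

definition eigenvalue :: "('d::finite \<Rightarrow> real) \<Rightarrow> real" where
  "eigenvalue \<theta> = (\<Sum>i\<in>UNIV. cos (\<theta> i)) / CARD('d)"

definition freq :: "nat \<Rightarrow> int ^ 'd \<Rightarrow> 'd \<Rightarrow> real" where
  "freq N \<xi> i = 2 * pi * (\<xi> $ i) / N"

text \<open>Real part of a character. The steps are symmetric, so the real part alone is an
  eigenfunction of \<open>avg\<close> and the expansion of the heat kernel stays real.\<close>

definition wave :: "('d::finite \<Rightarrow> real) \<Rightarrow> int ^ 'd \<Rightarrow> real" where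
  "wave \<theta> z = cos (\<Sum>i\<in>UNIV. \<theta> i * (z $ i))"

lemma sum_mult_axis:
  "(\<Sum>j\<in>UNIV. \<theta> j * real_of_int ((axis i s :: int ^ 'd::finite) $ j)) = \<theta> i * s"
proof -
  have "(\<Sum>j\<in>UNIV. \<theta> j * real_of_int ((axis i s :: int ^ 'd) $ j)) =
      (\<Sum>j\<in>UNIV. if j = i then \<theta> i * s else 0)"
    by (intro sum.cong) (auto simp: axis_def)
  then show ?thesis by simp
qed

lemma avg_wave: "avg (\<lambda>z. wave \<theta> (z - y)) z = eigenvalue \<theta> * wave \<theta> (z - y)"
proof -
  define a where "a = (\<Sum>i\<in>UNIV. \<theta> i * ((z - y) $ i))"
  have shift: "wave \<theta> (z + axis i s - y) = cos (a + \<theta> i * s)" for i s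
  proof -
    have "(\<Sum>j\<in>UNIV. \<theta> j * ((z + axis i s - y) $ j)) =
        (\<Sum>j\<in>UNIV. \<theta> j * ((z - y) $ j) + \<theta> j * real_of_int (axis i s $ j))"
      by (intro sum.cong) (auto simp: algebra_simps)
    then show ?thesis by (simp add: wave_def sum.distrib sum_mult_axis a_def)
  qed
  have "(\<Sum>e\<in>unit_steps. wave \<theta> (z + e - y)) = (\<Sum>i\<in>UNIV. 2 * cos (\<theta> i) * cos a)"
    by (simp add: sum_unit_steps shift cos_add cos_diff mult_ac)
  also have "\<dots> = 2 * (\<Sum>i\<in>UNIV. cos (\<theta> i)) * cos a"
    by (simp add: sum_distrib_left sum_distrib_right)
  finally show ?thesis
    by (simp add: avg_def card_unit_steps eigenvalue_def wave_def a_def)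
qed

lemma avg_power_wave:
  "(avg ^^ n) (\<lambda>z. wave \<theta> (z - y)) z = eigenvalue \<theta> ^ n * wave \<theta> (z - y)"
proof (induction n arbitrary: z)
  case (Suc n)
  show ?case
    using avg_cong [where z = z, OF Suc] by (simp add: avg_cmult avg_wave)
qed simp

text \<open>Reduces sums over all frequencies to one dimension, both for the orthogonality of
  characters and for the heat kernel bound.\<close>

lemma sum_torus_prod:
  fixes g :: "'d::finite \<Rightarrow> int \<Rightarrow> 'b::comm_semiring_1"
  shows "(\<Sum>\<xi>\<in>torus N. \<Prod>i\<in>UNIV. g i (\<xi> $ i)) = (\<Prod>i\<in>UNIV. \<Sum>k\<in>{0..<int N}. g i k)"
proof -
  have "(\<Prod>i\<in>UNIV. \<Sum>k\<in>{0..<int N}. g i k) =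
      (\<Sum>h\<in>PiE UNIV (\<lambda>_. {0..<int N}). \<Prod>i\<in>UNIV. g i (h i))"
    by (rule prod_sum_PiE) auto
  also have "\<dots> = (\<Sum>\<xi>\<in>torus N. \<Prod>i\<in>UNIV. g i (\<xi> $ i))"
    by (rule sum.reindex_bij_betw [symmetric, OF bij_betw_torus_PiE])
  finally show ?thesis ..
qed

lemma sum_roots_of_unity:
  assumes "N \<ge> 1"
  shows "(\<Sum>k\<in>{0..<int N}. cis (2 * pi * k / N * z)) = (if int N dvd z then of_nat N else 0)"
proof -
  define w where "w = cis (2 * pi * real_of_int z / N)"
  have w_power: "w ^ k = cis (2 * pi * int k / N * z)" for k
    unfolding w_def Complex.DeMoivre by (rule arg_cong [where f = cis]) simp
  have "(\<Sum>k\<in>{0..<int N}. cis (2 * pi * k / N * z)) = (\<Sum>k<N. w ^ k)"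
    by (rule sum.reindex_bij_witness [where i = int and j = nat]) (auto simp: w_power)
  also have "\<dots> = (if int N dvd z then of_nat N else 0)"
  proof (cases "int N dvd z")
    case True
    then obtain q where "z = int N * q" by blast
    then have "w = cis (2 * pi * q)" 
      unfolding w_def by (intro arg_cong [where f = cis]) (use assms in simp)
    then have "w = 1" by (metis Ints_of_int cis_multiple_2pi)
    then show ?thesis using True by simp
  next
    case False
    have "w \<noteq> 1"
    proof
      assume "w = 1"
      then have "cos (2 * pi * real_of_int z / N) = 1"
        by (simp add: w_def complex_eq_iff)
      then obtain q :: int where "2 * pi * real_of_int z / N = q * 2 * pi"
        using cos_one_2pi_int by auto
      then have "real_of_int z = real_of_int (q * int N)"
        using assms by (simp add: field_simps)
      then have "z = q * int N" by (simp only: of_int_eq_iff)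
      with False show False by simp
    qed
    moreover have "w ^ N = cis (2 * pi * z)"
      unfolding w_power by (intro arg_cong [where f = cis]) (use assms in simp)
    then have "w ^ N = 1" by (metis Ints_of_int cis_multiple_2pi)
    ultimately show ?thesis using False by (simp add: geometric_sum)
  qed
  finally show ?thesis .
qed

text \<open>Orthogonality of characters. The computation passes through complex exponentials because
  these, unlike cosines, factor over the coordinates.\<close>

lemma sum_wave_freq:
  fixes z :: "int ^ 'd::finite"
  assumes "N \<ge> 1"
  shows "(\<Sum>\<xi>\<in>torus N. wave (freq N \<xi>) z) = (if torus_proj N z = torus_proj N 0 then real N ^ CARD('d) else 0)"
proof -
  have "(\<Sum>\<xi>\<in>torus N. cis (\<Sum>i\<in>UNIV. freq N \<xi> i * (z $ i))) =
      (\<Sum>\<xi>\<in>torus N. \<Prod>i\<in>UNIV. cis (2 * pi * (\<xi> $ i) / N * (z $ i)))"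
    by (intro sum.cong refl)
      (simp add: cis_conv_exp freq_def exp_sum sum_distrib_left of_real_sum del: of_real_mult)
  also have "\<dots> = (\<Prod>i\<in>UNIV. if int N dvd z $ i then of_nat N else 0)"
    by (simp only: sum_torus_prod [where g = "\<lambda>i k. cis (2 * pi * k / N * (z $ i))"]
        sum_roots_of_unity [OF assms])
  also have "\<dots> = (if \<forall>i. int N dvd z $ i then of_nat N ^ CARD('d) else 0)"
    by (auto intro: prod_zero)
  finally have *: "(\<Sum>\<xi>\<in>torus N. cis (\<Sum>i\<in>UNIV. freq N \<xi> i * (z $ i))) =
      (if \<forall>i. int N dvd z $ i then of_nat N ^ CARD('d) else 0)" .
  have "(\<Sum>\<xi>\<in>torus N. wave (freq N \<xi>) z) =
      Re (\<Sum>\<xi>\<in>torus N. cis (\<Sum>i\<in>UNIV. freq N \<xi> i * (z $ i)))"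
    by (simp add: wave_def)
  also have "\<dots> = (if torus_proj N z = torus_proj N 0 then real N ^ CARD('d) else 0)"
    unfolding * by (simp add: torus_proj_eq_iff flip: of_nat_power)
  finally show ?thesis .
qed

text \<open>Periodic lift of the point mass at \<open>y\<close>:
  \<open>(avg ^^ n) (delta N y) z\<close> is the heat kernel of the torus walk.\<close>

definition delta :: "nat \<Rightarrow> int ^ 'd::finite \<Rightarrow> int ^ 'd \<Rightarrow> real" where
  "delta N y z = of_bool (torus_proj N z = torus_proj N y)"

text \<open>Fourier inversion writes the point mass as a normalised sum of waves, and each step
  multiplies a wave by its eigenvalue.\<close>

lemma avg_power_delta:
  fixes y z :: "int ^ 'd::finite"
  assumes "N \<ge> 1"
  shows "(avg ^^ n) (delta N y) z =
    (\<Sum>\<xi>\<in>torus N. eigenvalue (freq N \<xi>) ^ n * wave (freq N \<xi>) (z - y)) / real N ^ CARD('d)"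
proof -
  have "delta N y = (\<lambda>z. 1 / real N ^ CARD('d) * (\<Sum>\<xi>\<in>torus N. wave (freq N \<xi>) (z - y)))"
  proof
    fix z
    have "torus_proj N z = torus_proj N y \<longleftrightarrow> torus_proj N (z - y) = torus_proj N 0"
      by (simp add: torus_proj_eq_iff)
    then show "delta N y z = 1 / real N ^ CARD('d) * (\<Sum>\<xi>\<in>torus N. wave (freq N \<xi>) (z - y))"
      using assms by (simp add: delta_def sum_wave_freq)
  qed
  then show ?thesis
    by (simp only: avg_power_cmult avg_power_sum avg_power_wave) simp
qed

section \<open>Decay of the eigenvalues and the one-dimensional Gaussian sums\<close>

lemma sin_ge_linear:
  assumes "0 \<le> y" "y \<le> pi / 2" shows "2 / pi * y \<le> sin y"
proof -
  have "convex_on {0..pi} (\<lambda>x. - sin x)"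
    by (rule f''_ge0_imp_convex [where f' = "\<lambda>x. - cos x" and f'' = sin])
      (auto intro!: derivative_eq_intros sin_ge_zero)
  \<comment> \<open>Concavity of the sine puts it above its chord from 0 to pi / 2.\<close>
  from convex_onD [OF this, of "2 / pi * y" 0 "pi / 2"] assms show ?thesis
    by (simp add: field_simps)
qed

text \<open>The square of sin (pi x) has period 1 in x, so the linear bound applies to the distance
  from the integer \<open>l\<close>.\<close>

lemma sin_squared_ge: "\<bar>x - real_of_int l\<bar> \<le> 1 / 2 \<Longrightarrow> (sin (pi * x))\<^sup>2 \<ge> 4 * (x - l)\<^sup>2"
proof -
  assume x: "\<bar>x - real_of_int l\<bar> \<le> 1 / 2"
  define y where "y = pi * \<bar>x - real_of_int l\<bar>"
  have "2 * \<bar>x - real_of_int l\<bar> \<le> sin y"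
    using sin_ge_linear [of y] x by (simp add: y_def field_simps)
  then have "(2 * \<bar>x - real_of_int l\<bar>)\<^sup>2 \<le> (sin y)\<^sup>2"
    by (intro power_mono) auto
  moreover have "(sin y)\<^sup>2 = (sin (pi * x - pi * l))\<^sup>2"
    by (auto simp: y_def abs_if algebra_simps) (metis minus_diff_eq power2_minus sin_minus)
  moreover have "sin (pi * l) = 0" "(cos (pi * l))\<^sup>2 = 1"
    using sin_integer_2pi [of "of_int l"] sin_npi_int[of l] cos_squared_eq[of "pi * l"] by (auto simp: mult_ac)
  ultimately show ?thesis by (simp add: sin_diff power_mult_distrib)
qed

text \<open>Expand the square of 1 - \<bar>cos x\<bar>. Cosines near -1 have to be controlled as
  well as those near 1, and sin x is small in both cases.\<close>

lemma abs_cos_le: "\<bar>cos x\<bar> \<le> 1 - (sin x)\<^sup>2 / 2" for x :: real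
proof -
  have "0 \<le> (1 - \<bar>cos x\<bar>)\<^sup>2" by simp
  also have "(1 - \<bar>cos x\<bar>)\<^sup>2 = 2 - (sin x)\<^sup>2 - 2 * \<bar>cos x\<bar>"
    using sin_cos_squared_add [of x] by (simp add: power2_eq_square algebra_simps)
  finally show ?thesis by simp
qed

text \<open>The bound is the exponential of a sum over coordinates, so that its sum over all
  frequencies factors.\<close>

lemma abs_eigenvalue_le:
  fixes \<theta> :: "'d::finite \<Rightarrow> real"
  shows "\<bar>eigenvalue \<theta>\<bar> \<le> exp (- (\<Sum>i\<in>UNIV. (sin (\<theta> i))\<^sup>2) / (2 * CARD('d)))"
proof -
  have "\<bar>\<Sum>i\<in>UNIV. cos (\<theta> i)\<bar> \<le> (\<Sum>i\<in>UNIV. 1 - (sin (\<theta> i))\<^sup>2 / 2)"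
    by (rule order_trans [OF sum_abs]) (intro sum_mono abs_cos_le)
  then have "\<bar>eigenvalue \<theta>\<bar> \<le> (CARD('d) - (\<Sum>i\<in>UNIV. (sin (\<theta> i))\<^sup>2) / 2) / CARD('d)"
    unfolding eigenvalue_def abs_divide
    by (simp add: sum_subtractf sum_divide_distrib divide_right_mono)
  also have "\<dots> = 1 + (- (\<Sum>i\<in>UNIV. (sin (\<theta> i))\<^sup>2) / (2 * CARD('d)))"
    by (simp add: field_simps)
  also have "\<dots> \<le> exp (- (\<Sum>i\<in>UNIV. (sin (\<theta> i))\<^sup>2) / (2 * CARD('d)))"
    by (rule exp_ge_add_one_self)
  finally show ?thesis .
qed

lemma sum_exp_geometric_le:
  assumes "c > 0" shows "(\<Sum>j<n. exp (- c * real j)) \<le> 1 + 1 / c"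
proof -
  have r: "0 < exp (- c)" "exp (- c) < 1" using assms by auto
  have "(\<Sum>j<n. exp (- c * real j)) = (\<Sum>j<n. exp (- c) ^ j)"
    by (simp add: exp_of_nat_mult [symmetric] mult_ac)
  also have "\<dots> = (1 - exp (- c) ^ n) / (1 - exp (- c))"
    using r by (simp add: sum_gp_strict)
  also have "\<dots> \<le> 1 / (1 - exp (- c))"
    using r by (intro divide_right_mono) auto
  also have "\<dots> \<le> 1 + 1 / c"
  proof -
    have "exp (- c) \<le> 1 / (1 + c)"
      using exp_ge_add_one_self [of c] assms by (simp add: exp_minus field_simps)
    then have "c / (1 + c) \<le> 1 - exp (- c)" using assms by (simp add: field_simps)
    then have "1 / (1 - exp (- c)) \<le> 1 / (c / (1 + c))"
      using assms by (intro divide_left_mono) (auto intro!: mult_pos_pos)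
    then show ?thesis using assms by (simp add: field_simps)
  qed
  finally show ?thesis .
qed

text \<open>Each value of \<bar>2 * k - a\<bar> is taken by at most one \<open>k\<close> on either
  side of a / 2, and no value exceeds 2 * N.\<close>

lemma sum_abs_le_twice:
  fixes g :: "nat \<Rightarrow> real" and a :: int
  assumes g: "\<And>j. 0 \<le> g j" and a: "0 \<le> a" "a \<le> 2 * int N"
  shows "(\<Sum>k\<in>{0..<int N}. g (nat \<bar>2 * k - a\<bar>)) \<le> 2 * (\<Sum>j<2 * N + 1. g j)"
proof -
  have half: "(\<Sum>k\<in>K. g (nat \<bar>2 * k - a\<bar>)) \<le> (\<Sum>j<2 * N + 1. g j)"
    if "K \<subseteq> {0..<int N}" "inj_on (\<lambda>k. nat \<bar>2 * k - a\<bar>) K" for K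
  proof -
    have "(\<Sum>k\<in>K. g (nat \<bar>2 * k - a\<bar>)) = (\<Sum>j\<in>(\<lambda>k. nat \<bar>2 * k - a\<bar>) ` K. g j)"
      using that(2) by (simp add: sum.reindex)
    also have "\<dots> \<le> (\<Sum>j<2 * N + 1. g j)"
    proof (intro sum_mono2)
      show "(\<lambda>k. nat \<bar>2 * k - a\<bar>) ` K \<subseteq> {..<2 * N + 1}"
      proof safe
        fix k assume "k \<in> K"
        then have "0 \<le> k" "k < int N" using that(1) by auto
        then show "nat \<bar>2 * k - a\<bar> < 2 * N + 1" using a by (auto simp: nat_less_iff)
      qed
    qed (use g in auto)
    finally show ?thesis .
  qed
  have "(\<Sum>k\<in>{0..<int N}. g (nat \<bar>2 * k - a\<bar>)) =
      (\<Sum>k\<in>{0..<int N} \<inter> {k. 2 * k \<ge> a}. g (nat \<bar>2 * k - a\<bar>)) +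
      (\<Sum>k\<in>{0..<int N} \<inter> {k. 2 * k < a}. g (nat \<bar>2 * k - a\<bar>))"
    by (subst sum.union_disjoint [symmetric]) (auto intro!: sum.cong)
  also have "\<dots> \<le> (\<Sum>j<2 * N + 1. g j) + (\<Sum>j<2 * N + 1. g j)"
    by (intro add_mono half) (auto simp: inj_on_def)
  finally show ?thesis by simp
qed

text \<open>The ratio 2 * k / N runs through [0, 2), where the sine is small near the integers 0, 1
  and 2. The constant 12 is the product of these three centres, a factor 2 for the two sides of
  each, and a factor 2 that bounds exp (1 / 4).\<close>

lemma sum_exp_sin_squared_le:
  assumes "N \<ge> 1" "b > 0"
  shows "(\<Sum>k\<in>{0..<int N}. exp (- b * (sin (2 * pi * k / N))\<^sup>2)) \<le> 12 * (1 + N / sqrt b)"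
proof -
  \<comment> \<open>Chosen so that \<open>c\<close> times the integer \<bar>2 * k - l * N\<bar>
    equals 2 sqrt b \<bar>x - l\<bar>, the root of the lower bound for b times the squared
    sine.\<close>
  define c where "c = 2 * sqrt b / N"
  have c: "c > 0" using assms by (simp add: c_def)
  have pointwise: "exp (- b * (sin (2 * pi * k / N))\<^sup>2) \<le>
      (\<Sum>l\<in>{0, 1, 2}. 2 * exp (- c * real (nat \<bar>2 * k - l * int N\<bar>)))"
    if k: "k \<in> {0..<int N}" for k
  proof -
    define x where "x = 2 * real_of_int k / N"
    define l where "l = round x"
    have x: "0 \<le> x" "x < 2" using k assms by (auto simp: x_def field_simps)
    have l: "\<bar>x - real_of_int l\<bar> \<le> 1 / 2"
      using of_int_round_abs_le [of x] by (simp add: l_def abs_minus_commute)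
    then have "-1 < l" "l < 3" using x by linarith+
    then have l_mem: "l \<in> {0, 1, 2}" by auto
    define y where "y = c * real (nat \<bar>2 * k - l * int N\<bar>)"
    have y: "y = 2 * sqrt b * \<bar>x - real_of_int l\<bar>"
    proof -
      have "real (nat \<bar>2 * k - l * int N\<bar>) = \<bar>2 * real_of_int k - l * N\<bar>" by simp
      also have "2 * real_of_int k - l * N = N * (x - l)" using assms by (simp add: x_def field_simps)
      also have "\<bar>N * (x - l)\<bar> = N * \<bar>x - l\<bar>" by (simp add: abs_mult)
      finally show ?thesis using assms by (simp add: y_def c_def)
    qed
    have "b * (4 * (x - l)\<^sup>2) \<le> b * (sin (pi * x))\<^sup>2"
      using sin_squared_ge [OF l] assms by (intro mult_left_mono) auto
    moreover have "b * (4 * (x - l)\<^sup>2) = y\<^sup>2"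
      using assms by (simp add: y power_mult_distrib)
    \<comment> \<open>Trades the Gaussian for a geometric series at the price of the constant exp (1
      / 4).\<close>
    moreover have "y - 1 / 4 \<le> y\<^sup>2"
      using zero_le_power2 [of "y - 1 / 2"] by (simp add: power2_eq_square algebra_simps)
    moreover have "sin (2 * pi * k / N) = sin (pi * x)" by (simp add: x_def mult_ac)
    ultimately have "exp (- b * (sin (2 * pi * k / N))\<^sup>2) \<le> exp (1 / 4 - y)" by simp
    also have "\<dots> = exp (1 / 4) * exp (- y)" by (simp flip: exp_add)
    also have "\<dots> \<le> 2 * exp (- y)"
    proof (intro mult_right_mono)
      have "exp (1 / 4 :: real) \<le> 1 + 1 / 4 + (1 / 4)\<^sup>2" by (rule exp_bound) auto
      then show "exp (1 / 4 :: real) \<le> 2" by (simp add: power2_eq_square)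
    qed simp
    also have "\<dots> = 2 * exp (- c * real (nat \<bar>2 * k - l * int N\<bar>))" by (simp add: y_def)
    also have "\<dots> \<le> (\<Sum>l\<in>{0, 1, 2}. 2 * exp (- c * real (nat \<bar>2 * k - l * int N\<bar>)))"
      using l_mem by (intro member_le_sum) auto
    finally show ?thesis .
  qed
  have "(\<Sum>k\<in>{0..<int N}. exp (- b * (sin (2 * pi * k / N))\<^sup>2)) \<le>
      (\<Sum>k\<in>{0..<int N}. \<Sum>l\<in>{0, 1, 2}. 2 * exp (- c * real (nat \<bar>2 * k - l * int N\<bar>)))"
    by (rule sum_mono) (rule pointwise)
  also have "\<dots> = (\<Sum>l\<in>{0, 1, 2}. 2 * (\<Sum>k\<in>{0..<int N}. exp (- c * real (nat \<bar>2 * k - l * int N\<bar>))))"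
    unfolding sum_distrib_left by (rule sum.swap)
  also have "\<dots> \<le> (\<Sum>l\<in>{0, 1, 2 :: int}. 2 * (2 * (\<Sum>j<2 * N + 1. exp (- c * real j))))"
    by (intro sum_mono mult_left_mono sum_abs_le_twice [where g = "\<lambda>j. exp (- c * real j)"]) auto
  also have "\<dots> \<le> (\<Sum>l\<in>{0, 1, 2 :: int}. 2 * (2 * (1 + 1 / c)))"
    using c by (intro sum_mono mult_left_mono sum_exp_geometric_le) auto
  also have "\<dots> = 12 * (1 + 1 / c)" by simp
  also have "\<dots> \<le> 12 * (1 + N / sqrt b)"
    using assms by (simp add: c_def field_simps)
  finally show ?thesis .
qed

text \<open>One Gaussian sum per coordinate. The result is of order j^(-d/2) while j \<le> N^2 and
  of order N^(-d) afterwards. Absolute values of the eigenvalues make it usable at all places z - y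
  at once.\<close>

lemma sum_abs_eigenvalue_le:
  assumes "N \<ge> 1" "j \<ge> 1"
  shows "(\<Sum>\<xi>\<in>torus N. \<bar>eigenvalue (freq N \<xi> :: 'd::finite \<Rightarrow> real)\<bar> ^ j) / real N ^ CARD('d) \<le>
    (12 * sqrt (2 * CARD('d)) * (1 / sqrt j + 1 / N)) ^ CARD('d)"
proof -
  define b where "b = real j / (2 * CARD('d))"
  have b: "b > 0" using assms by (simp add: b_def)
  have "(\<Sum>\<xi>\<in>torus N. \<bar>eigenvalue (freq N \<xi> :: 'd \<Rightarrow> real)\<bar> ^ j) \<le>
      (\<Sum>\<xi>\<in>torus N. \<Prod>i\<in>UNIV. exp (- b * (sin (2 * pi * ((\<xi> :: int ^ 'd) $ i) / N))\<^sup>2))"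
  proof (rule sum_mono)
    fix \<xi> :: "int ^ 'd"
    have "\<bar>eigenvalue (freq N \<xi>)\<bar> ^ j \<le>
        exp (- (\<Sum>i\<in>UNIV. (sin (freq N \<xi> i))\<^sup>2) / (2 * CARD('d))) ^ j"
      by (intro power_mono abs_eigenvalue_le) auto
    also have "\<dots> = exp (\<Sum>i\<in>UNIV. - b * (sin (freq N \<xi> i))\<^sup>2)"
      by (simp add: b_def exp_of_nat_mult [symmetric] sum_distrib_left sum_negf sum_divide_distrib)
    finally show "\<bar>eigenvalue (freq N \<xi>)\<bar> ^ j \<le>
        (\<Prod>i\<in>UNIV. exp (- b * (sin (2 * pi * (\<xi> $ i) / N))\<^sup>2))"
      by (simp add: exp_sum freq_def)
  qed
  also have "\<dots> = (\<Prod>i\<in>(UNIV :: 'd set). \<Sum>k\<in>{0..<int N}. exp (- b * (sin (2 * pi * k / N))\<^sup>2))"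
    by (rule sum_torus_prod [where g = "\<lambda>_ k. exp (- b * (sin (2 * pi * k / N))\<^sup>2)"])
  also have "\<dots> \<le> (\<Prod>i\<in>(UNIV :: 'd set). 12 * (1 + N / sqrt b))"
    by (intro prod_mono conjI sum_exp_sin_squared_le sum_nonneg assms b) auto
  also have "\<dots> \<le> (12 * sqrt (2 * CARD('d)) * (1 / sqrt j + 1 / N) * N) ^ CARD('d)"
  proof -
    have "real CARD('d) \<ge> 1" by (simp add: Suc_leI)
    then have "1 \<le> sqrt (2 * CARD('d))" by (intro real_sqrt_ge_one) linarith
    moreover have "1 + N / sqrt b = 1 + sqrt (2 * CARD('d)) * N / sqrt j"
      using assms by (simp add: b_def real_sqrt_divide)
    ultimately have "1 + N / sqrt b \<le> sqrt (2 * CARD('d)) + sqrt (2 * CARD('d)) * N / sqrt j" by simp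
    also have "\<dots> = sqrt (2 * CARD('d)) * (1 / sqrt j + 1 / N) * N"
      using assms by (simp add: field_simps)
    finally have "12 * (1 + N / sqrt b) \<le> 12 * sqrt (2 * CARD('d)) * (1 / sqrt j + 1 / N) * N"
      by simp
    then have "(12 * (1 + N / sqrt b)) ^ CARD('d) \<le>
        (12 * sqrt (2 * CARD('d)) * (1 / sqrt j + 1 / N) * N) ^ CARD('d)"
      using b by (intro power_mono) auto
    then show ?thesis by simp
  qed
  also have "\<dots> = (12 * sqrt (2 * CARD('d)) * (1 / sqrt j + 1 / N)) ^ CARD('d) * real N ^ CARD('d)"
    by (rule power_mult_distrib)
  finally show ?thesis
    by (subst pos_divide_le_eq) (use assms in simp_all)
qed

lemma abs_wave_le: "\<bar>wave \<theta> z\<bar> \<le> 1"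
  by (simp add: wave_def)

lemma avg_power_delta_le:
  fixes y z :: "int ^ 'd::finite"
  assumes "N \<ge> 1" "j \<ge> 1"
  shows "(avg ^^ j) (delta N y) z \<le> (12 * sqrt (2 * CARD('d)) * (1 / sqrt j + 1 / N)) ^ CARD('d)"
proof -
  have "(\<Sum>\<xi>\<in>torus N. eigenvalue (freq N \<xi>) ^ j * wave (freq N \<xi>) (z - y)) \<le>
      (\<Sum>\<xi>\<in>torus N. \<bar>eigenvalue (freq N \<xi> :: 'd \<Rightarrow> real)\<bar> ^ j)"
  proof (rule sum_mono)
    fix \<xi> :: "int ^ 'd"
    have "eigenvalue (freq N \<xi>) ^ j * wave (freq N \<xi>) (z - y) \<le>
        \<bar>eigenvalue (freq N \<xi>)\<bar> ^ j * \<bar>wave (freq N \<xi>) (z - y)\<bar>"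
      by (metis abs_ge_self abs_mult power_abs)
    also have "\<dots> \<le> \<bar>eigenvalue (freq N \<xi>)\<bar> ^ j"
      by (simp add: abs_wave_le mult_left_le)
    finally show "eigenvalue (freq N \<xi>) ^ j * wave (freq N \<xi>) (z - y) \<le>
        \<bar>eigenvalue (freq N \<xi>)\<bar> ^ j" .
  qed
  then have "(avg ^^ j) (delta N y) z \<le>
      (\<Sum>\<xi>\<in>torus N. \<bar>eigenvalue (freq N \<xi> :: 'd \<Rightarrow> real)\<bar> ^ j) / real N ^ CARD('d)"
    unfolding avg_power_delta [OF assms(1)] by (intro divide_right_mono) auto
  also have "\<dots> \<le> (12 * sqrt (2 * CARD('d)) * (1 / sqrt j + 1 / N)) ^ CARD('d)"
    by (rule sum_abs_eigenvalue_le [OF assms])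
  finally show ?thesis .
qed

text \<open>A single nonzero coordinate suffices. Only the distance to 1 is bounded below: for even
  \<open>N\<close> the frequency with all coordinates N / 2 has eigenvalue -1.\<close>

lemma eigenvalue_gap:
  fixes \<xi> :: "int ^ 'd::finite"
  assumes "N \<ge> 1" "\<xi> \<in> torus N" "\<xi> \<noteq> 0"
  shows "1 - eigenvalue (freq N \<xi>) \<ge> 8 / (CARD('d) * real N ^ 2)"
proof -
  from assms obtain i where i: "\<xi> $ i \<noteq> 0" by (auto simp: vec_eq_iff)
  define k where "k = \<xi> $ i"
  have "0 \<le> k" "k < int N" using assms(2) by (auto simp: k_def torus_def)
  with i have k: "1 \<le> k" "k \<le> int N - 1" by (auto simp: k_def)
  define x where "x = real_of_int k / N"
  \<comment> \<open>An integer nearest to k / N; it is 0 or 1 because 0 < k < N.\<close>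
  define l where "l = (if 2 * k \<le> int N then 0 else 1 :: int)"
  have "\<bar>x - real_of_int l\<bar> \<le> 1 / 2"
    using k assms(1) by (auto simp: x_def l_def field_simps abs_if)
  note sin_squared_ge [OF this]
  moreover have "\<bar>x - real_of_int l\<bar> \<ge> 1 / N"
  proof -
    have "x - real_of_int l = real_of_int (k - l * int N) / N"
      using assms(1) by (simp add: x_def field_simps)
    moreover have "\<bar>k - l * int N\<bar> \<ge> 1" using k by (auto simp: l_def)
    then have "\<bar>real_of_int (k - l * int N)\<bar> \<ge> 1" by linarith
    ultimately show ?thesis by (simp add: abs_divide divide_right_mono)
  qed
  then have "(x - l)\<^sup>2 \<ge> (1 / N)\<^sup>2"
    by (metis abs_le_square_iff abs_of_nonneg divide_nonneg_nonneg of_nat_0_le_iff zero_le_one)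
  ultimately have "4 / real N ^ 2 \<le> (sin (pi * x))\<^sup>2" by (simp add: power_divide)
  moreover have "cos (freq N \<xi> i) = 1 - 2 * (sin (pi * x))\<^sup>2"
    using cos_double_sin [of "pi * x"] by (simp add: freq_def x_def k_def mult_ac)
  ultimately have "8 / real N ^ 2 \<le> 1 - cos (freq N \<xi> i)" by simp
  also have "\<dots> \<le> (\<Sum>i\<in>UNIV. 1 - cos (freq N \<xi> i))"
    by (rule member_le_sum) auto
  finally have "8 / real N ^ 2 / CARD('d) \<le> (\<Sum>i\<in>UNIV. 1 - cos (freq N \<xi> i)) / CARD('d)"
    by (rule divide_right_mono) simp
  then show ?thesis
    by (simp add: eigenvalue_def sum_subtractf diff_divide_distrib mult_ac)
qed

lemma abs_eigenvalue_le_1: "\<bar>eigenvalue \<theta>\<bar> \<le> 1"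
proof -
  have "(\<Sum>i\<in>UNIV. (sin (\<theta> i))\<^sup>2) \<ge> 0" by (intro sum_nonneg) auto
  then have "exp (- (\<Sum>i\<in>UNIV. (sin (\<theta> i))\<^sup>2) / (2 * CARD('a))) \<le> 1" by simp
  then show ?thesis using abs_eigenvalue_le [of \<theta>] by linarith
qed

text \<open>The two factors have different origins. The first N^2 steps make the sum over
  frequencies small, with 1 / sqrt j and 1 / N both equal to 1 / N, which turns 12 into 24. The
  average over \<open>m\<close> times produces geometric sums bounded by 2 / (1 - ev), hence by d
  N^2 / 4 even when ev = -1.\<close>

lemma cesaro_mixing:
  fixes y z :: "int ^ 'd::finite"
  assumes "N \<ge> 1" "m \<ge> 1"
  shows "\<bar>(\<Sum>s<m. (avg ^^ (N\<^sup>2 + s)) (delta N y) z) / m - 1 / real N ^ CARD('d)\<bar> \<le>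
    (24 * sqrt (2 * CARD('d)) / N) ^ CARD('d) * (CARD('d) * real N ^ 2 / (4 * m))"
proof -
  define ev where "ev \<xi> = eigenvalue (freq N \<xi> :: 'd \<Rightarrow> real)" for \<xi>
  define c where "c \<xi> = (\<Sum>s<m. ev \<xi> ^ (N\<^sup>2 + s)) * wave (freq N \<xi>) (z - y)" for \<xi>
  have "(\<Sum>s<m. (avg ^^ (N\<^sup>2 + s)) (delta N y) z) = (\<Sum>\<xi>\<in>torus N. c \<xi>) / real N ^ CARD('d)"
    unfolding avg_power_delta [OF assms(1)] c_def ev_def sum_distrib_right
    by (subst sum.swap) (simp add: sum_divide_distrib)
  also have "(\<Sum>\<xi>\<in>torus N. c \<xi>) = c 0 + (\<Sum>\<xi>\<in>torus N - {0}. c \<xi>)"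
    using assms(1) by (intro sum.remove) (simp, simp add: torus_def)
  \<comment> \<open>The zero frequency carries the equilibrium value.\<close>
  also have "c 0 = m"
    by (simp add: c_def ev_def eigenvalue_def freq_def wave_def)
  finally have "\<bar>(\<Sum>s<m. (avg ^^ (N\<^sup>2 + s)) (delta N y) z) / m - 1 / real N ^ CARD('d)\<bar> =
      \<bar>\<Sum>\<xi>\<in>torus N - {0}. c \<xi>\<bar> / (m * real N ^ CARD('d))"
    using assms by (simp add: field_simps abs_divide)
  moreover have "\<bar>\<Sum>\<xi>\<in>torus N - {0}. c \<xi>\<bar> \<le>
      (\<Sum>\<xi>\<in>torus N - {0}. \<bar>ev \<xi>\<bar> ^ N\<^sup>2 * (CARD('d) * real N ^ 2 / 4))"
  proof (rule order_trans [OF sum_abs], rule sum_mono)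
    fix \<xi> :: "int ^ 'd" assume \<xi>: "\<xi> \<in> torus N - {0}"
    then have gap: "1 - ev \<xi> \<ge> 8 / (CARD('d) * real N ^ 2)"
      unfolding ev_def using assms by (intro eigenvalue_gap) auto
    moreover have pos: "8 / (CARD('d) * real N ^ 2) > 0" using assms by simp
    ultimately have gap_pos: "1 - ev \<xi> > 0" by linarith
    have "\<bar>ev \<xi>\<bar> ^ m \<le> 1" unfolding ev_def by (simp add: abs_eigenvalue_le_1 power_le_one)
    then have "\<bar>1 - ev \<xi> ^ m\<bar> \<le> 2" by (simp add: power_abs [symmetric])
    then have "\<bar>\<Sum>s<m. ev \<xi> ^ s\<bar> \<le> 2 / (1 - ev \<xi>)"
      using gap_pos by (simp add: sum_gp_strict abs_divide divide_right_mono)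
    also have "\<dots> \<le> 2 / (8 / (CARD('d) * real N ^ 2))"
      using gap pos gap_pos by (intro divide_left_mono) auto
    finally have geo: "\<bar>\<Sum>s<m. ev \<xi> ^ s\<bar> \<le> CARD('d) * real N ^ 2 / 4" by simp
    have "\<bar>c \<xi>\<bar> = \<bar>ev \<xi>\<bar> ^ N\<^sup>2 * \<bar>\<Sum>s<m. ev \<xi> ^ s\<bar> * \<bar>wave (freq N \<xi>) (z - y)\<bar>"
      by (simp add: c_def power_add sum_distrib_left [symmetric] abs_mult power_abs)
    also have "\<dots> \<le> \<bar>ev \<xi>\<bar> ^ N\<^sup>2 * \<bar>\<Sum>s<m. ev \<xi> ^ s\<bar>"
      by (simp add: abs_wave_le mult_left_le)
    also have "\<dots> \<le> \<bar>ev \<xi>\<bar> ^ N\<^sup>2 * (CARD('d) * real N ^ 2 / 4)"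
      by (intro mult_left_mono geo) auto
    finally show "\<bar>c \<xi>\<bar> \<le> \<bar>ev \<xi>\<bar> ^ N\<^sup>2 * (CARD('d) * real N ^ 2 / 4)" .
  qed
  then have "\<bar>\<Sum>\<xi>\<in>torus N - {0}. c \<xi>\<bar> \<le>
      (\<Sum>\<xi>\<in>torus N. \<bar>ev \<xi>\<bar> ^ N\<^sup>2) * (CARD('d) * real N ^ 2 / 4)"
    unfolding sum_distrib_right by (rule order_trans) (intro sum_mono2, auto)
  then have "\<bar>\<Sum>\<xi>\<in>torus N - {0}. c \<xi>\<bar> / (m * real N ^ CARD('d)) \<le>
      (\<Sum>\<xi>\<in>torus N. \<bar>ev \<xi>\<bar> ^ N\<^sup>2) * (CARD('d) * real N ^ 2 / 4) / (m * real N ^ CARD('d))"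
    by (rule divide_right_mono) simp
  also have "\<dots> = (\<Sum>\<xi>\<in>torus N. \<bar>ev \<xi>\<bar> ^ N\<^sup>2) / real N ^ CARD('d) * (CARD('d) * real N ^ 2 / (4 * m))"
    by simp
  also have "\<dots> \<le> (24 * sqrt (2 * CARD('d)) / N) ^ CARD('d) * (CARD('d) * real N ^ 2 / (4 * m))"
  proof (rule mult_right_mono)
    show "(\<Sum>\<xi>\<in>torus N. \<bar>ev \<xi>\<bar> ^ N\<^sup>2) / real N ^ CARD('d) \<le> (24 * sqrt (2 * CARD('d)) / N) ^ CARD('d)"
      using sum_abs_eigenvalue_le [of N "N\<^sup>2", where 'd = 'd] assms(1)
      by (simp add: ev_def)
  qed simp
  ultimately show ?thesis by simp
qed

section \<open>Heat kernel consequences\<close>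

text \<open>Tail, over times beyond \<open>n\<close>, of the series of j^(-3/2). The exponent 3
  serves every dimension d \<ge> 3.\<close>

definition heat_tail :: "nat \<Rightarrow> real" where
  "heat_tail n = (\<Sum>j. (1 / sqrt (j + Suc n)) ^ 3)"

lemma inverse_sqrt_cubed: "j \<ge> 1 \<Longrightarrow> (1 / sqrt (real j)) ^ 3 = real j powr (- 3 / 2)"
  by (simp add: powr_half_sqrt [symmetric] powr_minus_divide [symmetric] powr_power)

lemma summable_inverse_sqrt_cubed: "summable (\<lambda>j. (1 / sqrt (real j)) ^ 3)"
proof -
  have "eventually (\<lambda>j. (1 / sqrt (real j)) ^ 3 = real j powr (- 3 / 2)) sequentially"
    using eventually_ge_at_top [of 1] by eventually_elim (rule inverse_sqrt_cubed)
  from summable_cong [OF this] show ?thesis by (simp add: summable_real_powr_iff)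
qed

lemma heat_tail_tendsto_0: "heat_tail \<longlonglongrightarrow> 0"
proof -
  have "(\<lambda>n. \<Sum>j. (1 / sqrt (real (j + n))) ^ 3) \<longlonglongrightarrow> 0"
    by (rule suminf_exist_split2 [OF summable_inverse_sqrt_cubed])
  then show ?thesis unfolding heat_tail_def by (rule LIMSEQ_Suc)
qed

lemma sum_le_heat_tail:
  assumes "finite J" "J \<subseteq> {n<..}"
  shows "(\<Sum>j\<in>J. (1 / sqrt (real j)) ^ 3) \<le> heat_tail n"
proof -
  have "(\<Sum>j\<in>J. (1 / sqrt (real j)) ^ 3) =
      (\<Sum>i\<in>(\<lambda>j. j - Suc n) ` J. (1 / sqrt (real (i + Suc n))) ^ 3)"
    using assms(2) by (intro sum.reindex_bij_witness [where i = "\<lambda>i. i + Suc n" and j = "\<lambda>j. j - Suc n"])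
      force+
  also have "\<dots> \<le> heat_tail n"
    unfolding heat_tail_def using assms(1)
    by (intro sum_le_suminf summable_ignore_initial_segment summable_inverse_sqrt_cubed) auto
  finally show ?thesis .
qed

text \<open>Separates a transient part, summable in \<open>j\<close>, from the equilibrium part
  N^(-d), which is harmless over time windows short compared with N^d.\<close>

lemma heat_kernel_bound:
  assumes "CARD('d::finite) \<ge> 3"
  obtains C where "C \<ge> 0" "\<And>N j y (z :: int ^ 'd). N \<ge> 1 \<Longrightarrow> j \<ge> 1 \<Longrightarrow>
    (avg ^^ j) (delta N y) z \<le> C * ((1 / sqrt j) ^ 3 + 1 / real N ^ CARD('d))"
proof
  define B where "B = 12 * sqrt (2 * CARD('d))"
  have B: "B \<ge> 0" by (simp add: B_def)
  then show "(2 * B) ^ CARD('d) \<ge> 0" by simp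
  fix N j :: nat and y z :: "int ^ 'd"
  assume N: "N \<ge> 1" and j: "j \<ge> 1"
  define a b where "a = 1 / sqrt (real j)" and "b = 1 / real N"
  have ab: "0 \<le> a" "a \<le> 1" "0 \<le> b" using N j by (auto simp: a_def b_def)
  have "(avg ^^ j) (delta N y) z \<le> (B * (a + b)) ^ CARD('d)"
    unfolding B_def a_def b_def by (rule avg_power_delta_le [OF N j])
  also have "\<dots> \<le> (2 * B * max a b) ^ CARD('d)"
  proof (rule power_mono)
    have "B * (a + b) \<le> B * (2 * max a b)" using B by (intro mult_left_mono) auto
    then show "B * (a + b) \<le> 2 * B * max a b" by (simp add: mult_ac)
  qed (use ab B in auto)
  also have "\<dots> = (2 * B) ^ CARD('d) * max a b ^ CARD('d)" by (rule power_mult_distrib)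
  also have "max a b ^ CARD('d) \<le> a ^ 3 + b ^ CARD('d)"
  proof (cases "a \<le> b")
    case False
    \<comment> \<open>Since a \<le> 1, a larger exponent may be lowered to 3.\<close>
    have "a ^ CARD('d) \<le> a ^ 3" using ab assms by (intro power_decreasing)
    then show ?thesis using False ab by (simp add: max_def add_increasing2)
  qed (use ab in \<open>simp add: max_def\<close>)
  finally show "(avg ^^ j) (delta N y) z \<le>
      (2 * B) ^ CARD('d) * ((1 / sqrt j) ^ 3 + 1 / real N ^ CARD('d))"
    using B by (simp add: a_def b_def power_divide mult_left_mono)
qed

text \<open>Relative to the uniform weight N^(-d) the error is C N^2 / m, so that m = \<kappa> N^2
  makes it C / \<kappa> for all \<open>N\<close>.\<close>

lemma cesaro_bound:
  obtains C where "C \<ge> 0" "\<And>N m y (z :: int ^ 'd::finite). N \<ge> 1 \<Longrightarrow> m \<ge> 1 \<Longrightarrow>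
    \<bar>(\<Sum>s<m. (avg ^^ (N\<^sup>2 + s)) (delta N y) z) / m - 1 / real N ^ CARD('d)\<bar> \<le>
      C * (real N ^ 2 / m) / real N ^ CARD('d)"
proof
  define B where "B = 24 * sqrt (2 * CARD('d))"
  show "B ^ CARD('d) * CARD('d) / 4 \<ge> 0" by (simp add: B_def)
  fix N m :: nat and y z :: "int ^ 'd"
  assume "N \<ge> 1" "m \<ge> 1"
  from cesaro_mixing [OF this, of y z]
  show "\<bar>(\<Sum>s<m. (avg ^^ (N\<^sup>2 + s)) (delta N y) z) / m - 1 / real N ^ CARD('d)\<bar> \<le>
      B ^ CARD('d) * CARD('d) / 4 * (real N ^ 2 / m) / real N ^ CARD('d)"
    by (simp add: B_def power_divide mult_ac)
qed

lemma periodic_expansion: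
  fixes g :: "int ^ 'd::finite \<Rightarrow> real"
  assumes "N \<ge> 1" "periodic N g"
  shows "(avg ^^ n) g z = (\<Sum>y\<in>torus N. g y * (avg ^^ n) (delta N y) z)"
proof -
  have "g = (\<lambda>z. \<Sum>y\<in>torus N. g y * delta N y z)"
  proof
    fix z
    have "(\<Sum>y\<in>torus N. g y * delta N y z) =
        (\<Sum>y\<in>torus N. if y = torus_proj N z then g y else 0)"
      by (intro sum.cong) (auto simp: delta_def torus_proj_of_torus)
    then show "g z = (\<Sum>y\<in>torus N. g y * delta N y z)"
      using assms by (simp add: periodicD)
  qed
  then have "(avg ^^ n) g z = (avg ^^ n) (\<lambda>z. \<Sum>y\<in>torus N. g y * delta N y z) z" by simp
  then show ?thesis by (simp only: avg_power_sum avg_power_cmult)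
qed

section \<open>Survival at long times\<close>

text \<open>Unnormalised: division by N^d gives the survival probability from a uniform
  start.\<close>

definition mass :: "nat \<Rightarrow> (int ^ 'd::finite) set \<Rightarrow> nat \<Rightarrow> real" where
  "mass N A t = (\<Sum>x\<in>torus N. surv A t x)"

lemma mass_bounds: "0 \<le> mass N A t" "mass N A t \<le> real N ^ CARD('d::finite)"
  for A :: "(int ^ 'd) set"
proof -
  show "0 \<le> mass N A t" unfolding mass_def by (intro sum_nonneg surv_bounds)
  have "mass N A t \<le> (\<Sum>x\<in>(torus N :: (int ^ 'd) set). 1)"
    unfolding mass_def by (intro sum_mono surv_bounds)
  then show "mass N A t \<le> real N ^ CARD('d)" by (simp add: card_torus)
qed

lemma mass_antimono: "s \<le> t \<Longrightarrow> mass N A t \<le> mass N A s"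
  unfolding mass_def by (intro sum_mono surv_antimono)

text \<open>Each step loses at most one unit per point of \<open>A\<close>. Shifting time by o(N^d)
  therefore does not change the normalised mass in the limit.\<close>

lemma mass_drop:
  fixes A :: "(int ^ 'd::finite) set"
  assumes "N \<ge> 1" "periodic N (\<lambda>z. z \<in> A)"
  shows "mass N A s - mass N A (s + k) \<le> k * card (torus N \<inter> A)"
proof (induction k)
  case (Suc k)
  have "(\<Sum>x\<in>torus N \<inter> A. avg (surv A (s + k)) x) \<le> (\<Sum>x\<in>torus N \<inter> A. 1)"
    by (intro sum_mono avg_surv_bounds)
  then have "mass N A (s + k) - mass N A (Suc (s + k)) \<le> card (torus N \<inter> A)"
    using sum_surv_Suc [OF assms, of "s + k"] by (simp add: mass_def)
  with Suc show ?case by (simp add: algebra_simps)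
qed simp

lemma mass_0: "mass N A 0 = real N ^ CARD('d) - card (torus N \<inter> A)"
  for A :: "(int ^ 'd::finite) set"
proof -
  have "mass N A 0 = (\<Sum>x\<in>torus N. 1 - (if x \<in> A then 1 else 0))"
    unfolding mass_def surv_0 by (intro sum.cong) auto
  also have "\<dots> = real N ^ CARD('d) - card (torus N \<inter> A)"
    by (simp add: sum_subtractf card_torus sum.inter_restrict [symmetric])
  finally show ?thesis .
qed

text \<open>Union bound over the points of \<open>A\<close> and the times in \<open>J\<close>: the
  heat kernel tail pays for the transient part, the number of times over the volume for the
  equilibrium part. \<open>J\<close> is arbitrary because two different time windows occur
  later.\<close>

lemma hit_mass_sum_le:
  fixes A :: "(int ^ 'd::finite) set"
  assumes N: "N \<ge> 1" and A: "periodic N (\<lambda>z. z \<in> A)" "card (torus N \<inter> A) \<le> \<alpha>"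
    and C: "C \<ge> 0" "\<And>j y (z :: int ^ 'd). j \<ge> 1 \<Longrightarrow>
      (avg ^^ j) (delta N y) z \<le> C * ((1 / sqrt j) ^ 3 + 1 / real N ^ CARD('d))"
    and J: "finite J" "J \<subseteq> {n<..}" "card J \<le> S"
  shows "(\<Sum>j\<in>J. hit_mass A j z) \<le> \<alpha> * C * (heat_tail n + S / real N ^ CARD('d))"
proof -
  define h where "h j = C * ((1 / sqrt (real j)) ^ 3 + 1 / real N ^ CARD('d))" for j
  have per: "periodic N (indicator A :: int ^ 'd \<Rightarrow> real)"
    using A by (simp add: periodic_def indicator_def)
  have "hit_mass A j z \<le> \<alpha> * h j" if "j \<in> J" for j
  proof -
    have j: "j \<ge> 1" using that J by auto
    have h: "h j \<ge> 0" using C(1) by (simp add: h_def)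
    have "hit_mass A j z = (\<Sum>y\<in>torus N. indicator A y * (avg ^^ j) (delta N y) z)"
      unfolding hit_mass_def by (rule periodic_expansion [OF N per])
    also have "\<dots> = (\<Sum>y\<in>torus N \<inter> A. (avg ^^ j) (delta N y) z)"
      unfolding sum.inter_restrict [OF finite_torus] by (intro sum.cong) (auto simp: indicator_def)
    also have "\<dots> \<le> (\<Sum>y\<in>torus N \<inter> A. h j)"
      unfolding h_def by (intro sum_mono C(2) j)
    also have "\<dots> = card (torus N \<inter> A) * h j" by simp
    also have "\<dots> \<le> \<alpha> * h j" using A(2) h by (intro mult_right_mono) auto
    finally show ?thesis .
  qed
  then have "(\<Sum>j\<in>J. hit_mass A j z) \<le> (\<Sum>j\<in>J. \<alpha> * h j)" by (rule sum_mono)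
  also have "\<dots> = \<alpha> * C * ((\<Sum>j\<in>J. (1 / sqrt (real j)) ^ 3) + card J / real N ^ CARD('d))"
    by (simp add: h_def sum_distrib_left [symmetric] sum.distrib del: power_divide)
  also have "\<dots> \<le> \<alpha> * C * (heat_tail n + S / real N ^ CARD('d))"
    using J C(1) by (intro mult_left_mono add_mono sum_le_heat_tail divide_right_mono) auto
  finally show ?thesis .
qed

text \<open>A walk that leaves \<open>A\<close> and stays away for \<open>n\<close> steps typically does not return before it has
  mixed, after which it is killed like a stationary walk. Averaging over \<open>m\<close> consecutive times
  disposes of the parity problem for even \<open>N\<close>.\<close>

lemma avg_surv_approx:
  fixes A :: "(int ^ 'd::finite) set"
  assumes N: "N \<ge> 1" and A: "periodic N (\<lambda>z. z \<in> A)" "card (torus N \<inter> A) \<le> \<alpha>"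
    and C: "C \<ge> 0" "\<And>j y (z :: int ^ 'd). j \<ge> 1 \<Longrightarrow>
      (avg ^^ j) (delta N y) z \<le> C * ((1 / sqrt j) ^ 3 + 1 / real N ^ CARD('d))"
    and m: "m \<ge> 1" and \<beta>: "\<beta> \<ge> 0" "\<And>y (z :: int ^ 'd).
      \<bar>(\<Sum>s<m. (avg ^^ (N\<^sup>2 + s)) (delta N y) z) / m - 1 / real N ^ CARD('d)\<bar> \<le> \<beta> / real N ^ CARD('d)"
    and t: "t \<ge> Suc n + (N\<^sup>2 + m) + n"
  shows "\<bar>avg (surv A t) z - avg (surv A n) z * (mass N A t / real N ^ CARD('d))\<bar> \<le>
    \<beta> + 2 * (\<alpha> * C * (heat_tail n + (N\<^sup>2 + m) / real N ^ CARD('d)))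
      + (Suc n + (N\<^sup>2 + m)) * \<alpha> / real N ^ CARD('d)"
proof -
  define V where "V = real N ^ CARD('d)"
  define S where "S = N\<^sup>2 + m"
  \<comment> \<open>The avoided times 1..t + 1 are divided: the first \<open>n\<close> + 1 for the
    escape, the next \<open>S\<close> for mixing, and the rest is accounted for by
    \<open>surv A K\<close>.\<close>
  define K where "K = t - (Suc n + S)"
  define T where "T = S + K"
  define \<gamma> where "\<gamma> = \<alpha> * C * (heat_tail n + S / V)"
  define F where "F = mass N A K / V"
  have V: "V > 0" using N by (simp add: V_def)
  have t_eq: "t = Suc n + T" and K: "K \<ge> n" using t by (auto simp: T_def K_def S_def)
  have F: "0 \<le> F" "F \<le> 1"
    using mass_bounds [of N A K] V by (auto simp: F_def V_def)
  have \<gamma>: "(\<Sum>j\<in>J. hit_mass A j w) \<le> \<gamma>" if "finite J" "J \<subseteq> {n<..}" "card J \<le> S" for J w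
    unfolding \<gamma>_def V_def using that by (intro hit_mass_sum_le N A C) auto
  have \<gamma>_nonneg: "\<gamma> \<ge> 0" using \<gamma> [of "{}"] by simp
  \<comment> \<open>Expanding \<open>surv A K\<close> in point masses reduces this to the mixing
    hypothesis; the error \<beta> / V is summed over the N^d points of the torus.\<close>
  have average: "\<bar>(\<Sum>s<m. (avg ^^ (N\<^sup>2 + s)) (surv A K) w) / m - F\<bar> \<le> \<beta>" for w
  proof -
    let ?p = "\<lambda>y. (\<Sum>s<m. (avg ^^ (N\<^sup>2 + s)) (delta N y) w) / m"
    have "(\<Sum>s<m. (avg ^^ (N\<^sup>2 + s)) (surv A K) w) / m = (\<Sum>y\<in>torus N. surv A K y * ?p y)"
      unfolding periodic_expansion [OF N periodic_surv [OF A(1)]]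
      by (subst sum.swap) (simp add: sum_distrib_left sum_divide_distrib)
    moreover have "F = (\<Sum>y\<in>torus N. surv A K y * (1 / V))"
      by (simp add: F_def mass_def sum_divide_distrib)
    ultimately have "(\<Sum>s<m. (avg ^^ (N\<^sup>2 + s)) (surv A K) w) / m - F =
        (\<Sum>y\<in>torus N. surv A K y * (?p y - 1 / V))"
      by (simp only: sum_subtractf right_diff_distrib)
    also have "\<bar>\<dots>\<bar> \<le> (\<Sum>y\<in>(torus N :: (int ^ 'd) set). 1 * (\<beta> / V))"
      unfolding V_def
      by (rule order_trans [OF sum_abs], rule sum_mono, subst abs_mult, rule mult_mono)
        (use \<beta> in \<open>auto simp: abs_of_nonneg surv_bounds\<close>)
    also have "\<dots> = \<beta>" using V by (simp add: card_torus V_def)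
    finally show ?thesis .
  qed
  \<comment> \<open>Survival up to \<open>T\<close> implies survival up to each N^2 + s + K with s <
    m; then killing is dropped for the first N^2 + s steps.\<close>
  have upper: "surv A T w \<le> F + \<beta>" for w
  proof -
    have "surv A T w \<le> (avg ^^ (N\<^sup>2 + s)) (surv A K) w" if "s < m" for s
    proof -
      have "surv A T w \<le> surv A (N\<^sup>2 + s + K) w"
        using that by (intro surv_antimono) (simp add: T_def S_def)
      then show ?thesis using surv_add_le order_trans by blast
    qed
    then have "(\<Sum>s<m. surv A T w) \<le> (\<Sum>s<m. (avg ^^ (N\<^sup>2 + s)) (surv A K) w)"
      by (intro sum_mono) auto
    then have "surv A T w \<le> (\<Sum>s<m. (avg ^^ (N\<^sup>2 + s)) (surv A K) w) / m"
      using m by (simp add: pos_le_divide_eq mult.commute)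
    then show ?thesis using average [of w] by linarith
  qed
  \<comment> \<open>Late visits, near time \<open>T\<close>, cost at most \<gamma> because K \<ge>
    n. Early visits are not rare for \<open>w\<close> close to \<open>A\<close>, so their sum is
    kept as a function of \<open>w\<close> until the escape steps have been taken.\<close>
  have lower: "F - \<beta> - \<gamma> - (\<Sum>j<S. hit_mass A j w) \<le> surv A T w" for w
  proof -
    have "(avg ^^ (N\<^sup>2 + s)) (surv A K) w \<le> surv A T w + \<gamma> + (\<Sum>j<S. hit_mass A j w)"
      if s: "s < m" for s
    proof -
      have "surv A (N\<^sup>2 + s + K + (m - s)) w \<ge>
          surv A (N\<^sup>2 + s + K) w - (\<Sum>j\<in>{N\<^sup>2 + s + K<..N\<^sup>2 + s + K + (m - s)}. hit_mass A j w)"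
        by (rule surv_add_ge')
      moreover have "N\<^sup>2 + s + K + (m - s) = T" using s by (simp add: T_def S_def)
      moreover have "(\<Sum>j\<in>{N\<^sup>2 + s + K<..N\<^sup>2 + s + K + (m - s)}. hit_mass A j w) \<le> \<gamma>"
        using K by (intro \<gamma>) (auto simp: S_def)
      moreover have "surv A (N\<^sup>2 + s + K) w \<ge>
          (avg ^^ (N\<^sup>2 + s)) (surv A K) w - (\<Sum>j<N\<^sup>2 + s. hit_mass A j w)"
        by (rule surv_add_ge)
      moreover have "(\<Sum>j<N\<^sup>2 + s. hit_mass A j w) \<le> (\<Sum>j<S. hit_mass A j w)"
        using s by (intro sum_mono2) (auto simp: S_def hit_mass_nonneg)
      ultimately show ?thesis by simp
    qed
    then have "(\<Sum>s<m. (avg ^^ (N\<^sup>2 + s)) (surv A K) w) \<le>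
        (\<Sum>s<m. surv A T w + \<gamma> + (\<Sum>j<S. hit_mass A j w))"
      by (intro sum_mono) auto
    then have "(\<Sum>s<m. (avg ^^ (N\<^sup>2 + s)) (surv A K) w) / m \<le>
        surv A T w + \<gamma> + (\<Sum>j<S. hit_mass A j w)"
      using m by (simp add: pos_divide_le_eq mult.commute)
    then show ?thesis using average [of w] by linarith
  qed
  \<comment> \<open>One free step followed by \<open>n\<close> + 1 steps with killing: a monotone
    linear functional that sends a constant to its multiple by the escape probability and
    \<open>surv A T\<close> to the quantity of interest.\<close>
  define L where "L h = avg ((kill A ^^ Suc n) h) z" for h
  have L_mono: "L f \<le> L g" if "\<And>w. f w \<le> g w" for f g
    unfolding L_def by (intro avg_mono kill_power_mono that)
  have L_const: "L (\<lambda>_. c) = c * avg (surv A n) z" for c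
    unfolding L_def
    by (subst kill_power_const [abs_def]) (simp add: avg_cmult surv_conv_kill_one del: funpow.simps)
  have L_surv: "L (surv A T) = avg (surv A t) z"
    by (simp only: L_def t_eq surv_add)
  have L_diff: "L (\<lambda>w. f w - g w) = L f - L g" for f g
    unfolding L_def by (subst kill_power_diff [abs_def]) (rule avg_diff)
  define e where "e = avg (surv A n) z"
  have e: "0 \<le> e" "e \<le> 1" by (simp_all add: e_def avg_surv_bounds)
  have "avg (surv A t) z \<le> L (\<lambda>_. F + \<beta>)"
    unfolding L_surv [symmetric] by (intro L_mono upper)
  also have "\<dots> = (F + \<beta>) * e" by (simp add: L_const e_def)
  also have "\<dots> \<le> e * F + \<beta>" using e \<beta>(1) by (simp add: algebra_simps mult_left_le)
  finally have up: "avg (surv A t) z \<le> e * F + \<beta>" .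
  \<comment> \<open>The walk has now made \<open>n\<close> + 2 steps, so what were early visits
    occur after time \<open>n\<close>, where the tail bound applies.\<close>
  have "L (\<lambda>w. \<Sum>j<S. hit_mass A j w) \<le> \<gamma>"
  proof -
    have "L (\<lambda>w. \<Sum>j<S. hit_mass A j w) \<le> (avg ^^ Suc (Suc n)) (\<lambda>w. \<Sum>j<S. hit_mass A j w) z"
      unfolding L_def funpow.simps(2) [where n = "Suc n" and f = avg] o_apply
      by (intro avg_mono kill_power_le_avg_power sum_nonneg hit_mass_nonneg)
    also have "\<dots> = (\<Sum>j<S. hit_mass A (Suc (Suc n) + j) z)"
      by (simp only: avg_power_sum avg_power_hit_mass)
    also have "\<dots> = (\<Sum>j\<in>(+) (Suc (Suc n)) ` {..<S}. hit_mass A j z)"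
      by (subst sum.reindex) (auto simp: inj_on_def)
    also have "\<dots> \<le> \<gamma>"
      by (intro \<gamma>) (auto intro: order_trans [OF card_image_le])
    finally show ?thesis .
  qed
  moreover have "avg (surv A t) z \<ge> L (\<lambda>w. F - \<beta> - \<gamma> - (\<Sum>j<S. hit_mass A j w))"
    unfolding L_surv [symmetric] by (intro L_mono lower)
  then have "avg (surv A t) z \<ge> (F - \<beta> - \<gamma>) * e - L (\<lambda>w. \<Sum>j<S. hit_mass A j w)"
    unfolding L_diff [of "\<lambda>_. F - \<beta> - \<gamma>"] L_const e_def .
  moreover have "(F - \<beta> - \<gamma>) * e \<ge> e * F - \<beta> - \<gamma>"
    using e \<beta>(1) \<gamma>_nonneg mult_left_le [of e \<beta>] mult_left_le [of e \<gamma>] by (simp add: algebra_simps)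
  ultimately have low: "avg (surv A t) z \<ge> e * F - \<beta> - 2 * \<gamma>" by linarith
  \<comment> \<open>Replaces the mass at time \<open>K\<close> by the mass at time \<open>t\<close>,
    which closes the recursion.\<close>
  have "mass N A K - mass N A (K + (Suc n + S)) \<le> (Suc n + S) * card (torus N \<inter> A)"
    by (rule mass_drop [OF N A(1)])
  also have "\<dots> \<le> (Suc n + S) * \<alpha>" using A(2) by (simp only: of_nat_mult [symmetric] of_nat_le_iff mult_le_mono2)
  finally have "mass N A K - mass N A t \<le> (Suc n + S) * \<alpha>"
    by (simp add: t_eq T_def add_ac)
  then have "F - mass N A t / V \<le> (Suc n + S) * \<alpha> / V"
    using V by (simp add: F_def diff_divide_distrib [symmetric] divide_right_mono)
  moreover have nonneg: "0 \<le> F - mass N A t / V"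
    using V mass_antimono [of K t N A] by (simp add: F_def divide_right_mono t_eq T_def)
  moreover have "e * (F - mass N A t / V) \<le> F - mass N A t / V"
    using e nonneg by (intro mult_left_le_one_le)
  ultimately have "\<bar>e * (F - mass N A t / V)\<bar> \<le> (Suc n + S) * \<alpha> / V"
    using e by (simp add: abs_of_nonneg)
  then have "\<bar>e * F - e * (mass N A t / V)\<bar> \<le> (Suc n + S) * \<alpha> / V"
    by (simp only: right_diff_distrib)
  with up low have "\<bar>avg (surv A t) z - e * (mass N A t / V)\<bar> \<le> \<beta> + 2 * \<gamma> + (Suc n + S) * \<alpha> / V"
    using \<gamma>_nonneg by linarith
  then show ?thesis by (simp add: e_def \<gamma>_def S_def V_def)
qed

section \<open>Exponential limit\<close>

text \<open>The errors of the single steps add up without amplification since \<bar>q\<bar> \<le>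
  1.\<close>

lemma perturbed_geometric:
  fixes x :: "nat \<Rightarrow> real"
  assumes "\<And>t. t \<ge> s \<Longrightarrow> \<bar>x (Suc t) - q * x t\<bar> \<le> \<delta>" "\<bar>q\<bar> \<le> 1"
  shows "\<bar>x (s + j) - q ^ j * x s\<bar> \<le> j * \<delta>"
proof (induction j)
  case (Suc j)
  have "x (s + Suc j) - q ^ Suc j * x s =
      (x (Suc (s + j)) - q * x (s + j)) + q * (x (s + j) - q ^ j * x s)"
    by (simp add: algebra_simps)
  also have "\<bar>\<dots>\<bar> \<le> \<bar>x (Suc (s + j)) - q * x (s + j)\<bar> + \<bar>q\<bar> * \<bar>x (s + j) - q ^ j * x s\<bar>"
    by (metis abs_mult abs_triangle_ineq)
  also have "\<dots> \<le> \<delta> + 1 * (j * \<delta>)"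
    using assms Suc by (intro add_mono mult_mono) auto
  finally show ?case by (simp add: algebra_simps)
qed simp

text \<open>The powers of 1 - a and exp (- a) differ by at most \<open>k\<close> times the
  difference of the bases, which is at most a^2 for a < 1; and k a^2 tends to 0.\<close>

lemma power_one_minus_tendsto_exp:
  fixes a :: "nat \<Rightarrow> real" and k :: "nat \<Rightarrow> nat"
  assumes "a \<longlonglongrightarrow> 0" "(\<lambda>N. k N * a N) \<longlonglongrightarrow> L" "\<And>N. 0 \<le> a N"
  shows "(\<lambda>N. (1 - a N) ^ k N) \<longlonglongrightarrow> exp (- L)"
proof -
  have "(\<lambda>N. exp (- (k N * a N))) \<longlonglongrightarrow> exp (- L)"
    by (intro tendsto_intros assms)
  moreover have "(\<lambda>N. (1 - a N) ^ k N - exp (- (k N * a N))) \<longlonglongrightarrow> 0"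
  proof (rule tendsto_0_le [where K = 1])
    show "(\<lambda>N. k N * a N * a N) \<longlonglongrightarrow> 0"
      using tendsto_mult [OF assms(2,1)] by simp
    have "eventually (\<lambda>N. a N < 1) sequentially"
      using assms(1) by (rule order_tendstoD) simp
    then show "eventually (\<lambda>N. norm ((1 - a N) ^ k N - exp (- (k N * a N))) \<le>
        norm (k N * a N * a N) * 1) sequentially"
    proof eventually_elim
      case (elim N)
      define b where "b = a N"
      have b: "0 \<le> b" "b < 1" using assms(3) elim by (auto simp: b_def)
      have "1 - b \<le> exp (- b)" using exp_ge_add_one_self [of "- b"] by simp
      moreover have "exp (- b) \<le> 1 / (1 + b)"
        using exp_ge_add_one_self [of b] b by (simp add: exp_minus field_simps)
      moreover have "1 / (1 + b) \<le> 1 - b + b * b"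
        using b by (simp add: field_simps)
      ultimately have diff: "norm ((1 - b) - exp (- b)) \<le> b * b" by simp
      have "norm ((1 - b) ^ k N - exp (- b) ^ k N) \<le> k N * norm ((1 - b) - exp (- b))"
        using b by (intro norm_power_diff) auto
      also have "\<dots> \<le> k N * (b * b)" by (intro mult_left_mono diff) simp
      finally show ?case using b by (simp add: b_def exp_of_nat_mult [symmetric] mult_ac)
    qed
  qed
  ultimately show ?thesis using tendsto_add by fastforce
qed

text \<open>The error carries a factor 1 / N^d, so that the roughly u N^d steps of the recursion
  accumulate only about u \<alpha> \<epsilon>.\<close>

lemma mass_step_approx:
  fixes A :: "(int ^ 'd::finite) set"
  assumes N: "N \<ge> 1" and A: "periodic N (\<lambda>z. z \<in> A)" "card (torus N \<inter> A) \<le> \<alpha>"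
    and approx: "\<And>z. \<bar>avg (surv A t) z - avg (surv A n) z * (mass N A t / real N ^ CARD('d))\<bar> \<le> \<epsilon>"
  shows "\<bar>mass N A (Suc t) / real N ^ CARD('d) -
      (1 - (\<Sum>x\<in>torus N \<inter> A. avg (surv A n) x) / real N ^ CARD('d)) * (mass N A t / real N ^ CARD('d))\<bar>
    \<le> \<alpha> * \<epsilon> / real N ^ CARD('d)"
proof -
  define V where "V = real N ^ CARD('d)"
  have V: "V > 0" using N by (simp add: V_def)
  have \<epsilon>: "\<epsilon> \<ge> 0" using approx [of 0] by linarith
  have "(\<Sum>x\<in>torus N \<inter> A. avg (surv A t) x) - (\<Sum>x\<in>torus N \<inter> A. avg (surv A n) x) * (mass N A t / V) =
      (\<Sum>x\<in>torus N \<inter> A. avg (surv A t) x - avg (surv A n) x * (mass N A t / V))"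
    by (simp only: sum_subtractf sum_distrib_right)
  also have "\<bar>\<dots>\<bar> \<le> (\<Sum>x\<in>torus N \<inter> A. \<epsilon>)"
    by (rule order_trans [OF sum_abs], rule sum_mono) (unfold V_def, rule approx)
  also have "\<dots> \<le> \<alpha> * \<epsilon>" using A(2) \<epsilon> by (simp add: mult_right_mono)
  finally have "\<bar>(\<Sum>x\<in>torus N \<inter> A. avg (surv A t) x) -
      (\<Sum>x\<in>torus N \<inter> A. avg (surv A n) x) * (mass N A t / V)\<bar> / V \<le> \<alpha> * \<epsilon> / V"
    using V by (intro divide_right_mono) auto
  moreover have "mass N A (Suc t) = mass N A t - (\<Sum>x\<in>torus N \<inter> A. avg (surv A t) x)"
    unfolding mass_def by (rule sum_surv_Suc [OF N A(1)])
  moreover have "\<bar>(\<Sum>x\<in>torus N \<inter> A. avg (surv A t) x) -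
      (\<Sum>x\<in>torus N \<inter> A. avg (surv A n) x) * (mass N A t / V)\<bar> / V =
      \<bar>(mass N A t - (\<Sum>x\<in>torus N \<inter> A. avg (surv A t) x)) / V -
      (1 - (\<Sum>x\<in>torus N \<inter> A. avg (surv A n) x) / V) * (mass N A t / V)\<bar>"
  proof -
    have "(F - s) / V - (1 - e / V) * (F / V) = (e * (F / V) - s) / V" for F s e
      using V by (simp add: field_simps)
    then show ?thesis using V by (simp add: abs_divide abs_minus_commute)
  qed
  ultimately show ?thesis unfolding V_def by simp
qed

text \<open>For a burn-in time \<open>s\<close> of smaller order than \<open>V\<close>: the steps
  remaining after it still number u V to leading order.\<close>

lemma floor_mult_div_tendsto:
  fixes V :: "nat \<Rightarrow> real" and s :: "nat \<Rightarrow> nat"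
  assumes V: "filterlim V at_top sequentially" and u: "u > 0"
    and s: "(\<lambda>N. s N / V N) \<longlonglongrightarrow> 0"
  shows "eventually (\<lambda>N. s N \<le> nat \<lfloor>u * V N\<rfloor>) sequentially"
    "(\<lambda>N. real (nat \<lfloor>u * V N\<rfloor> - s N) / V N) \<longlonglongrightarrow> u"
proof -
  have inv: "(\<lambda>N. 1 / V N) \<longlonglongrightarrow> 0"
    by (intro tendsto_divide_0 [OF tendsto_const] filterlim_at_top_imp_at_infinity V)
  have pos: "eventually (\<lambda>N. V N > 0) sequentially"
    using V by (rule filterlim_at_top_dense [THEN iffD1, rule_format])
  have floor: "(\<lambda>N. real (nat \<lfloor>u * V N\<rfloor>) / V N) \<longlonglongrightarrow> u"
  proof (rule tendsto_sandwich)
    show "(\<lambda>N. u - 1 / V N) \<longlonglongrightarrow> u" using tendsto_diff [OF tendsto_const inv, of u] by simp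
    show "(\<lambda>N. u) \<longlonglongrightarrow> u" by simp
    show "eventually (\<lambda>N. u - 1 / V N \<le> real (nat \<lfloor>u * V N\<rfloor>) / V N) sequentially"
      using pos
    proof eventually_elim
      case (elim N)
      have "u * V N - 1 \<le> real (nat \<lfloor>u * V N\<rfloor>)" by linarith
      then have "(u * V N - 1) / V N \<le> real (nat \<lfloor>u * V N\<rfloor>) / V N"
        using elim by (intro divide_right_mono) auto
      then show ?case using elim by (simp add: diff_divide_distrib)
    qed
    show "eventually (\<lambda>N. real (nat \<lfloor>u * V N\<rfloor>) / V N \<le> u) sequentially"
      using pos by eventually_elim (use u in \<open>auto simp: field_simps\<close>)
  qed
  have diff: "(\<lambda>N. real (nat \<lfloor>u * V N\<rfloor>) / V N - s N / V N) \<longlonglongrightarrow> u"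
    using tendsto_diff [OF floor s] by simp
  have "eventually (\<lambda>N. 0 < real (nat \<lfloor>u * V N\<rfloor>) / V N - s N / V N) sequentially"
    using diff u by (rule order_tendstoD)
  with pos show le: "eventually (\<lambda>N. s N \<le> nat \<lfloor>u * V N\<rfloor>) sequentially"
    by eventually_elim (simp add: diff_divide_distrib [symmetric] zero_less_divide_iff)
  show "(\<lambda>N. real (nat \<lfloor>u * V N\<rfloor> - s N) / V N) \<longlonglongrightarrow> u"
    by (rule Lim_transform_eventually [OF diff])
      (use le in eventually_elim, simp add: of_nat_diff diff_divide_distrib)
qed

text \<open>The set may vary with \<open>N\<close> as long as its number of points on the torus
  stays bounded. Escape has to agree with \<open>c n\<close> for large \<open>N\<close> at each
  fixed \<open>n\<close>, because \<open>n\<close> is chosen before \<open>N\<close> grows.\<close>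

theorem survival_limit:
  fixes A :: "nat \<Rightarrow> (int ^ 'd::finite) set"
  assumes d: "CARD('d) \<ge> 3" and u: "u > 0"
    and per: "\<And>N. periodic N (\<lambda>z. z \<in> A N)"
    and card: "\<And>N. card (torus N \<inter> A N) \<le> \<alpha>"
    and esc: "\<And>n. eventually (\<lambda>N. (\<Sum>x\<in>torus N \<inter> A N. avg (surv (A N) n) x) = c n) sequentially"
    and c: "c \<longlonglongrightarrow> cap"
  shows "(\<lambda>N. mass N (A N) (nat \<lfloor>u * real N ^ CARD('d)\<rfloor>) / real N ^ CARD('d)) \<longlonglongrightarrow> exp (- u * cap)"
proof -
  obtain C where C: "C \<ge> 0" "\<And>N j y (z :: int ^ 'd). N \<ge> 1 \<Longrightarrow> j \<ge> 1 \<Longrightarrow>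
      (avg ^^ j) (delta N y) z \<le> C * ((1 / sqrt j) ^ 3 + 1 / real N ^ CARD('d))"
    using heat_kernel_bound [OF d] by blast
  obtain C' where C': "C' \<ge> 0" "\<And>N m y (z :: int ^ 'd). N \<ge> 1 \<Longrightarrow> m \<ge> 1 \<Longrightarrow>
      \<bar>(\<Sum>s<m. (avg ^^ (N\<^sup>2 + s)) (delta N y) z) / m - 1 / real N ^ CARD('d)\<bar> \<le>
        C' * (real N ^ 2 / m) / real N ^ CARD('d)"
    using cesaro_bound by blast
  define V where "V N = real N ^ CARD('d)" for N
  define \<phi> where "\<phi> N t = mass N (A N) t / V N" for N t
  define T where "T N = nat \<lfloor>u * V N\<rfloor>" for N
  have V_pos: "V N > 0" if "N \<ge> 1" for N using that by (simp add: V_def)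
  have V_top: "filterlim V at_top sequentially"
    unfolding V_def by (rule filterlim_pow_at_top) (auto simp: filterlim_real_sequentially)
  have V_inv: "(\<lambda>N. x / V N) \<longlonglongrightarrow> 0" for x
    by (intro tendsto_divide_0 [OF tendsto_const] filterlim_at_top_imp_at_infinity V_top)
  have square: "(\<lambda>N. real (N\<^sup>2) / V N) \<longlonglongrightarrow> 0"
  proof (rule tendsto_sandwich [where f = "\<lambda>_. 0" and h = "\<lambda>N. 1 / real N"])
    show "(\<lambda>N. 1 / real N) \<longlonglongrightarrow> 0" by (rule lim_1_over_n)
    show "eventually (\<lambda>N. real (N\<^sup>2) / V N \<le> 1 / real N) sequentially"
      using eventually_ge_at_top [of 1]
    proof eventually_elim
      case (elim N)
      have "real N ^ 3 \<le> V N" unfolding V_def using elim d by (intro power_increasing) auto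
      then have "real (N\<^sup>2) / V N \<le> real (N\<^sup>2) / real N ^ 3"
        using elim by (intro divide_left_mono) (auto simp: V_def)
      also have "\<dots> = 1 / real N" using elim by (simp add: field_simps power2_eq_square power3_eq_cube)
      finally show ?case .
    qed
  qed (auto simp: V_def)
  have approx: "eventually (\<lambda>N. \<bar>\<phi> N (T N) - exp (- u * c n)\<bar> <
      u * (\<alpha> * (C' / \<kappa> + 2 * (\<alpha> * C * heat_tail n))) + \<eta>) sequentially"
    if \<kappa>: "\<kappa> \<ge> 1" and \<eta>: "\<eta> > 0" for n \<kappa> :: nat and \<eta>
  proof -
    \<comment> \<open>N^2 steps for the smallness of the nonconstant modes and \<kappa> N^2 for the
      averaging; together of smaller order than N^d.\<close>
    define S where "S N = N\<^sup>2 + \<kappa> * N\<^sup>2" for N :: nat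
    \<comment> \<open>The earliest time at which \<open>avg_surv_approx\<close> applies.\<close>
    define t where "t N = Suc n + S N + n" for N
    define q where "q N = 1 - c n / V N" for N
    define \<epsilon> where "\<epsilon> N = C' / \<kappa> + 2 * (\<alpha> * C * (heat_tail n + S N / V N)) + (Suc n + S N) * \<alpha> / V N" for N
    have S_lim: "(\<lambda>N. S N / V N) \<longlonglongrightarrow> 0"
      using tendsto_add [OF square tendsto_mult [OF tendsto_const square, of "real \<kappa>"]]
      by (simp add: S_def add_divide_distrib)
    have t_lim: "(\<lambda>N. t N / V N) \<longlonglongrightarrow> 0"
      using tendsto_add [OF V_inv [of "Suc n + n"] S_lim]
      by (simp add: t_def add_divide_distrib [symmetric] add_ac)
    note T_lims = floor_mult_div_tendsto [OF V_top u t_lim, folded T_def]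
    have c_event: "eventually (\<lambda>N. (\<Sum>x\<in>torus N \<inter> A N. avg (surv (A N) n) x) = c n) sequentially"
      by (rule esc)
    have c_bounds: "0 \<le> c n" "c n \<le> \<alpha>"
    proof -
      obtain N where N: "(\<Sum>x\<in>torus N \<inter> A N. avg (surv (A N) n) x) = c n"
        using c_event by (auto simp: eventually_sequentially)
      then show "0 \<le> c n" by (metis avg_surv_bounds(1) sum_nonneg)
      have "c n \<le> (\<Sum>x\<in>torus N \<inter> A N. 1)"
        unfolding N [symmetric] by (intro sum_mono avg_surv_bounds)
      then show "c n \<le> \<alpha>" using card [of N] by simp
    qed
    have "eventually (\<lambda>N. \<bar>\<phi> N (T N) - q N ^ (T N - t N) * \<phi> N (t N)\<bar> \<le>
        real (T N - t N) / V N * (\<alpha> * \<epsilon> N)) sequentially"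
      using eventually_ge_at_top [of 1] c_event T_lims(1)
        order_tendstoD(2) [OF V_inv [of "c n"], of 1, OF zero_less_one]
    proof eventually_elim
      case (elim N)
      have "\<bar>avg (surv (A N) t') z - avg (surv (A N) n) z * (mass N (A N) t' / V N)\<bar> \<le> \<epsilon> N"
        if "t' \<ge> t N" for t' z
      proof -
        have N2: "\<kappa> * N\<^sup>2 \<ge> 1" using elim \<kappa> by simp
        have \<beta>: "\<bar>(\<Sum>s<\<kappa> * N\<^sup>2. (avg ^^ (N\<^sup>2 + s)) (delta N y) z) / (\<kappa> * N\<^sup>2) - 1 / real N ^ CARD('d)\<bar>
            \<le> (C' / \<kappa>) / real N ^ CARD('d)" for y z :: "int ^ 'd"
          using C'(2) [OF elim(1) N2, of y z] elim(1) by simp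
        show ?thesis
          using avg_surv_approx [OF elim(1) per card C(1) C(2) [OF elim(1)] N2 _ \<beta>, of n t' z] that C'(1)
          by (simp add: t_def S_def \<epsilon>_def V_def)
      qed
      then have "\<bar>\<phi> N (Suc t') - q N * \<phi> N t'\<bar> \<le> \<alpha> * \<epsilon> N / V N" if "t' \<ge> t N" for t'
        using mass_step_approx [OF elim(1) per card, of t' n "\<epsilon> N"] that elim(2)
        by (simp add: \<phi>_def q_def V_def)
      moreover have "\<bar>q N\<bar> \<le> 1"
        using elim(4) c_bounds V_pos [OF elim(1)] by (simp add: q_def abs_le_iff)
      ultimately have "\<bar>\<phi> N (t N + (T N - t N)) - q N ^ (T N - t N) * \<phi> N (t N)\<bar> \<le>
          (T N - t N) * (\<alpha> * \<epsilon> N / V N)"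
        by (rule perturbed_geometric)
      then show ?case using elim(3) by simp
    qed
    moreover have "(\<lambda>N. real (T N - t N) / V N * (\<alpha> * \<epsilon> N)) \<longlonglongrightarrow>
        u * (\<alpha> * (C' / \<kappa> + 2 * (\<alpha> * C * heat_tail n)))"
    proof -
      have "(\<lambda>N. (\<alpha> * Suc n) / V N + \<alpha> * (S N / V N)) \<longlonglongrightarrow> 0 + real \<alpha> * 0"
        by (intro tendsto_intros S_lim V_inv)
      then have "(\<lambda>N. (Suc n + S N) * \<alpha> / V N) \<longlonglongrightarrow> 0"
        by (simp add: add_divide_distrib algebra_simps)
      then have "\<epsilon> \<longlonglongrightarrow> C' / \<kappa> + 2 * (\<alpha> * C * (heat_tail n + 0)) + 0"
        unfolding \<epsilon>_def by (intro tendsto_intros S_lim)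
      then show ?thesis by (intro tendsto_intros T_lims) simp
    qed
    then have "eventually (\<lambda>N. real (T N - t N) / V N * (\<alpha> * \<epsilon> N) <
        u * (\<alpha> * (C' / \<kappa> + 2 * (\<alpha> * C * heat_tail n))) + \<eta> / 2) sequentially"
      using \<eta> by (intro order_tendstoD) auto
    moreover have "eventually (\<lambda>N. \<bar>q N ^ (T N - t N) * \<phi> N (t N) - exp (- u * c n)\<bar> < \<eta> / 2) sequentially"
    proof -
      have "(\<lambda>N. (1 - c n / V N) ^ (T N - t N)) \<longlonglongrightarrow> exp (- (u * c n))"
      proof (rule power_one_minus_tendsto_exp)
        show "(\<lambda>N. real (T N - t N) * (c n / V N)) \<longlonglongrightarrow> u * c n"
          using tendsto_mult [OF T_lims(2) tendsto_const, of "c n"] by (simp add: mult_ac)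
      qed (use V_inv c_bounds in \<open>auto simp: V_def\<close>)
      \<comment> \<open>Up to the burn-in time at most \<alpha> (t N + 1) of the mass is lost, a
        vanishing fraction of \<open>V N\<close>.\<close>
      moreover have "(\<lambda>N. \<phi> N (t N)) \<longlonglongrightarrow> 1"
      proof (rule tendsto_sandwich)
        show "(\<lambda>N. 1 - \<alpha> * (t N / V N) - \<alpha> / V N) \<longlonglongrightarrow> 1"
          using tendsto_diff [OF tendsto_diff [OF tendsto_const tendsto_mult [OF tendsto_const t_lim]] V_inv,
              of 1 \<alpha> \<alpha>] by simp
        show "eventually (\<lambda>N. 1 - \<alpha> * (t N / V N) - \<alpha> / V N \<le> \<phi> N (t N)) sequentially"
          using eventually_ge_at_top [of 1]
        proof eventually_elim
          case (elim N)
          have "mass N (A N) 0 - mass N (A N) (0 + t N) \<le> t N * card (torus N \<inter> A N)"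
            using elim by (intro mass_drop per)
          also have "\<dots> \<le> t N * \<alpha>" using card [of N] by (intro of_nat_mono mult_left_mono) auto
          finally have "V N - \<alpha> - \<alpha> * t N \<le> mass N (A N) (t N)"
            using card [of N] mass_0 [of N "A N"] by (simp add: V_def mult.commute)
          then have "(V N - \<alpha> - \<alpha> * t N) / V N \<le> \<phi> N (t N)"
            unfolding \<phi>_def using V_pos [OF elim] by (intro divide_right_mono) auto
          then show ?case using V_pos [OF elim] by (simp add: diff_divide_distrib)
        qed
        show "eventually (\<lambda>N. \<phi> N (t N) \<le> 1) sequentially"
          using eventually_ge_at_top [of 1]
          by eventually_elim (use mass_bounds(2) V_pos in \<open>simp add: \<phi>_def V_def\<close>)
      qed simp
      ultimately have "(\<lambda>N. q N ^ (T N - t N) * \<phi> N (t N)) \<longlonglongrightarrow> exp (- u * c n) * 1"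
        unfolding q_def using tendsto_mult by fastforce
      then show ?thesis
        using \<eta> tendstoD [of _ "exp (- u * c n)" sequentially "\<eta> / 2"] by (simp add: dist_real_def)
    qed
    ultimately show ?thesis by eventually_elim linarith
  qed
  show ?thesis
  proof (rule LIMSEQ_I, unfold real_norm_def eventually_sequentially [symmetric])
    fix r :: real assume r: "r > 0"
    \<comment> \<open>One quarter each for the heat kernel tail, the passage from \<open>c n\<close>
      to \<open>cap\<close>, the averaging error and the finite size. The first two fix
      \<open>n\<close>, then the third fixes \<kappa>, and \<open>N\<close> comes last.\<close>
    define \<delta> where "\<delta> = r / 4"
    have \<delta>: "\<delta> > 0" "r = 4 * \<delta>" using r by (simp_all add: \<delta>_def)
    have "(\<lambda>n. u * (\<alpha> * (2 * (\<alpha> * C * heat_tail n)))) \<longlonglongrightarrow> u * (\<alpha> * (2 * (\<alpha> * C * 0)))"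
      by (intro tendsto_intros heat_tail_tendsto_0)
    then have e1: "eventually (\<lambda>n. u * (\<alpha> * (2 * (\<alpha> * C * heat_tail n))) < \<delta>) sequentially"
      using \<delta> by (intro order_tendstoD) auto
    have "(\<lambda>n. exp (- u * c n)) \<longlonglongrightarrow> exp (- u * cap)"
      by (intro tendsto_intros c)
    then have e2: "eventually (\<lambda>n. \<bar>exp (- u * c n) - exp (- u * cap)\<bar> < \<delta>) sequentially"
      using \<delta> tendstoD by (fastforce simp: dist_real_def)
    obtain n where n: "u * (\<alpha> * (2 * (\<alpha> * C * heat_tail n))) < \<delta>"
        "\<bar>exp (- u * c n) - exp (- u * cap)\<bar> < \<delta>"
      using eventually_happens [OF eventually_conj [OF e1 e2]] by auto
    have "(\<lambda>\<kappa>. u * (\<alpha> * (C' * (1 / real \<kappa>)))) \<longlonglongrightarrow> u * (\<alpha> * (C' * 0))"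
      by (intro tendsto_intros lim_1_over_n)
    then have e3: "eventually (\<lambda>\<kappa>. u * (\<alpha> * (C' * (1 / real \<kappa>))) < \<delta>) sequentially"
      using \<delta> by (intro order_tendstoD) auto
    obtain \<kappa> :: nat where \<kappa>: "\<kappa> \<ge> 1" "u * (\<alpha> * (C' * (1 / real \<kappa>))) < \<delta>"
      using eventually_happens [OF eventually_conj [OF eventually_ge_at_top [of 1] e3]] by auto
    have "u * (\<alpha> * (C' / \<kappa> + 2 * (\<alpha> * C * heat_tail n))) < 2 * \<delta>"
      using n(1) \<kappa>(2) by (simp add: algebra_simps)
    moreover note n(2) approx [OF \<kappa>(1) \<delta>(1), of n]
    ultimately show "eventually (\<lambda>N. \<bar>mass N (A N) (nat \<lfloor>u * real N ^ CARD('d)\<rfloor>) / real N ^ CARD('d) -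
        exp (- u * cap)\<bar> < r) sequentially"
      unfolding \<phi>_def T_def V_def
      by (elim eventually_mono) (use \<delta>(2) in linarith)
  qed
qed

section \<open>Random walk probabilities\<close>

abbreviation step_law :: "(int ^ 'd::finite) measure" where
  "step_law \<equiv> measure_pmf (pmf_of_set unit_steps)"

interpretation step_seq: sequence_space "step_law :: (int ^ 'd::finite) measure"
  rewrites "PiM UNIV (\<lambda>_ :: nat. step_law) = (step_measure :: (nat \<Rightarrow> int ^ 'd) measure)"
proof -
  interpret product_prob_space "\<lambda>_ :: nat. step_law :: (int ^ 'd) measure"
    by unfold_locales
  show "sequence_space (step_law :: (int ^ 'd) measure)" by unfold_locales
qed (simp add: step_measure_def)

lemma sets_step_measure [measurable_cong]:
  "sets (step_measure :: (nat \<Rightarrow> int ^ 'd::finite) measure) = sets (PiM UNIV (\<lambda>_. count_space UNIV))"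
  unfolding step_measure_def by (intro sets_PiM_cong) auto

lemma space_step_measure [simp]: "space step_measure = UNIV"
  by (simp add: step_measure_def space_PiM)

lemma prob_space_step_measure: "prob_space (step_measure :: (nat \<Rightarrow> int ^ 'd::finite) measure)"
  by unfold_locales

lemma measurable_partial_sum [measurable]:
  "(\<lambda>\<xi>. z + (\<Sum>i<k. \<xi> i)) \<in> measurable (step_measure :: (nat \<Rightarrow> int ^ 'd::finite) measure) (count_space UNIV)"
proof (induction k)
  case (Suc k)
  have "(\<lambda>\<xi>. (\<lambda>y \<xi>. y + \<xi> k) (z + (\<Sum>i<k. \<xi> i)) \<xi>) \<in>
      measurable (step_measure :: (nat \<Rightarrow> int ^ 'd) measure) (count_space UNIV)"
    by (rule measurable_compose_countable [OF _ Suc]) measurable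
  then show ?case by (simp add: add.assoc)
qed simp

text \<open>Markov property at time one: prepending an independent step to the sequence of steps
  preserves its law.\<close>

lemma measure_step_first:
  fixes E :: "(nat \<Rightarrow> int ^ 'd::finite) set"
  assumes E: "E \<in> sets step_measure"
  shows "measure step_measure E =
    (\<Sum>e\<in>unit_steps. measure step_measure {\<xi>. case_nat e \<xi> \<in> E}) / card (unit_steps :: (int ^ 'd) set)"
proof -
  have meas: "(\<lambda>(s, \<omega>). case_nat s \<omega>) \<in> measurable (step_law \<Otimes>\<^sub>M step_measure) (step_measure :: (nat \<Rightarrow> int ^ 'd) measure)"
    unfolding step_measure_def by measurable
  have sec: "Pair e -` ((\<lambda>(s, \<omega>). case_nat s \<omega>) -` E \<inter> space (step_law \<Otimes>\<^sub>M step_measure)) = {\<xi>. case_nat e \<xi> \<in> E}"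
    for e by (auto simp: space_pair_measure)
  have "emeasure step_measure E = emeasure (distr (step_law \<Otimes>\<^sub>M step_measure) step_measure (\<lambda>(s, \<omega>). case_nat s \<omega>)) E"
    by (simp only: step_seq.PiM_iter)
  also have "\<dots> = (\<integral>\<^sup>+e. emeasure step_measure {\<xi>. case_nat e \<xi> \<in> E} \<partial>step_law)"
    by (subst emeasure_distr [OF meas E])
      (simp only: step_seq.P.emeasure_pair_measure_alt [OF measurable_sets [OF meas E]] sec)
  also have "\<dots> = (\<Sum>e\<in>unit_steps. emeasure step_measure {\<xi>. case_nat e \<xi> \<in> E}) /
      card (unit_steps :: (int ^ 'd) set)"
    by (simp add: nn_integral_pmf_of_set)
  finally show ?thesis
    by (simp add: step_seq.P.emeasure_eq_measure sum_ennreal divide_ennreal card_unit_steps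
        ennreal_of_nat_eq_real_of_nat sum_nonneg del: of_nat_mult)
qed

lemma sets_avoid:
  "{\<xi>. \<forall>k\<in>I. z + (\<Sum>i<k. \<xi> i) \<notin> A} \<in> sets (step_measure :: (nat \<Rightarrow> int ^ 'd::finite) measure)"
proof -
  have "{\<xi> \<in> space (step_measure :: (nat \<Rightarrow> int ^ 'd) measure). \<forall>k\<in>I. z + (\<Sum>i<k. \<xi> i) \<notin> A} \<in> sets step_measure"
    by measurable
  then show ?thesis by simp
qed

text \<open>Formulated with the avoidance formula at level \<open>t\<close> as a hypothesis, so that
  it serves in the induction that proves this formula and again once it is available.\<close>

lemma measure_avoid_after_step:
  fixes A :: "(int ^ 'd::finite) set"
  assumes "\<And>z. measure step_measure {\<xi>. \<forall>k\<in>{..t}. z + (\<Sum>i<k. \<xi> i) \<notin> A} = surv A t z"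
  shows "measure step_measure {\<xi>. \<forall>k\<in>{1..Suc t}. z + (\<Sum>i<k. \<xi> i) \<notin> A} = avg (surv A t) z"
proof -
  have "{\<xi>. case_nat e \<xi> \<in> {\<xi>. \<forall>k\<in>{1..Suc t}. z + (\<Sum>i<k. \<xi> i) \<notin> A}} =
      {\<xi>. \<forall>k\<in>{..t}. (z + e) + (\<Sum>i<k. \<xi> i) \<notin> A}" for e
  proof -
    have "(\<Sum>i<Suc k. case_nat e \<xi> i) = e + (\<Sum>i<k. \<xi> i)" for k and \<xi> :: "nat \<Rightarrow> int ^ 'd"
      by (simp add: sum.lessThan_Suc_shift del: sum.lessThan_Suc)
    moreover have "{1..Suc t} = Suc ` {..t}" by (simp add: image_Suc_atMost)
    ultimately show ?thesis by (simp add: add.assoc del: sum.lessThan_Suc)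
  qed
  then show ?thesis
    by (subst measure_step_first [OF sets_avoid]) (simp add: assms avg_def)
qed

lemma measure_avoid:
  fixes A :: "(int ^ 'd::finite) set"
  shows "measure step_measure {\<xi>. \<forall>k\<in>{..t}. z + (\<Sum>i<k. \<xi> i) \<notin> A} = surv A t z"
proof (induction t arbitrary: z)
  case 0
  have "measure (step_measure :: (nat \<Rightarrow> int ^ 'd) measure) UNIV = 1"
    using prob_space.prob_space [OF prob_space_step_measure] by simp
  then show ?case by (simp add: surv_0 indicator_def)
next
  case (Suc t)
  have "{\<xi> :: nat \<Rightarrow> int ^ 'd. \<forall>k\<in>{..Suc t}. z + (\<Sum>i<k. \<xi> i) \<notin> A} =
      (if z \<in> A then {} else {\<xi>. \<forall>k\<in>{1..Suc t}. z + (\<Sum>i<k. \<xi> i) \<notin> A})"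
  proof -
    have "{..Suc t} = insert 0 {1..Suc t}" by auto
    then show ?thesis by (simp only: ball_simps) auto
  qed
  then show ?case
    using measure_avoid_after_step [OF Suc, of z] by (simp add: surv_Suc)
qed

lemma measure_avoid_pos:
  fixes A :: "(int ^ 'd::finite) set"
  shows "measure step_measure {\<xi>. \<forall>k\<in>{1..Suc t}. z + (\<Sum>i<k. \<xi> i) \<notin> A} = avg (surv A t) z"
  by (rule measure_avoid_after_step) (rule measure_avoid)

lemma return_time_eq_infinity: "return_time K X = \<infinity> \<longleftrightarrow> (\<forall>n\<ge>1. X n \<notin> K)"
  unfolding return_time_def top_enat_def [symmetric] INF_top_conv by (auto simp: top_enat_def)

lemma measurable_walk:
  "(\<lambda>\<xi> n. x + (\<Sum>k<n. \<xi> k)) \<in>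
    measurable (step_measure :: (nat \<Rightarrow> int ^ 'd::finite) measure) (PiM UNIV (\<lambda>_. count_space UNIV))"
  by (rule measurable_PiM_single') (simp_all add: space_PiM)

text \<open>Continuity from above: the events of avoiding \<open>K\<close> during {1..n + 1}
  decrease to the event of never returning.\<close>

lemma escape_tendsto:
  fixes K :: "(int ^ 'd::finite) set"
  shows "(\<lambda>n. avg (surv K n) x) \<longlonglongrightarrow> measure (srw x) {X \<in> space (srw x). return_time K X = \<infinity>}"
proof -
  define E where "E n = {\<xi> :: nat \<Rightarrow> int ^ 'd. \<forall>k\<in>{1..Suc n}. x + (\<Sum>i<k. \<xi> i) \<notin> K}" for n
  have "(\<lambda>n. measure step_measure (E n)) \<longlonglongrightarrow> measure step_measure (\<Inter>n. E n)"
    by (intro step_seq.P.finite_Lim_measure_decseq)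
      (auto simp: E_def decseq_def intro: sets_avoid [where I = "{1..Suc _}", simplified])
  also have "(\<lambda>n. measure step_measure (E n)) = (\<lambda>n. avg (surv K n) x)"
    by (simp only: E_def measure_avoid_pos)
  also have "measure step_measure (\<Inter>n. E n) = measure (srw x) {X \<in> space (srw x). return_time K X = \<infinity>}"
  proof -
    have "{X \<in> space (PiM UNIV (\<lambda>_ :: nat. count_space UNIV)). \<forall>n\<ge>1. X n \<notin> K} \<in> sets (PiM UNIV (\<lambda>_ :: nat. count_space UNIV))"
      by measurable
    then have "measure (srw x) {X \<in> space (srw x). return_time K X = \<infinity>} =
        measure step_measure {\<xi>. \<forall>n\<ge>1. x + (\<Sum>k<n. \<xi> k) \<notin> K}"
      unfolding srw_def return_time_eq_infinity
      by (subst measure_distr [OF measurable_walk]) (auto simp: space_PiM intro!: arg_cong [where f = "measure step_measure"])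
    also have "{\<xi>. \<forall>n\<ge>1. x + (\<Sum>k<n. \<xi> k) \<notin> K} = (\<Inter>n. E n)"
    proof safe
      fix \<xi> n assume "\<xi> \<in> (\<Inter>n. E n)" "1 \<le> n" "x + (\<Sum>k<n. \<xi> k) \<in> K"
      moreover from this have "\<xi> \<in> E n" by blast
      ultimately show False by (auto simp: E_def)
    qed (auto simp: E_def)
    finally show ?thesis ..
  qed
  finally show ?thesis .
qed

lemma capacity_tendsto: "(\<lambda>n. \<Sum>x\<in>K. avg (surv K n) x) \<longlonglongrightarrow> capacity K"
  unfolding capacity_def by (intro tendsto_sum escape_tendsto)

section \<open>The walk on the torus and its avoidance probabilities\<close>

lemma measurable_torus_walk_map:
  assumes "N \<ge> 1"
  shows "(\<lambda>(x, \<xi>) n. torus_add N x (torus_proj N (\<Sum>k<n. \<xi> k))) \<in>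
    measurable (measure_pmf (pmf_of_set (torus N)) \<Otimes>\<^sub>M (step_measure :: (nat \<Rightarrow> int ^ 'd::finite) measure))
      (PiM UNIV (\<lambda>_. count_space (torus N)))"
proof (rule measurable_PiM_single')
  fix n :: nat
  show "(\<lambda>p. (case p of (x, \<xi>) \<Rightarrow> \<lambda>n. torus_add N x (torus_proj N (\<Sum>k<n. \<xi> k))) n) \<in>
    measurable (measure_pmf (pmf_of_set (torus N)) \<Otimes>\<^sub>M (step_measure :: (nat \<Rightarrow> int ^ 'd) measure)) (count_space (torus N))"
  proof -
    have "(\<lambda>p. (\<lambda>x p. torus_add N x (torus_proj N (\<Sum>k<n. snd p k))) (fst p) p) \<in>
      measurable (measure_pmf (pmf_of_set (torus N)) \<Otimes>\<^sub>M (step_measure :: (nat \<Rightarrow> int ^ 'd) measure)) (count_space (torus N))"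
    proof (rule measurable_compose_countable [where g = fst])
      fix x :: "int ^ 'd"
      have "(\<lambda>v. torus_add N x (torus_proj N v)) \<in> measurable (count_space UNIV) (count_space (torus N))"
        using assms by (simp add: torus_add_def)
      from measurable_compose [OF measurable_compose [OF measurable_snd measurable_partial_sum [of 0 n]] this]
      show "(\<lambda>p. torus_add N x (torus_proj N (\<Sum>k<n. snd p k))) \<in>
        measurable (measure_pmf (pmf_of_set (torus N)) \<Otimes>\<^sub>M step_measure) (count_space (torus N))" by simp
    qed measurable
    then show ?thesis by (simp add: case_prod_unfold)
  qed
qed (use assms in \<open>auto simp: space_PiM torus_add_def\<close>)

lemma prob_space_torus_walk: "N \<ge> 1 \<Longrightarrow> prob_space (torus_walk N :: (nat \<Rightarrow> int ^ 'd::finite) measure)"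
  unfolding torus_walk_def
  by (intro prob_space.prob_space_distr measurable_torus_walk_map)
    (simp_all add: prob_space_pair prob_space_measure_pmf prob_space_step_measure)

lemma sets_torus_walk [measurable_cong]:
  "sets (torus_walk N) = sets (PiM UNIV (\<lambda>_. count_space (torus N)))"
  by (simp add: torus_walk_def)

lemma pred_torus_walk_avoid: "Measurable.pred (torus_walk N) (\<lambda>X. \<forall>k\<le>t. X k \<notin> B)"
proof -
  have "Measurable.pred (PiM UNIV (\<lambda>_ :: nat. count_space (torus N))) (\<lambda>X. X k \<notin> B)" for k
    by (rule measurable_compose [OF measurable_component_singleton [of k]]) simp_all
  then have "Measurable.pred (PiM UNIV (\<lambda>_ :: nat. count_space (torus N))) (\<lambda>X. \<forall>k\<in>{..t}. X k \<notin> B)"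
    by (intro pred_intros_finite) simp_all
  then show ?thesis
    unfolding measurable_cong_sets [OF sets_torus_walk refl] by (simp only: Ball_def atMost_iff)
qed

text \<open>The torus walk avoids \<open>B\<close> exactly when the lattice walk that drives it
  avoids the periodic preimage of \<open>B\<close>; integrating over the uniform start gives the
  mass.\<close>

lemma measure_torus_walk_avoid:
  fixes B :: "(int ^ 'd::finite) set"
  assumes N: "N \<ge> 1"
  shows "measure (torus_walk N) {X \<in> space (torus_walk N). \<forall>k\<le>t. X k \<notin> B} =
    mass N {z. torus_proj N z \<in> B} t / real N ^ CARD('d)"
proof -
  let ?U = "measure_pmf (pmf_of_set (torus N)) :: (int ^ 'd) measure"
  let ?A = "{z. torus_proj N z \<in> B}"
  let ?f = "\<lambda>(x, \<xi>) n. torus_add N x (torus_proj N (\<Sum>k<n. \<xi> k))"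
  have E: "{X \<in> space (PiM UNIV (\<lambda>_ :: nat. count_space (torus N))). \<forall>k\<le>t. X k \<notin> B} \<in>
      sets (PiM UNIV (\<lambda>_ :: nat. count_space (torus N)))" (is "?E \<in> _")
    using pred_torus_walk_avoid [where N = N and t = t and B = B] unfolding torus_walk_def pred_def by (simp only: space_distr sets_distr)
  note meas = measurable_torus_walk_map [OF N, where 'd = 'd]
  have sec: "Pair x -` (?f -` ?E \<inter> space (?U \<Otimes>\<^sub>M step_measure)) = {\<xi>. \<forall>k\<in>{..t}. x + (\<Sum>i<k. \<xi> i) \<notin> ?A}" for x
    using N by (auto simp: space_pair_measure space_PiM torus_add_def torus_proj_add_right)
  have "emeasure (torus_walk N) ?E = emeasure (?U \<Otimes>\<^sub>M step_measure) (?f -` ?E \<inter> space (?U \<Otimes>\<^sub>M step_measure))"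
    unfolding torus_walk_def by (rule emeasure_distr [OF meas E])
  also have "\<dots> = (\<integral>\<^sup>+x. emeasure step_measure {\<xi>. \<forall>k\<in>{..t}. x + (\<Sum>i<k. \<xi> i) \<notin> ?A} \<partial>?U)"
    by (subst step_seq.P.emeasure_pair_measure_alt [OF measurable_sets [OF meas E]]) (simp only: sec)
  also have "\<dots> = (\<integral>\<^sup>+x. ennreal (surv ?A t x) \<partial>?U)"
    by (simp only: step_seq.P.emeasure_eq_measure measure_avoid)
  also have "\<dots> = (\<Sum>x\<in>torus N. ennreal (surv ?A t x)) / card (torus N :: (int ^ 'd) set)"
    using N by (subst nn_integral_pmf_of_set) (auto simp: torus_nonempty)
  also have "\<dots> = ennreal (mass N ?A t / real N ^ CARD('d))"
    using N by (simp add: mass_def sum_ennreal surv_bounds divide_ennreal card_torus sum_nonneg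
        ennreal_of_nat_eq_real_of_nat)
  finally show ?thesis
    by (simp add: measure_def torus_walk_def mass_bounds(1))
qed

section \<open>Locality and the vacant sets\<close>

text \<open>In \<open>n\<close> steps no coordinate moves by more than \<open>n\<close>. Two centres
  and two sets are allowed so that a patch of the periodic set can be compared with a finite set on
  the lattice.\<close>

lemma surv_local:
  fixes A A' :: "(int ^ 'd::finite) set"
  assumes "\<And>v. (\<forall>i. \<bar>v $ i\<bar> \<le> int n) \<Longrightarrow> z + v \<in> A \<longleftrightarrow> z' + v \<in> A'"
  shows "surv A n z = surv A' n z'"
  using assms
proof (induction n arbitrary: z z')
  case 0
  from 0 [of 0] show ?case by (simp add: surv_0 indicator_def)
next
  case (Suc n)
  have "surv A n (z + e) = surv A' n (z' + e)" if e: "e \<in> unit_steps" for e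
  proof (rule Suc.IH)
    fix v :: "int ^ 'd" assume v: "\<forall>i. \<bar>v $ i\<bar> \<le> int n"
    have "\<bar>(e + v) $ i\<bar> \<le> int (Suc n)" for i
    proof -
      have "\<bar>e $ i\<bar> \<le> 1" using e by (auto simp: unit_steps_def axis_def)
      then show ?thesis using v [rule_format, of i] by simp
    qed
    then show "z + e + v \<in> A \<longleftrightarrow> z' + e + v \<in> A'"
      using Suc.prems [of "e + v"] by (simp add: add.assoc)
  qed
  then have "avg (surv A n) z = avg (surv A' n) z'" by (simp add: avg_def)
  moreover have "z \<in> A \<longleftrightarrow> z' \<in> A'" using Suc.prems [of 0] by simp
  ultimately show ?case by (simp add: surv_Suc)
qed

lemma avg_surv_local:
  fixes A A' :: "(int ^ 'd::finite) set"
  assumes "\<And>v. (\<forall>i. \<bar>v $ i\<bar> \<le> int (Suc n)) \<Longrightarrow> z + v \<in> A \<longleftrightarrow> z' + v \<in> A'"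
  shows "avg (surv A n) z = avg (surv A' n) z'"
proof -
  have "surv A n (z + e) = surv A' n (z' + e)" if e: "e \<in> unit_steps" for e
  proof (rule surv_local)
    fix v :: "int ^ 'd" assume v: "\<forall>i. \<bar>v $ i\<bar> \<le> int n"
    have "\<bar>(e + v) $ i\<bar> \<le> int (Suc n)" for i
    proof -
      have "\<bar>e $ i\<bar> \<le> 1" using e by (auto simp: unit_steps_def axis_def)
      then show ?thesis using v [rule_format, of i] by simp
    qed
    then show "z + e + v \<in> A \<longleftrightarrow> z' + e + v \<in> A'"
      using assms [of "e + v"] by (simp add: add.assoc)
  qed
  then show ?thesis by (simp add: avg_def)
qed

lemma sup_norm_le: "(\<And>i. \<bar>z $ i\<bar> \<le> int R) \<Longrightarrow> sup_norm z \<le> R"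
  unfolding sup_norm_def by (subst Max_le_iff) (auto simp: nat_le_iff)

lemma torus_dist_le_sup_norm: "torus_dist N (torus_proj N z) (torus_proj N z') \<le> sup_norm (z - z')"
  unfolding torus_dist_def by (rule cInf_lower) auto

text \<open>Lift to the lattice of the union of the translates K i + y i on the torus. Avoiding it
  means that every \<open>K i\<close> is vacant as seen from \<open>y i\<close>.\<close>

definition copies :: "nat \<Rightarrow> ('m \<Rightarrow> int ^ 'd::finite) \<Rightarrow> ('m \<Rightarrow> (int ^ 'd) set) \<Rightarrow> (int ^ 'd) set" where
  "copies N y K = {w. \<exists>i. \<exists>z\<in>K i. torus_proj N w = torus_proj N (z + y i)}"

lemma periodic_copies: "periodic N (\<lambda>w. w \<in> copies N y K)"
  by (simp add: periodic_def copies_def)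

lemma torus_copies:
  assumes "N \<ge> 1"
  shows "torus N \<inter> copies N y K = (\<lambda>(i, z). torus_proj N (z + y i)) ` Sigma UNIV K"
proof (intro set_eqI iffI)
  fix w assume w: "w \<in> torus N \<inter> copies N y K"
  then obtain i z where "z \<in> K i" "torus_proj N w = torus_proj N (z + y i)"
    by (auto simp: copies_def)
  with w show "w \<in> (\<lambda>(i, z). torus_proj N (z + y i)) ` Sigma UNIV K"
    by (intro image_eqI [of _ _ "(i, z)"]) (simp_all add: torus_proj_of_torus)
next
  fix w assume "w \<in> (\<lambda>(i, z). torus_proj N (z + y i)) ` Sigma UNIV K"
  then obtain i z where "z \<in> K i" "w = torus_proj N (z + y i)" by auto
  with assms show "w \<in> torus N \<inter> copies N y K"
    unfolding copies_def by (metis (mono_tags, lifting) IntI mem_Collect_eq torus_proj_idem torus_proj_in_torus)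
qed

lemma card_torus_copies_le:
  fixes K :: "'m::finite \<Rightarrow> (int ^ 'd::finite) set"
  assumes "\<And>i. finite (K i)"
  shows "card (torus N \<inter> copies N y K) \<le> (\<Sum>i\<in>UNIV. card (K i))"
proof (cases "N \<ge> 1")
  case True
  have "card (torus N \<inter> copies N y K) \<le> card (Sigma UNIV K)"
    unfolding torus_copies [OF True] by (intro card_image_le finite_SigmaI assms) simp
  then show ?thesis using assms by simp
next
  case False
  then have "torus N = ({} :: (int ^ 'd) set)" by (simp add: torus_def)
  then show ?thesis by simp
qed

text \<open>Once the centres are far apart and \<open>N\<close> is large, the walk started in one
  copy sees during \<open>n\<close> + 1 steps only this copy, without wrapping around the torus.
  Hence equality rather than convergence.\<close>

lemma escape_sum_eventually:
  fixes x :: "nat \<Rightarrow> 'm::finite \<Rightarrow> int ^ 'd::finite" and K :: "'m \<Rightarrow> (int ^ 'd) set"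
  assumes fin: "\<And>i. finite (K i)"
    and x: "\<And>N i. N \<ge> 1 \<Longrightarrow> x N i \<in> torus N"
    and dist: "(\<lambda>N. INF (i, j)\<in>{(i, j). i \<noteq> j}. ereal (real (torus_dist N (x N i) (x N j)))) \<longlonglongrightarrow> \<infinity>"
  shows "eventually (\<lambda>N. (\<Sum>w\<in>torus N \<inter> copies N (x N) K. avg (surv (copies N (x N) K) n) w) =
    (\<Sum>i\<in>UNIV. \<Sum>z\<in>K i. avg (surv (K i) n) z)) sequentially"
proof -
  \<comment> \<open>A common bound for all coordinates; inserting 0 covers the case that every
    \<open>K i\<close> is empty.\<close>
  define R0 where "R0 = Max (insert 0 ((\<lambda>(z, k). nat \<bar>z $ k\<bar>) ` ((\<Union>i. K i) \<times> UNIV)))"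
  have R0: "\<bar>z $ k\<bar> \<le> int R0" if "z \<in> K i" for z k i
  proof -
    have "nat \<bar>z $ k\<bar> \<le> R0"
      unfolding R0_def using that fin by (intro Max_ge) (auto intro!: image_eqI [of _ _ "(z, k)"])
    then show ?thesis by linarith
  qed
  \<comment> \<open>Bounds z + v - z' for z and z' in the finite sets and a displacement v of at
    most \<open>n\<close> + 1 in each coordinate.\<close>
  define R where "R = Suc n + 2 * R0"
  have "eventually (\<lambda>N. ereal (real R) <
      (INF (i, j)\<in>{(i, j). i \<noteq> j}. ereal (real (torus_dist N (x N i) (x N j))))) sequentially"
    using dist by (rule order_tendstoD) simp
  then show ?thesis using eventually_gt_at_top [of R]
  proof eventually_elim
    case (elim N)
    define A where "A = copies N (x N) K"
    have N: "N \<ge> 1" using elim by simp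
    have far: "R < torus_dist N (x N i) (x N j)" if "i \<noteq> j" for i j
    proof -
      have "ereal (real R) < ereal (real (torus_dist N (x N i) (x N j)))"
        by (rule less_le_trans [OF elim(1)], rule INF_lower2 [of "(i, j)"]) (use that in simp_all)
      then show ?thesis by simp
    qed
    have separate: "i = j \<and> z' = z + v"
      if z: "z \<in> K i" and z': "z' \<in> K j" and v: "\<forall>k. \<bar>v $ k\<bar> \<le> int (Suc n)"
        and eq: "torus_proj N (z + x N i + v) = torus_proj N (z' + x N j)" for i j z z' v
    proof -
      have small: "\<bar>(z + v - z') $ k\<bar> \<le> int R" for k
        using R0 [OF z, of k] R0 [OF z', of k] v [rule_format, of k] by (simp add: R_def)
      have "i = j"
      proof (rule ccontr)
        assume "i \<noteq> j"
        have "torus_proj N (x N i + (z + v - z')) = torus_proj N (x N j)"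
          using eq by (simp add: torus_proj_eq_iff algebra_simps)
        then have "torus_dist N (x N j) (x N i) \<le> sup_norm (x N i + (z + v - z') - x N i)"
          using torus_dist_le_sup_norm [of N "x N i + (z + v - z')" "x N i"] x [OF N]
          by (simp add: torus_proj_of_torus)
        also have "\<dots> \<le> R" using small by (intro sup_norm_le) simp
        finally show False using far [of j i] \<open>i \<noteq> j\<close> by simp
      qed
      \<comment> \<open>Excludes wrapping around: a nonzero multiple of \<open>N\<close> cannot be
        as small as \<open>R\<close> < N.\<close>
      moreover have "(z + v - z') $ k = 0" for k
      proof (rule ccontr)
        assume nonzero: "(z + v - z') $ k \<noteq> 0"
        have "(z + x N i + v) $ k - (z' + x N j) $ k = (z + v - z') $ k"
          using \<open>i = j\<close> by simp
        then have "int N dvd (z + v - z') $ k"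
          using eq unfolding torus_proj_eq_iff by metis
        then have "\<bar>int N\<bar> \<le> \<bar>(z + v - z') $ k\<bar>" by (rule dvd_imp_le_int [OF nonzero])
        then show False using small [of k] elim(2) by linarith
      qed
      then have "z' = z + v" by (simp add: vec_eq_iff)
      ultimately show ?thesis by simp
    qed
    have inj: "inj_on (\<lambda>(i, z). torus_proj N (z + x N i)) (Sigma UNIV K)"
    proof (rule inj_onI, clarify)
      fix i z j z' assume "z \<in> K i" "z' \<in> K j" "torus_proj N (z + x N i) = torus_proj N (z' + x N j)"
      then show "i = j \<and> z = z'" using separate [of z i z' j 0] by simp
    qed
    have "avg (surv A n) (torus_proj N (z + x N i)) = avg (surv (K i) n) z" if z: "z \<in> K i" for i z
    proof -
      have "avg (surv A n) (torus_proj N (z + x N i)) = avg (surv A n) (z + x N i)"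
        using periodicD [OF periodic_avg [OF periodic_surv [OF periodic_copies]]] by (simp add: A_def)
      also have "\<dots> = avg (surv (K i) n) z"
      proof (rule avg_surv_local)
        fix v :: "int ^ 'd" assume v: "\<forall>k. \<bar>v $ k\<bar> \<le> int (Suc n)"
        show "z + x N i + v \<in> A \<longleftrightarrow> z + v \<in> K i"
        proof
          assume "z + x N i + v \<in> A"
          then obtain j z' where "z' \<in> K j" "torus_proj N (z + x N i + v) = torus_proj N (z' + x N j)"
            by (auto simp: A_def copies_def)
          then show "z + v \<in> K i" using separate [OF z _ v] by blast
        next
          assume "z + v \<in> K i"
          then show "z + x N i + v \<in> A"
            unfolding A_def copies_def by (intro CollectI exI [of _ i] bexI [of _ "z + v"]) (simp_all add: add_ac)
        qed
      qed
      finally show ?thesis .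
    qed
    then have "(\<Sum>w\<in>torus N \<inter> A. avg (surv A n) w) = (\<Sum>(i, z)\<in>Sigma UNIV K. avg (surv (K i) n) z)"
      unfolding A_def torus_copies [OF N] sum.reindex [OF inj]
      by (intro sum.cong) (auto simp: A_def)
    also have "\<dots> = (\<Sum>i\<in>UNIV. \<Sum>z\<in>K i. avg (surv (K i) n) z)"
      using fin by (simp add: sum.Sigma)
    finally show ?case by (simp add: A_def)
  qed
qed

text \<open>Joint vacancy around all centres is avoidance of one periodic set, so a single survival
  limit covers it; the factorisation of the limit comes from the additivity of the escape
  sums.\<close>

theorem vacant_probability_tendsto:
  fixes x :: "nat \<Rightarrow> 'm::finite \<Rightarrow> int ^ 'd::finite" and K :: "'m \<Rightarrow> (int ^ 'd) set"
  assumes u: "u > 0" and d: "CARD('d) \<ge> 3" and x: "\<And>N i. N \<ge> 1 \<Longrightarrow> x N i \<in> torus N"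
    and dist: "(\<lambda>N. INF (i, j)\<in>{(i, j). i \<noteq> j}. ereal (real (torus_dist N (x N i) (x N j)))) \<longlonglongrightarrow> \<infinity>"
    and fin: "\<And>i. finite (K i)"
  shows "(\<lambda>N. measure (torus_walk N) {X \<in> space (torus_walk N).
      \<forall>i. \<forall>z\<in>K i. vacant_config N (x N i) (u * real N ^ CARD('d)) X z})
    \<longlonglongrightarrow> exp (- u * (\<Sum>i\<in>UNIV. capacity (K i)))"
proof -
  have "(\<lambda>N. mass N (copies N (x N) K) (nat \<lfloor>u * real N ^ CARD('d)\<rfloor>) / real N ^ CARD('d))
      \<longlonglongrightarrow> exp (- u * (\<Sum>i\<in>UNIV. capacity (K i)))"
  proof (rule survival_limit [OF d u periodic_copies card_torus_copies_le])
    show "(\<lambda>n. \<Sum>i\<in>UNIV. \<Sum>z\<in>K i. avg (surv (K i) n) z) \<longlonglongrightarrow> (\<Sum>i\<in>UNIV. capacity (K i))"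
      by (intro tendsto_sum capacity_tendsto)
  qed (intro fin, intro escape_sum_eventually fin x dist)
  then show ?thesis
  proof (rule Lim_transform_eventually)
    show "eventually (\<lambda>N. mass N (copies N (x N) K) (nat \<lfloor>u * real N ^ CARD('d)\<rfloor>) / real N ^ CARD('d) =
      measure (torus_walk N) {X \<in> space (torus_walk N).
        \<forall>i. \<forall>z\<in>K i. vacant_config N (x N i) (u * real N ^ CARD('d)) X z}) sequentially"
      using eventually_ge_at_top [of 1]
    proof eventually_elim
      case (elim N)
      define B where "B = {w. \<exists>i. \<exists>z\<in>K i. w = torus_proj N (z + x N i)}"
      have "(\<forall>i. \<forall>z\<in>K i. vacant_config N (x N i) (u * real N ^ CARD('d)) X z) \<longleftrightarrow>
          (\<forall>k\<le>nat \<lfloor>u * real N ^ CARD('d)\<rfloor>. X k \<notin> B)" for X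
        by (auto simp: vacant_config_def B_def torus_add_def torus_proj_add_left)
      moreover have "copies N (x N) K = {w. torus_proj N w \<in> B}"
        by (simp add: copies_def B_def)
      ultimately show ?case
        using measure_torus_walk_avoid [OF elim, of "nat \<lfloor>u * real N ^ CARD('d)\<rfloor>" B] by simp
    qed
  qed
qed

section \<open>Cylinder events\<close>

text \<open>Induction on \<open>Q\<close>, with \<open>P\<close> left general because removing a
  negated condition at q subtracts the event in which q has joined \<open>P\<close>.\<close>

lemma (in finite_measure) measure_inclusion_exclusion:
  assumes B: "\<And>p. {\<omega> \<in> space M. B p \<omega>} \<in> sets M" and "finite P" "finite Q"
  shows "measure M {\<omega> \<in> space M. (\<forall>p\<in>P. B p \<omega>) \<and> (\<forall>p\<in>Q. \<not> B p \<omega>)} =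
    (\<Sum>S\<in>Pow Q. (-1) ^ card S * measure M {\<omega> \<in> space M. \<forall>p\<in>P \<union> S. B p \<omega>})"
  using assms(3,2)
proof (induction Q arbitrary: P)
  case (insert q Q)
  let ?E = "\<lambda>P Q. {\<omega> \<in> space M. (\<forall>p\<in>P. B p \<omega>) \<and> (\<forall>p\<in>Q. \<not> B p \<omega>)}"
  let ?F = "\<lambda>P. {\<omega> \<in> space M. \<forall>p\<in>P. B p \<omega>}"
  have sets: "?E P Q \<in> sets M" if "finite P" for P
    using that insert.hyps
    by (intro sets.sets_Collect_conj sets.sets_Collect_finite_All sets.sets_Collect_neg B)
  have "?E P (insert q Q) = ?E P Q - ?E (insert q P) Q" by auto
  then have "measure M (?E P (insert q Q)) = measure M (?E P Q) - measure M (?E (insert q P) Q)"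
    using insert.prems by (simp only:) (intro finite_measure_Diff sets; auto)
  also have "\<dots> = (\<Sum>S\<in>Pow Q. (-1) ^ card S * measure M (?F (P \<union> S))) +
      (\<Sum>S\<in>Pow Q. (-1) ^ card (insert q S) * measure M (?F (P \<union> insert q S)))"
  proof -
    have "card (insert q S) = Suc (card S)" if "S \<in> Pow Q" for S
      using that insert.hyps by (intro card_insert_disjoint) (auto intro: finite_subset)
    then show ?thesis
      using insert.IH [OF insert.prems] insert.IH [of "insert q P"] insert.prems
      by (simp add: sum_negf)
  qed
  also have "\<dots> = (\<Sum>S\<in>Pow (insert q Q). (-1) ^ card S * measure M (?F (P \<union> S)))"
  proof -
    have "inj_on (insert q) (Pow Q)"
      using insert.hyps by (auto simp: inj_on_def)
    then show ?thesis
      unfolding Pow_insert using insert.hyps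
      by (subst sum.union_disjoint) (auto simp: sum.reindex)
  qed
  finally show ?case .
qed simp

lemma pattern_tendsto:
  fixes \<mu> :: "nat \<Rightarrow> 'b measure"
  assumes "\<And>N. finite_measure (\<mu> N)" "\<And>N p. {\<omega> \<in> space (\<mu> N). B p \<omega>} \<in> sets (\<mu> N)"
    and "\<And>P. finite P \<Longrightarrow> (\<lambda>N. measure (\<mu> N) {\<omega> \<in> space (\<mu> N). \<forall>p\<in>P. B p \<omega>}) \<longlonglongrightarrow> q P"
    and "finite P" "finite Q"
  shows "(\<lambda>N. measure (\<mu> N) {\<omega> \<in> space (\<mu> N). (\<forall>p\<in>P. B p \<omega>) \<and> (\<forall>p\<in>Q. \<not> B p \<omega>)}) \<longlonglongrightarrow>
    (\<Sum>S\<in>Pow Q. (-1) ^ card S * q (P \<union> S))"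
proof -
  have eq: "measure (\<mu> N) {\<omega> \<in> space (\<mu> N). (\<forall>p\<in>P. B p \<omega>) \<and> (\<forall>p\<in>Q. \<not> B p \<omega>)} =
      (\<Sum>S\<in>Pow Q. (-1) ^ card S * measure (\<mu> N) {\<omega> \<in> space (\<mu> N). \<forall>p\<in>P \<union> S. B p \<omega>})" for N
    by (rule finite_measure.measure_inclusion_exclusion [OF assms(1,2,4,5)])
  show ?thesis unfolding eq
    using assms(4,5) by (intro tendsto_intros assms(3)) (auto intro: finite_subset)
qed

section \<open>Weak convergence of configurations\<close>

lemma compact_UNIV_fun:
  assumes "compact (UNIV :: 'b::topological_space set)"
  shows "compact (UNIV :: ('a \<Rightarrow> 'b) set)"
proof -
  have "compactin (product_topology (\<lambda>_ :: 'a. euclidean :: 'b topology) UNIV) (PiE UNIV (\<lambda>_. UNIV))"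
    unfolding compactin_PiE using assms by simp
  then show ?thesis by (simp add: euclidean_product_topology)
qed

lemma open_fun_basis:
  fixes U :: "('a \<Rightarrow> 'b::topological_space) set"
  assumes "open U" "\<omega> \<in> U"
  obtains X where "\<And>i. open (X i)" "\<And>i. \<omega> i \<in> X i" "finite {i. X i \<noteq> UNIV}"
    "\<And>\<omega>'. (\<And>i. \<omega>' i \<in> X i) \<Longrightarrow> \<omega>' \<in> U"
proof -
  have "openin (product_topology (\<lambda>_. euclidean) UNIV) U"
    using assms(1) by (simp add: euclidean_product_topology)
  from product_topology_open_contains_basis [OF this assms(2)] that show thesis
    by (auto simp: PiE_UNIV_domain) blast
qed

lemma open_config_cylinder:
  fixes U :: "('a \<Rightarrow> bool) set"
  assumes "open U" "\<omega> \<in> U"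
  obtains K where "finite K" "\<And>\<omega>'. (\<And>z. z \<in> K \<Longrightarrow> \<omega>' z = \<omega> z) \<Longrightarrow> \<omega>' \<in> U"
proof -
  obtain X where X: "\<And>i. open (X i)" "\<And>i. \<omega> i \<in> X i" "finite {i. X i \<noteq> UNIV}"
    "\<And>\<omega>'. (\<And>i. \<omega>' i \<in> X i) \<Longrightarrow> \<omega>' \<in> U"
    using open_fun_basis [OF assms] by metis
  show thesis
  proof (rule that [OF X(3)])
    fix \<omega>' assume eq: "\<And>z. z \<in> {i. X i \<noteq> UNIV} \<Longrightarrow> \<omega>' z = \<omega> z"
    show "\<omega>' \<in> U"
    proof (rule X(4))
      fix i show "\<omega>' i \<in> X i"
        using eq [of i] X(2) [of i] by (cases "X i = UNIV") auto
    qed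
  qed
qed

text \<open>The topology is a product of products; finiteness of the outer index keeps the union of
  the inner coordinate sets finite.\<close>

lemma open_configs_cylinder:
  fixes U :: "('m::finite \<Rightarrow> 'a \<Rightarrow> bool) set"
  assumes "open U" "\<omega> \<in> U"
  obtains P where "finite P" "\<And>\<omega>'. (\<And>i z. (i, z) \<in> P \<Longrightarrow> \<omega>' i z = \<omega> i z) \<Longrightarrow> \<omega>' \<in> U"
proof -
  obtain X where X: "\<And>i. open (X i)" "\<And>i. \<omega> i \<in> X i" "\<And>\<omega>'. (\<And>i. \<omega>' i \<in> X i) \<Longrightarrow> \<omega>' \<in> U"
    using open_fun_basis [OF assms] by metis
  have "\<exists>K. finite K \<and> (\<forall>\<eta>. (\<forall>z\<in>K. \<eta> z = \<omega> i z) \<longrightarrow> \<eta> \<in> X i)" for i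
    using open_config_cylinder [OF X(1,2)] by metis
  then obtain K where K: "\<And>i. finite (K i)" "\<And>i \<eta>. (\<And>z. z \<in> K i \<Longrightarrow> \<eta> z = \<omega> i z) \<Longrightarrow> \<eta> \<in> X i"
    by metis
  show thesis
  proof (rule that [of "Sigma UNIV K"])
    show "finite (Sigma UNIV K)" using K(1) by simp
    fix \<omega>' assume "\<And>i z. (i, z) \<in> Sigma UNIV K \<Longrightarrow> \<omega>' i z = \<omega> i z"
    then show "\<omega>' \<in> U" by (intro X(3) K(2)) simp
  qed
qed

lemma open_coordinate: "open {\<omega> :: 'm \<Rightarrow> 'a \<Rightarrow> bool. \<omega> i z = b}"
proof -
  have "continuous_on UNIV (\<lambda>\<omega> :: 'm \<Rightarrow> 'a \<Rightarrow> bool. \<omega> i z)"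
    using continuous_on_product_then_coordinatewise
      [OF continuous_on_product_coordinates [of i]] .
  then have "open ((\<lambda>\<omega> :: 'm \<Rightarrow> 'a \<Rightarrow> bool. \<omega> i z) -` {b})"
    by (intro open_vimage) (simp_all add: Topological_Spaces.open_discrete)
  then show ?thesis by (simp add: vimage_def)
qed

text \<open>Around each configuration there is a cylinder on which \<open>f\<close> varies by less
  than \<epsilon> / 2 from its centre. Finitely many of them cover the compact space, and their
  coordinates together form \<open>P\<close>: agreement on \<open>P\<close> puts both configurations
  into the same cylinder.\<close>

lemma uniformly_cylindrical:
  fixes f :: "('m::finite \<Rightarrow> 'a \<Rightarrow> bool) \<Rightarrow> real"
  assumes f: "continuous_on UNIV f" and \<epsilon>: "\<epsilon> > 0"
  obtains P where "finite P" "\<And>\<omega> \<omega>'. (\<And>i z. (i, z) \<in> P \<Longrightarrow> \<omega> i z = \<omega>' i z) \<Longrightarrow> \<bar>f \<omega> - f \<omega>'\<bar> < \<epsilon>"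
proof -
  have "\<exists>P. finite P \<and> (\<forall>\<omega>'. (\<forall>i z. (i, z) \<in> P \<longrightarrow> \<omega>' i z = \<omega> i z) \<longrightarrow> \<bar>f \<omega>' - f \<omega>\<bar> < \<epsilon> / 2)" for \<omega>
  proof -
    have *: "open (f -` ball (f \<omega>) (\<epsilon> / 2))" "\<omega> \<in> f -` ball (f \<omega>) (\<epsilon> / 2)"
      using f \<epsilon> by (auto intro: open_vimage)
    obtain P where P: "finite P"
        "\<And>\<omega>'. (\<And>i z. (i, z) \<in> P \<Longrightarrow> \<omega>' i z = \<omega> i z) \<Longrightarrow> \<omega>' \<in> f -` ball (f \<omega>) (\<epsilon> / 2)"
      using open_configs_cylinder [OF *] by metis
    show ?thesis
    proof (intro exI [of _ P] conjI allI impI P(1))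
      fix \<omega>' assume "\<forall>i z. (i, z) \<in> P \<longrightarrow> \<omega>' i z = \<omega> i z"
      then have "\<omega>' \<in> f -` ball (f \<omega>) (\<epsilon> / 2)" by (intro P(2)) simp
      then show "\<bar>f \<omega>' - f \<omega>\<bar> < \<epsilon> / 2" by (simp add: dist_real_def abs_minus_commute)
    qed
  qed
  then obtain P where P: "\<And>\<omega>. finite (P \<omega>)"
      "\<And>\<omega> \<omega>'. (\<And>i z. (i, z) \<in> P \<omega> \<Longrightarrow> \<omega>' i z = \<omega> i z) \<Longrightarrow> \<bar>f \<omega>' - f \<omega>\<bar> < \<epsilon> / 2"
    by metis
  define C where "C \<omega> = (\<Inter>(i, z)\<in>P \<omega>. {\<omega>'. \<omega>' i z = \<omega> i z})" for \<omega>
  have "open (C \<omega>)" for \<omega>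
    unfolding C_def using P(1) by (intro open_INT) (auto intro: open_coordinate)
  moreover have "compact (UNIV :: ('m \<Rightarrow> 'a \<Rightarrow> bool) set)"
    by (intro compact_UNIV_fun finite_imp_compact) simp
  moreover have "UNIV \<subseteq> (\<Union>\<omega>. C \<omega>)" by (auto simp: C_def)
  ultimately obtain W where W: "finite W" "UNIV \<subseteq> (\<Union>\<omega>\<in>W. C \<omega>)"
    by (metis compactE_image)
  show thesis
  proof (rule that [of "\<Union>\<omega>\<in>W. P \<omega>"])
    show "finite (\<Union>\<omega>\<in>W. P \<omega>)" using W P(1) by auto
    fix \<omega> \<omega>' :: "'m \<Rightarrow> 'a \<Rightarrow> bool"
    assume eq: "\<And>i z. (i, z) \<in> (\<Union>\<omega>\<in>W. P \<omega>) \<Longrightarrow> \<omega> i z = \<omega>' i z"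
    obtain \<eta> where \<eta>: "\<eta> \<in> W" "\<omega> \<in> C \<eta>" using W(2) by auto
    have e: "\<omega> i z = \<eta> i z" if "(i, z) \<in> P \<eta>" for i z using that \<eta>(2) by (auto simp: C_def)
    then have e': "\<omega>' i z = \<eta> i z" if "(i, z) \<in> P \<eta>" for i z
      using that eq [of i z] \<eta>(1) by auto
    have "\<bar>f \<omega> - f \<eta>\<bar> < \<epsilon> / 2" by (rule P(2)) (rule e)
    moreover have "\<bar>f \<omega>' - f \<eta>\<bar> < \<epsilon> / 2" by (rule P(2)) (rule e')
    ultimately show "\<bar>f \<omega> - f \<omega>'\<bar> < \<epsilon>" by linarith
  qed
qed

text \<open>The function is replaced by its value at the configuration set to \<open>False\<close>
  outside \<open>P\<close>, which is a step function over the patterns on \<open>P\<close> and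
  uniformly close.\<close>

lemma integral_near_patterns:
  fixes f :: "('m \<Rightarrow> 'a \<Rightarrow> bool) \<Rightarrow> real" and \<mu> :: "('m \<Rightarrow> 'a \<Rightarrow> bool) measure"
  assumes "prob_space \<mu>" and sets: "sets \<mu> = sets borel"
    and f: "continuous_on UNIV f" "bounded (range f)" and P: "finite P"
    and near: "\<And>\<omega> \<omega>'. (\<And>i z. (i, z) \<in> P \<Longrightarrow> \<omega> i z = \<omega>' i z) \<Longrightarrow> \<bar>f \<omega> - f \<omega>'\<bar> < \<epsilon>"
  shows "\<bar>(\<integral>\<omega>. f \<omega> \<partial>\<mu>) - (\<Sum>\<sigma>\<in>Pow P. f (\<lambda>i z. (i, z) \<in> \<sigma>) * measure \<mu> {\<omega> \<in> space \<mu>.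
    (\<forall>p\<in>\<sigma>. \<omega> (fst p) (snd p)) \<and> (\<forall>p\<in>P - \<sigma>. \<not> \<omega> (fst p) (snd p))})\<bar> \<le> \<epsilon>"
proof -
  interpret prob_space \<mu> by fact
  define E where "E \<sigma> = {\<omega> :: 'm \<Rightarrow> 'a \<Rightarrow> bool. (\<forall>p\<in>\<sigma>. \<omega> (fst p) (snd p)) \<and>
    (\<forall>p\<in>P - \<sigma>. \<not> \<omega> (fst p) (snd p))}" for \<sigma>
  define h where "h \<omega> = (\<Sum>\<sigma>\<in>Pow P. f (\<lambda>i z. (i, z) \<in> \<sigma>) * indicator (E \<sigma>) \<omega>)" for \<omega>
  have space: "space \<mu> = UNIV" using sets_eq_imp_space_eq [OF sets] by simp
  have E_sets: "E \<sigma> \<in> sets \<mu>" if "\<sigma> \<subseteq> P" for \<sigma>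
  proof -
    have "E \<sigma> = (\<Inter>p\<in>\<sigma>. {\<omega>. \<omega> (fst p) (snd p) = True}) \<inter> (\<Inter>p\<in>P - \<sigma>. {\<omega>. \<omega> (fst p) (snd p) = False})"
      by (auto simp: E_def)
    then have "open (E \<sigma>)"
      using P finite_subset [OF that] by (auto intro!: open_Int open_INT open_coordinate simp del: eq_True eq_False)
    then show ?thesis by (simp add: sets)
  qed
  \<comment> \<open>Exactly one pattern \<sigma> agrees with \<omega> on \<open>P\<close>, so a
    single term of the sum survives.\<close>
  have h_eq: "h \<omega> = f (\<lambda>i z. (i, z) \<in> P \<and> \<omega> i z)" for \<omega>
  proof -
    let ?\<sigma> = "{p \<in> P. \<omega> (fst p) (snd p)}"
    have "h \<omega> = (\<Sum>\<sigma>\<in>Pow P. if \<sigma> = ?\<sigma> then f (\<lambda>i z. (i, z) \<in> \<sigma>) else 0)"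
      unfolding h_def by (intro sum.cong) (auto simp: E_def indicator_def)
    then show ?thesis using P by simp
  qed
  have close: "\<bar>f \<omega> - h \<omega>\<bar> \<le> \<epsilon>" for \<omega>
    unfolding h_eq by (intro less_imp_le near) simp
  obtain b where b: "\<And>\<omega>. \<bar>f \<omega>\<bar> \<le> b" using f(2) by (auto simp: bounded_iff)
  have "f \<in> borel_measurable borel" using f(1) by (rule borel_measurable_continuous_onI)
  then have f_meas: "f \<in> borel_measurable \<mu>" using measurable_cong_sets [OF sets refl] by blast
  have f_int: "integrable \<mu> f"
    using b f_meas by (intro integrable_const_bound [of _ b]) auto
  have E_int: "integrable \<mu> (indicator (E \<sigma>) :: _ \<Rightarrow> real)" if "\<sigma> \<in> Pow P" for \<sigma>
    using E_sets that by (intro integrable_real_indicator) (simp_all add: emeasure_eq_measure)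
  have h_int: "integrable \<mu> h"
    unfolding h_def by (intro Bochner_Integration.integrable_sum integrable_mult_right E_int)
  have "(\<integral>\<omega>. h \<omega> \<partial>\<mu>) = (\<Sum>\<sigma>\<in>Pow P. f (\<lambda>i z. (i, z) \<in> \<sigma>) * measure \<mu> (E \<sigma>))"
    unfolding h_def
    by (subst Bochner_Integration.integral_sum) (intro integrable_mult_right E_int, simp_all add: space)
  moreover have "\<bar>(\<integral>\<omega>. f \<omega> \<partial>\<mu>) - (\<integral>\<omega>. h \<omega> \<partial>\<mu>)\<bar> \<le> \<epsilon>"
  proof -
    have "(\<integral>\<omega>. f \<omega> \<partial>\<mu>) - (\<integral>\<omega>. h \<omega> \<partial>\<mu>) = (\<integral>\<omega>. f \<omega> - h \<omega> \<partial>\<mu>)"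
      using f_int h_int by simp
    also have "\<bar>\<dots>\<bar> \<le> (\<integral>\<omega>. \<bar>f \<omega> - h \<omega>\<bar> \<partial>\<mu>)" by (rule integral_abs_bound)
    also have "\<dots> \<le> \<epsilon>"
      using close f_int h_int by (intro integral_le_const) auto
    finally show ?thesis .
  qed
  ultimately show ?thesis by (simp add: E_def space)
qed

theorem weakly_converges_cylinders:
  fixes \<mu> :: "nat \<Rightarrow> ('m::finite \<Rightarrow> 'a \<Rightarrow> bool) measure"
  assumes \<mu>: "\<And>N. prob_space (\<mu> N)" "\<And>N. sets (\<mu> N) = sets borel"
    and \<nu>: "prob_space \<nu>" "sets \<nu> = sets borel"
    and lim: "\<And>K. (\<And>i. finite (K i)) \<Longrightarrow>
      (\<lambda>N. measure (\<mu> N) {\<omega>. \<forall>i. \<forall>z\<in>K i. \<omega> i z}) \<longlonglongrightarrow> measure \<nu> {\<omega>. \<forall>i. \<forall>z\<in>K i. \<omega> i z}"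
  shows "weakly_converges \<mu> \<nu>"
  unfolding weakly_converges_def
proof (intro allI impI, elim conjE)
  fix f :: "('m \<Rightarrow> 'a \<Rightarrow> bool) \<Rightarrow> real"
  assume f: "continuous_on UNIV f" "bounded (range f)"
  have space: "space (\<mu> N) = UNIV" "space \<nu> = UNIV" for N
    using sets_eq_imp_space_eq [OF \<mu>(2)] sets_eq_imp_space_eq [OF \<nu>(2)] by simp_all
  define B where "B p \<omega> = \<omega> (fst p) (snd p)" for p and \<omega> :: "'m \<Rightarrow> 'a \<Rightarrow> bool"
  have B_sets: "{\<omega> \<in> space M. B p \<omega>} \<in> sets M" if "sets M = sets borel" for M p
    using open_coordinate [of "fst p" "snd p" True] that sets_eq_imp_space_eq [OF that]
    by (simp add: B_def)
  \<comment> \<open>A finite set of pairs is cut into its sections, one finite set of sites for each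
    index.\<close>
  have lim_B: "(\<lambda>N. measure (\<mu> N) {\<omega> \<in> space (\<mu> N). \<forall>p\<in>P. B p \<omega>}) \<longlonglongrightarrow>
      measure \<nu> {\<omega> \<in> space \<nu>. \<forall>p\<in>P. B p \<omega>}" if "finite P" for P
  proof -
    have "finite (P `` {i})" for i using that by (rule finite_Image)
    moreover have "{\<omega>. \<forall>i. \<forall>z\<in>P `` {i}. \<omega> i z} = {\<omega>. \<forall>p\<in>P. B p \<omega>}" by (auto simp: B_def)
    ultimately show ?thesis using lim [of "\<lambda>i. P `` {i}"] by (simp add: space)
  qed
  have pattern: "(\<lambda>N. measure (\<mu> N) {\<omega> \<in> space (\<mu> N). (\<forall>p\<in>P. B p \<omega>) \<and> (\<forall>p\<in>Q. \<not> B p \<omega>)}) \<longlonglongrightarrow>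
      measure \<nu> {\<omega> \<in> space \<nu>. (\<forall>p\<in>P. B p \<omega>) \<and> (\<forall>p\<in>Q. \<not> B p \<omega>)}" if "finite P" "finite Q" for P Q
    using pattern_tendsto [of \<mu> B, OF _ B_sets lim_B that]
      finite_measure.measure_inclusion_exclusion [of \<nu> B, OF _ B_sets that] \<mu> \<nu>
    by (simp add: prob_space.finite_measure)
  show "(\<lambda>N. \<integral>\<omega>. f \<omega> \<partial>\<mu> N) \<longlonglongrightarrow> (\<integral>\<omega>. f \<omega> \<partial>\<nu>)"
  proof (rule LIMSEQ_I, unfold real_norm_def eventually_sequentially [symmetric])
    fix r :: real assume r: "r > 0"
    obtain P where P: "finite P"
        "\<And>\<omega> \<omega>'. (\<And>i z. (i, z) \<in> P \<Longrightarrow> \<omega> i z = \<omega>' i z) \<Longrightarrow> \<bar>f \<omega> - f \<omega>'\<bar> < r / 4"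
      using uniformly_cylindrical [OF f(1), of "r / 4"] r by (metis divide_pos_pos zero_less_numeral)
    define I where "I M = (\<Sum>\<sigma>\<in>Pow P. f (\<lambda>i z. (i, z) \<in> \<sigma>) * measure M {\<omega> \<in> space M.
      (\<forall>p\<in>\<sigma>. B p \<omega>) \<and> (\<forall>p\<in>P - \<sigma>. \<not> B p \<omega>)})" for M
    have "(\<lambda>N. I (\<mu> N)) \<longlonglongrightarrow> I \<nu>"
      unfolding I_def using P(1) by (intro tendsto_intros pattern) (auto intro: finite_subset)
    then have "eventually (\<lambda>N. dist (I (\<mu> N)) (I \<nu>) < r / 4) sequentially"
      using r by (intro tendstoD) auto
    then show "eventually (\<lambda>N. \<bar>(\<integral>\<omega>. f \<omega> \<partial>\<mu> N) - (\<integral>\<omega>. f \<omega> \<partial>\<nu>)\<bar> < r) sequentially"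
    proof eventually_elim
      case (elim N)
      have "\<bar>(\<integral>\<omega>. f \<omega> \<partial>\<mu> N) - I (\<mu> N)\<bar> \<le> r / 4"
        unfolding I_def B_def by (rule integral_near_patterns [OF \<mu> f P])
      moreover have "\<bar>(\<integral>\<omega>. f \<omega> \<partial>\<nu>) - I \<nu>\<bar> \<le> r / 4"
        unfolding I_def B_def by (rule integral_near_patterns [OF \<nu> f P])
      ultimately show ?case using elim r unfolding dist_real_def by linarith
    qed
  qed
qed

section \<open>Existence and uniqueness of the limit law\<close>

lemma sets_cylinder:
  assumes "finite K"
  shows "{\<omega>. \<forall>z\<in>K. \<omega> z} \<in> sets (PiM UNIV (\<lambda>_ :: 'a. count_space (UNIV :: bool set)))"
proof -
  have "{\<omega> \<in> space (PiM UNIV (\<lambda>_ :: 'a. count_space (UNIV :: bool set))). \<forall>z\<in>K. \<omega> z} \<in>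
      sets (PiM UNIV (\<lambda>_. count_space UNIV))"
    using assms by (intro sets.sets_Collect_finite_All) measurable
  then show ?thesis by (simp add: space_PiM)
qed

text \<open>The events "vacant on K" are closed under intersection, and they generate the algebra
  because the complement of a one-site event is the event that the site is occupied.\<close>

lemma config_measure_eqI:
  fixes Q Q' :: "('a \<Rightarrow> bool) measure"
  assumes Q: "prob_space Q" "sets Q = sets (PiM UNIV (\<lambda>_. count_space UNIV))"
    and Q': "prob_space Q'" "sets Q' = sets (PiM UNIV (\<lambda>_. count_space UNIV))"
    and eq: "\<And>K. finite K \<Longrightarrow> measure Q {\<omega>. \<forall>z\<in>K. \<omega> z} = measure Q' {\<omega>. \<forall>z\<in>K. \<omega> z}"
  shows "Q = Q'"
proof -
  interpret Q: prob_space Q by fact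
  interpret Q': prob_space Q' by fact
  let ?S = "PiM UNIV (\<lambda>_ :: 'a. count_space (UNIV :: bool set))"
  define G where "G = {{\<omega>. \<forall>z\<in>K. \<omega> z} | K :: 'a set. finite K}"
  have gen: "sets ?S = sigma_sets UNIV G"
  proof
    show "sigma_sets UNIV G \<subseteq> sets ?S"
      using sets_cylinder by (subst sets.sigma_sets_subset [of G ?S, unfolded space_PiM, simplified]) (auto simp: G_def)
    have coord: "{\<omega> :: 'a \<Rightarrow> bool. \<omega> z \<in> A} \<in> sigma_sets UNIV G" for z A
    proof -
      have "{\<omega>. \<forall>z\<in>{z}. \<omega> z} \<in> G" unfolding G_def by blast
      then have T: "{\<omega> :: 'a \<Rightarrow> bool. \<omega> z} \<in> sigma_sets UNIV G" by (auto intro: sigma_sets.Basic)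
      from sigma_sets.Compl [OF T] have F: "{\<omega> :: 'a \<Rightarrow> bool. \<not> \<omega> z} \<in> sigma_sets UNIV G"
        by (simp add: Compl_eq_Diff_UNIV [symmetric] Collect_neg_eq)
      consider "A = {}" | "A = {True}" | "A = {False}" | "A = UNIV"
        by (metis (full_types) UNIV_bool insert_commute UNIV_I empty_iff insert_iff set_eq_iff)
      then show ?thesis
        by cases (use T F sigma_sets_top sigma_sets.Empty in auto)
    qed
    have "(UNIV :: 'a set) \<rightarrow>\<^sub>E (UNIV :: bool set) = UNIV" by auto
    then show "sets ?S \<subseteq> sigma_sets UNIV G"
      unfolding sets_PiM_single space_count_space by (simp only:) (rule sigma_sets_mono, use coord in auto)
  qed
  show ?thesis
  proof (rule measure_eqI_generator_eq [where E = G and \<Omega> = UNIV and A = "\<lambda>_. UNIV"])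
    show "Int_stable G"
    proof (rule Int_stableI)
      fix a b assume "a \<in> G" "b \<in> G"
      then obtain K L where "finite K" "a = {\<omega>. \<forall>z\<in>K. \<omega> z}" "finite L" "b = {\<omega>. \<forall>z\<in>L. \<omega> z}"
        by (auto simp: G_def)
      then have "a \<inter> b = {\<omega>. \<forall>z\<in>K \<union> L. \<omega> z}" "finite (K \<union> L)" by auto
      then show "a \<inter> b \<in> G" unfolding G_def by blast
    qed
    show "range (\<lambda>_. UNIV) \<subseteq> G" unfolding G_def by (auto intro!: exI [of _ "{}"])
    show "emeasure Q X = emeasure Q' X" if "X \<in> G" for X
      using that eq by (auto simp: G_def Q.emeasure_eq_measure Q'.emeasure_eq_measure)
    show "emeasure Q UNIV \<noteq> \<infinity>" by simp
  qed (use Q(2) Q'(2) gen in auto)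
qed

text \<open>Encodes a finite pattern as a real function on \<open>J\<close>, so that Kolmogorov's
  theorem can be applied with real coordinates.\<close>

definition pattern_indicator :: "'a set \<Rightarrow> 'a set \<Rightarrow> 'a \<Rightarrow> real" where
  "pattern_indicator J \<sigma> = (\<lambda>z\<in>J. indicator \<sigma> z)"

text \<open>Inclusion-exclusion turns \<open>q\<close> into weights of finite patterns. That these
  are nonnegative and consistent is not visible from \<open>q\<close>; both properties pass to the
  limit from the approximating measures.\<close>

theorem config_limit_exists:
  fixes \<mu> :: "nat \<Rightarrow> ('a \<Rightarrow> bool) measure"
  assumes \<mu>: "\<And>N. prob_space (\<mu> N)" "\<And>N. sets (\<mu> N) = sets (PiM UNIV (\<lambda>_. count_space UNIV))"
    and lim: "\<And>K. finite K \<Longrightarrow> (\<lambda>N. measure (\<mu> N) {\<omega>. \<forall>z\<in>K. \<omega> z}) \<longlonglongrightarrow> q K"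
  obtains Q where "prob_space Q" "sets Q = sets (PiM UNIV (\<lambda>_. count_space UNIV))"
    "\<And>K. finite K \<Longrightarrow> measure Q {\<omega>. \<forall>z\<in>K. \<omega> z} = q K"
proof -
  interpret \<mu>: prob_space "\<mu> N" for N by (rule \<mu>(1))
  have space: "space (\<mu> N) = UNIV" for N
    using sets_eq_imp_space_eq [OF \<mu>(2) [of N]] by (simp add: space_PiM)
  define E where "E J \<sigma> = {\<omega> :: 'a \<Rightarrow> bool. (\<forall>z\<in>\<sigma>. \<omega> z) \<and> (\<forall>z\<in>J - \<sigma>. \<not> \<omega> z)}" for J \<sigma>
  define w where "w J \<sigma> = (\<Sum>S\<in>Pow (J - \<sigma>). (-1) ^ card S * q (\<sigma> \<union> S))" for J \<sigma>
  have coord: "{\<omega> \<in> space (\<mu> N). \<omega> z} \<in> sets (\<mu> N)" for N z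
    using sets_cylinder [of "{z}"] by (simp add: \<mu>(2) space)
  have E_lim: "(\<lambda>N. measure (\<mu> N) (E J \<sigma>)) \<longlonglongrightarrow> w J \<sigma>" if "finite J" "\<sigma> \<subseteq> J" for J \<sigma>
    using pattern_tendsto [of \<mu> "\<lambda>z \<omega>. \<omega> z" q \<sigma> "J - \<sigma>"] that coord lim
    by (simp add: space E_def w_def \<mu>.finite_measure_axioms finite_subset)
  have E_sets: "E J \<sigma> \<in> sets (\<mu> N)" if "finite J" "\<sigma> \<subseteq> J" for J \<sigma> N
  proof -
    have "{\<omega> \<in> space (\<mu> N). (\<forall>z\<in>\<sigma>. \<omega> z) \<and> (\<forall>z\<in>J - \<sigma>. \<not> \<omega> z)} \<in> sets (\<mu> N)"
      using that finite_subset
      by (intro sets.sets_Collect_conj sets.sets_Collect_finite_All sets.sets_Collect_neg coord) auto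
    then show ?thesis by (simp add: E_def space)
  qed
  have w_nonneg: "0 \<le> w J \<sigma>" if "finite J" "\<sigma> \<subseteq> J" for J \<sigma>
    using E_lim [OF that] by (rule LIMSEQ_le_const) auto
  \<comment> \<open>Consistency: the event of a pattern on \<open>J\<close> is the disjoint union
    over its extensions to \<open>H\<close>.\<close>
  have w_sum: "(\<Sum>\<tau>\<in>{\<tau> \<in> Pow H. \<tau> \<inter> J = \<sigma>}. w H \<tau>) = w J \<sigma>"
    if "finite H" "J \<subseteq> H" "\<sigma> \<subseteq> J" for H J \<sigma>
  proof (rule LIMSEQ_unique)
    have "measure (\<mu> N) (E J \<sigma>) = (\<Sum>\<tau>\<in>{\<tau> \<in> Pow H. \<tau> \<inter> J = \<sigma>}. measure (\<mu> N) (E H \<tau>))" for N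
    proof -
      have "E J \<sigma> = (\<Union>\<tau>\<in>{\<tau> \<in> Pow H. \<tau> \<inter> J = \<sigma>}. E H \<tau>)"
      proof (intro set_eqI iffI)
        fix \<omega> assume "\<omega> \<in> E J \<sigma>"
        then show "\<omega> \<in> (\<Union>\<tau>\<in>{\<tau> \<in> Pow H. \<tau> \<inter> J = \<sigma>}. E H \<tau>)"
          using that by (intro UN_I [of "{z \<in> H. \<omega> z}"]) (auto simp: E_def)
      qed (use that in \<open>auto simp: E_def\<close>)
      moreover have "disjoint_family_on (E H) {\<tau> \<in> Pow H. \<tau> \<inter> J = \<sigma>}"
        by (auto simp: disjoint_family_on_def E_def)
      ultimately show ?thesis
        using that E_sets [of H] by (simp add: \<mu>.finite_measure_finite_Union image_subset_iff)
    qed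
    then show "(\<lambda>N. measure (\<mu> N) (E J \<sigma>)) \<longlonglongrightarrow> (\<Sum>\<tau>\<in>{\<tau> \<in> Pow H. \<tau> \<inter> J = \<sigma>}. w H \<tau>)"
      using that by (simp only:) (intro tendsto_sum E_lim, auto)
    show "(\<lambda>N. measure (\<mu> N) (E J \<sigma>)) \<longlonglongrightarrow> w J \<sigma>"
      using that by (intro E_lim) (auto intro: finite_subset)
  qed
  have w_empty: "w {} {} = 1"
  proof -
    have "(\<lambda>N. measure (\<mu> N) (E {} {})) \<longlonglongrightarrow> w {} {}" by (intro E_lim) auto
    moreover have "measure (\<mu> N) (E {} {}) = 1" for N
      using \<mu>.prob_space [of N] by (simp add: E_def space)
    ultimately show ?thesis by (simp add: LIMSEQ_const_iff)
  qed
  define p where "p J = point_measure (Pow J) (\<lambda>\<sigma>. ennreal (w J \<sigma>))" for J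
  define P where "P J = distr (p J) (PiM J (\<lambda>_. borel :: real measure)) (pattern_indicator J)" for J
  have pat_space: "pattern_indicator J \<sigma> \<in> space (PiM J (\<lambda>_. borel))" for J \<sigma>
    by (auto simp: pattern_indicator_def space_PiM)
  have pat_meas: "pattern_indicator J \<in> measurable (p J) (PiM J (\<lambda>_. borel))" for J
    using pat_space by (auto simp: p_def measurable_point_measure_eq1)
  \<comment> \<open>For patterns given as sets, restriction is intersection with \<open>J\<close>.
    Consistency is checked here on a finite space and then carried over to real functions.\<close>
  have p_restrict: "p J = distr (p H) (count_space (Pow J)) (\<lambda>\<tau>. \<tau> \<inter> J)" if "finite H" "J \<subseteq> H" for H J
  proof (rule measure_eqI_finite [of _ "Pow J"])
    have J: "finite J" using that finite_subset by blast
    then show "finite (Pow J)" by simp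
    fix \<sigma> assume \<sigma>: "\<sigma> \<in> Pow J"
    have "emeasure (distr (p H) (count_space (Pow J)) (\<lambda>\<tau>. \<tau> \<inter> J)) {\<sigma>} =
        emeasure (p H) {\<tau> \<in> Pow H. \<tau> \<inter> J = \<sigma>}"
      using \<sigma> by (subst emeasure_distr) (auto simp: p_def space_point_measure measurable_point_measure_eq1 intro!: arg_cong2 [where f = emeasure])
    also have "\<dots> = (\<Sum>\<tau>\<in>{\<tau> \<in> Pow H. \<tau> \<inter> J = \<sigma>}. ennreal (w H \<tau>))"
      using that unfolding p_def by (intro emeasure_point_measure_finite) auto
    also have "\<dots> = ennreal (w J \<sigma>)"
      using w_sum [of H J \<sigma>] that \<sigma> w_nonneg [of H] by (subst sum_ennreal) auto
    also have "\<dots> = emeasure (p J) {\<sigma>}"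
      using J \<sigma> unfolding p_def by (subst emeasure_point_measure_finite) auto
    finally show "emeasure (p J) {\<sigma>} = emeasure (distr (p H) (count_space (Pow J)) (\<lambda>\<tau>. \<tau> \<inter> J)) {\<sigma>}" ..
  qed (simp_all add: p_def sets_point_measure)
  interpret polish_projective UNIV P
  proof (intro polish_projective.intro projective_family.intro)
    fix J H :: "'a set" assume JH: "J \<subseteq> H" "finite H"
    have "distr (P H) (PiM J (\<lambda>_. borel)) (\<lambda>f. restrict f J) =
        distr (p H) (PiM J (\<lambda>_. borel)) ((\<lambda>f. restrict f J) \<circ> pattern_indicator H)"
      unfolding P_def using JH by (intro distr_distr measurable_restrict_subset pat_meas)
    also have "(\<lambda>f. restrict f J) \<circ> pattern_indicator H = pattern_indicator J \<circ> (\<lambda>\<tau>. \<tau> \<inter> J)"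
      using JH by (auto simp: pattern_indicator_def fun_eq_iff indicator_def)
    also have "distr (p H) (PiM J (\<lambda>_. borel)) (pattern_indicator J \<circ> (\<lambda>\<tau>. \<tau> \<inter> J)) =
        distr (distr (p H) (count_space (Pow J)) (\<lambda>\<tau>. \<tau> \<inter> J)) (PiM J (\<lambda>_. borel)) (pattern_indicator J)"
      using pat_space by (intro distr_distr [symmetric]) (auto simp: p_def measurable_point_measure_eq1)
    also have "\<dots> = P J"
      unfolding P_def using p_restrict JH by metis
    finally show "P J = distr (P H) (PiM J (\<lambda>_. borel)) (\<lambda>f. restrict f J)" ..
  next
    fix J :: "'a set" assume J: "finite J"
    have "emeasure (p J) (Pow J) = ennreal (\<Sum>\<sigma>\<in>Pow J. w J \<sigma>)"
      using J w_nonneg [OF J] unfolding p_def by (subst emeasure_point_measure_finite) (auto intro: sum_ennreal)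
    also have "(\<Sum>\<sigma>\<in>Pow J. w J \<sigma>) = 1"
      using w_sum [OF J, of "{}" "{}"] w_empty by (simp add: Pow_def)
    finally have "prob_space (p J)"
      by (intro prob_spaceI) (simp add: p_def space_point_measure)
    then show "prob_space (P J)"
      unfolding P_def by (intro prob_space.prob_space_distr pat_meas)
  qed
  \<comment> \<open>Returns from real coordinates to truth values; a site is vacant when its
    coordinate is 1.\<close>
  define Q where "Q = distr lim (PiM UNIV (\<lambda>_. count_space UNIV)) (\<lambda>\<omega> z. \<omega> z = 1)"
  have Q_meas: "(\<lambda>\<omega> z. \<omega> z = 1) \<in> measurable lim (PiM UNIV (\<lambda>_. count_space UNIV))"
  proof (rule measurable_PiM_single')
    fix z :: 'a
    have "(\<lambda>\<omega>. \<omega> z) \<in> measurable lim borel"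
      using measurable_cong_sets [OF sets_lim refl] measurable_component_singleton [of z UNIV "\<lambda>_. borel :: real measure"] by blast
    then show "(\<lambda>\<omega>. \<omega> z = 1) \<in> measurable lim (count_space UNIV)" by measurable
  qed (simp add: space_PiM)
  show thesis
  proof (rule that [of Q])
    show "prob_space Q"
      unfolding Q_def by (intro P.prob_space_distr Q_meas)
    show "sets Q = sets (PiM UNIV (\<lambda>_. count_space UNIV))" by (simp add: Q_def)
    fix K :: "'a set" assume K: "finite K"
    have box: "PiE K (\<lambda>_. {1}) \<in> sets (PiM K (\<lambda>_. borel :: real measure))"
      using K by (intro sets_PiM_I_finite) auto
    have emb: "prod_emb UNIV (\<lambda>_. borel) K (PiE K (\<lambda>_. {1})) = {\<omega> :: 'a \<Rightarrow> real. \<forall>z\<in>K. \<omega> z = 1}"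
      using K by (subst prod_emb_PiE) (auto simp: PiE_UNIV_domain Pi_iff split: if_splits)
    have "emeasure Q {\<omega>. \<forall>z\<in>K. \<omega> z} = emeasure lim (prod_emb UNIV (\<lambda>_. borel) K (PiE K (\<lambda>_. {1})))"
      unfolding emb Q_def using sets_cylinder [OF K]
      by (subst emeasure_distr [OF Q_meas])
        (auto simp: space_PiM intro!: arg_cong2 [where f = emeasure])
    also have "\<dots> = emeasure (P K) (PiE K (\<lambda>_. {1}))"
      using K box by (intro emeasure_lim_emb) auto
    also have "\<dots> = emeasure (p K) {K}"
    proof -
      have "pattern_indicator K \<sigma> \<in> PiE K (\<lambda>_. {1}) \<longleftrightarrow> \<sigma> = K" if "\<sigma> \<subseteq> K" for \<sigma>
        unfolding pattern_indicator_def PiE_iff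
        using that by (auto simp: indicator_def split: if_splits)
      then have "pattern_indicator K -` PiE K (\<lambda>_. {1}) \<inter> space (p K) = {K}"
        by (auto simp: p_def space_point_measure)
      then show ?thesis unfolding P_def emeasure_distr [OF pat_meas box] by simp
    qed
    also have "\<dots> = ennreal (w K K)"
      using K unfolding p_def by (subst emeasure_point_measure_finite) auto
    finally show "measure Q {\<omega>. \<forall>z\<in>K. \<omega> z} = q K"
      using w_nonneg [OF K subset_refl] by (simp add: measure_def w_def)
  qed
qed

section \<open>The law of the vacant set of random interlacements and the final convergence\<close>

lemma space_config_algebra [simp]: "space config_algebra = UNIV"
  by (simp add: config_algebra_def space_PiM)

lemma measurable_vacant_config:
  "vacant_config N x t \<in> measurable (torus_walk N) (config_algebra :: 'd::finite config measure)"
  unfolding config_algebra_def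
proof (rule measurable_PiM_single')
  fix z :: "int ^ 'd"
  have "(\<lambda>X. vacant_config N x t X z) = (\<lambda>X. \<forall>k\<le>nat \<lfloor>t\<rfloor>. X k \<notin> {torus_add N (torus_proj N z) x})"
    by (auto simp: vacant_config_def)
  then show "(\<lambda>X. vacant_config N x t X z) \<in> measurable (torus_walk N) (count_space UNIV)"
    by (simp only:) (rule pred_torus_walk_avoid)
qed (simp add: space_PiM)

lemma interlacement_law_exists:
  assumes u: "u > 0" and d: "CARD('d::finite) \<ge> 3"
  shows "\<exists>Q :: 'd config measure. prob_space Q \<and> sets Q = sets config_algebra \<and>
    (\<forall>K. finite K \<longrightarrow> measure Q {\<omega> \<in> space Q. \<forall>x\<in>K. \<omega> x} = exp (- u * capacity K))"
proof -
  \<comment> \<open>The configurations seen from the origin. The side is N + 1 so that no torus in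
    the sequence is empty.\<close>
  define \<mu> where "\<mu> N = distr (torus_walk (Suc N)) config_algebra
    (vacant_config (Suc N) (0 :: int ^ 'd) (u * real (Suc N) ^ CARD('d)))" for N
  have prob: "prob_space (\<mu> N)" for N
    unfolding \<mu>_def by (intro prob_space.prob_space_distr prob_space_torus_walk measurable_vacant_config) simp
  have sets: "sets (\<mu> N) = sets (PiM UNIV (\<lambda>_. count_space UNIV))" for N
    by (simp add: \<mu>_def config_algebra_def)
  have lim: "(\<lambda>N. measure (\<mu> N) {\<omega>. \<forall>z\<in>K. \<omega> z}) \<longlonglongrightarrow> exp (- u * capacity K)" if K: "finite K" for K
  proof -
    \<comment> \<open>With a single index the infimum over pairs is taken over the empty set and
      equals infinity, so the distance condition holds.\<close>
    have "(\<lambda>N. measure (torus_walk N) {X \<in> space (torus_walk N).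
        \<forall>i :: unit. \<forall>z\<in>K. vacant_config N 0 (u * real N ^ CARD('d)) X z})
      \<longlonglongrightarrow> exp (- u * (\<Sum>i\<in>(UNIV :: unit set). capacity K))"
      using K by (intro vacant_probability_tendsto u d) (auto simp: torus_def top_ereal_def)
    then have "(\<lambda>N. measure (torus_walk (Suc N)) {X \<in> space (torus_walk (Suc N)).
        \<forall>z\<in>K. vacant_config (Suc N) 0 (u * real (Suc N) ^ CARD('d)) X z}) \<longlonglongrightarrow> exp (- u * capacity K)"
      by (simp only: UNIV_unit sum.insert sum.empty finite.emptyI empty_iff not_False_eq_True
          add_0_right simp_thms all_simps) (rule LIMSEQ_Suc)
    moreover have "measure (\<mu> N) {\<omega>. \<forall>z\<in>K. \<omega> z} = measure (torus_walk (Suc N)) {X \<in> space (torus_walk (Suc N)).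
        \<forall>z\<in>K. vacant_config (Suc N) 0 (u * real (Suc N) ^ CARD('d)) X z}" for N
      unfolding \<mu>_def using sets_cylinder [OF K]
      by (subst measure_distr [OF measurable_vacant_config])
        (auto simp: config_algebra_def intro!: arg_cong2 [where f = measure])
    ultimately show ?thesis by simp
  qed
  obtain Q :: "'d config measure" where Q: "prob_space Q" "sets Q = sets (PiM UNIV (\<lambda>_. count_space UNIV))"
      "\<And>K. finite K \<Longrightarrow> measure Q {\<omega>. \<forall>z\<in>K. \<omega> z} = exp (- u * capacity K)"
    using config_limit_exists [OF prob sets lim] by blast
  moreover have "space Q = UNIV"
    using sets_eq_imp_space_eq [OF Q(2)] by (simp add: space_PiM)
  ultimately show ?thesis by (intro exI [of _ Q]) (simp add: config_algebra_def)
qed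

text \<open>Existence together with uniqueness ensures that the definite description denotes a law
  with the prescribed properties.\<close>

lemma interlacement_law:
  assumes u: "u > 0" and d: "CARD('d::finite) \<ge> 3"
  shows "prob_space (interlacement_law u :: 'd config measure)"
    and "sets (interlacement_law u) = sets (config_algebra :: 'd config measure)"
    and "finite K \<Longrightarrow> measure (interlacement_law u) {\<omega> :: 'd config. \<forall>x\<in>K. \<omega> x} = exp (- u * capacity K)"
proof -
  define good where "good Q \<longleftrightarrow> prob_space Q \<and> sets Q = sets config_algebra \<and>
    (\<forall>K. finite K \<longrightarrow> measure Q {\<omega> \<in> space Q. \<forall>x\<in>K. \<omega> x} = exp (- u * capacity K))"
    for Q :: "'d config measure"
  have space: "space Q = UNIV" if "sets Q = sets config_algebra" for Q :: "'d config measure"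
    using sets_eq_imp_space_eq [OF that] by simp
  have "\<exists>Q. good Q" unfolding good_def by (rule interlacement_law_exists [OF u d])
  moreover have "Q = Q'" if "good Q" "good Q'" for Q Q'
    by (rule config_measure_eqI) (use that space in \<open>auto simp: good_def config_algebra_def\<close>)
  ultimately have "\<exists>!Q. good Q" by blast
  then have "good (THE Q. good Q)" by (rule theI')
  then have good: "good (interlacement_law u)" by (simp add: interlacement_law_def good_def)
  then show sets: "sets (interlacement_law u) = sets (config_algebra :: 'd config measure)"
    and "prob_space (interlacement_law u :: 'd config measure)"
    by (simp_all add: good_def)
  show "measure (interlacement_law u) {\<omega> :: 'd config. \<forall>x\<in>K. \<omega> x} = exp (- u * capacity K)" if "finite K"
    using good that space [OF sets] by (simp add: good_def)
qed

theorem theorem1p1: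
  fixes u :: real and x :: "nat \<Rightarrow> 'm::finite \<Rightarrow> int ^ 'd::finite"
  assumes "u > 0"
    and "CARD('d) \<ge> 3"
    and "\<And>N i. N \<ge> 1 \<Longrightarrow> x N i \<in> torus N"
    and "(\<lambda>N. INF (i, j)\<in>{(i, j). i \<noteq> j}. ereal (real (torus_dist N (x N i) (x N j))))
           \<longlonglongrightarrow> \<infinity>"
  shows "weakly_converges
    (\<lambda>N. distr (torus_walk N) (PiM UNIV (\<lambda>_::'m. config_algebra))
       (\<lambda>X i. vacant_config N (x N i) (u * real N ^ CARD('d)) X))
    (PiM UNIV (\<lambda>_::'m. interlacement_law u))"
proof -
  define \<mu> where "\<mu> N = distr (torus_walk N) (PiM UNIV (\<lambda>_::'m. config_algebra))
    (\<lambda>X i. vacant_config N (x N i) (u * real N ^ CARD('d)) X)" for N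
  define \<nu> where "\<nu> = PiM UNIV (\<lambda>_::'m. interlacement_law u :: 'd config measure)"
  note law = interlacement_law [OF assms(1,2)]
  interpret Q: prob_space "interlacement_law u :: 'd config measure" by (rule law(1))
  interpret prod: finite_product_prob_space "\<lambda>_. interlacement_law u :: 'd config measure" "UNIV :: 'm set"
    by unfold_locales simp
  have meas: "(\<lambda>X i. vacant_config N (x N i) (u * real N ^ CARD('d)) X) \<in>
      measurable (torus_walk N) (PiM UNIV (\<lambda>_::'m. config_algebra))" for N
    by (rule measurable_PiM_single') (simp_all add: measurable_vacant_config space_PiM)
  have cylinder_sets: "{\<omega>. \<forall>i. \<forall>z\<in>K i. \<omega> i z} \<in> sets (PiM UNIV (\<lambda>_::'m. config_algebra :: 'd config measure))"
    if "\<And>i. finite (K i)" for K :: "'m \<Rightarrow> (int ^ 'd) set"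
  proof -
    have "PiE UNIV (\<lambda>i. {\<eta>. \<forall>z\<in>K i. \<eta> z}) \<in> sets (PiM UNIV (\<lambda>_::'m. config_algebra :: 'd config measure))"
      using sets_cylinder [OF that] by (intro sets_PiM_I_finite) (simp_all add: config_algebra_def)
    then show ?thesis by (simp add: PiE_UNIV_domain Pi_def)
  qed
  \<comment> \<open>The index 0 is skipped because the torus is empty there; the limit of the full
    sequence is recovered at the end.\<close>
  have "weakly_converges (\<lambda>N. \<mu> (Suc N)) \<nu>"
  proof (rule weakly_converges_cylinders)
    show "prob_space (\<mu> (Suc N))" for N
      unfolding \<mu>_def by (intro prob_space.prob_space_distr prob_space_torus_walk meas) simp
    show "sets (\<mu> (Suc N)) = sets borel" for N
      by (simp add: \<mu>_def sets_PiM_config_algebra)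
    show "prob_space \<nu>" unfolding \<nu>_def by unfold_locales
    show "sets \<nu> = sets borel"
      unfolding \<nu>_def sets_PiM_config_algebra [symmetric] using law(2) by (intro sets_PiM_cong) auto
    fix K :: "'m \<Rightarrow> (int ^ 'd) set" assume K: "\<And>i. finite (K i)"
    have "(\<lambda>N. measure (torus_walk N) {X \<in> space (torus_walk N).
        \<forall>i. \<forall>z\<in>K i. vacant_config N (x N i) (u * real N ^ CARD('d)) X z})
      \<longlonglongrightarrow> exp (- u * (\<Sum>i\<in>UNIV. capacity (K i)))"
      by (rule vacant_probability_tendsto [OF assms K])
    moreover have "measure (\<mu> N) {\<omega>. \<forall>i. \<forall>z\<in>K i. \<omega> i z} = measure (torus_walk N) {X \<in> space (torus_walk N).
        \<forall>i. \<forall>z\<in>K i. vacant_config N (x N i) (u * real N ^ CARD('d)) X z}" for N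
      unfolding \<mu>_def
      by (subst measure_distr [OF meas cylinder_sets [OF K]]) (auto intro!: arg_cong2 [where f = measure])
    moreover have "measure \<nu> {\<omega>. \<forall>i. \<forall>z\<in>K i. \<omega> i z} = exp (- u * (\<Sum>i\<in>UNIV. capacity (K i)))"
    proof -
      have "{\<eta> :: 'd config. \<forall>z\<in>K i. \<eta> z} \<in> sets (interlacement_law u)" for i
        using sets_cylinder [OF K] by (simp add: law(2) config_algebra_def)
      then have "measure \<nu> (PiE UNIV (\<lambda>i. {\<eta>. \<forall>z\<in>K i. \<eta> z})) = (\<Prod>i\<in>UNIV. exp (- u * capacity (K i)))"
        unfolding \<nu>_def by (subst prod.finite_measure_PiM_emb) (simp_all add: law(3) K)
      also have "PiE UNIV (\<lambda>i. {\<eta>. \<forall>z\<in>K i. \<eta> z}) = {\<omega>. \<forall>i. \<forall>z\<in>K i. \<omega> i z}"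
        by (simp add: PiE_UNIV_domain Pi_def)
      finally show ?thesis by (simp add: exp_sum [symmetric] sum_distrib_left sum_negf)
    qed
    ultimately have "(\<lambda>N. measure (\<mu> N) {\<omega>. \<forall>i. \<forall>z\<in>K i. \<omega> i z}) \<longlonglongrightarrow>
        measure \<nu> {\<omega>. \<forall>i. \<forall>z\<in>K i. \<omega> i z}"
      by simp
    then show "(\<lambda>N. measure (\<mu> (Suc N)) {\<omega>. \<forall>i. \<forall>z\<in>K i. \<omega> i z}) \<longlonglongrightarrow>
        measure \<nu> {\<omega>. \<forall>i. \<forall>z\<in>K i. \<omega> i z}"
      by (rule LIMSEQ_Suc)
  qed
  then have shifted: "(\<lambda>N. \<integral>\<omega>. f \<omega> \<partial>\<mu> (Suc N)) \<longlonglongrightarrow> (\<integral>\<omega>. f \<omega> \<partial>\<nu>)"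
    if "continuous_on UNIV f \<and> bounded (range f)" for f :: "('m \<Rightarrow> 'd config) \<Rightarrow> real"
    using that unfolding weakly_converges_def by (elim allE impE)
  have "weakly_converges \<mu> \<nu>"
    unfolding weakly_converges_def
    by (intro allI impI) (rule LIMSEQ_imp_Suc, rule shifted)
  then show ?thesis by (simp only: \<mu>_def [abs_def] \<nu>_def)
qed

end
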